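(* Assume that for every integer $k\ge1$, every $\ell\in\{1,\dots,k\}$, every $k$-bounded partition $\lambda$ and every copy $\mathbb A_T^{(k)}$ of the super atom $\mathbb A_\lambda^{(k)}$, there is a tableau $T'$ of shape $\lambda\cup(\ell^{k-\ell+1})$ such that $\mathbb B_{(\ell^{k-\ell+1})}\,\mathbb A_T^{(k)}=\mathbb A_{T'}^{(k)}$ is a copy of $\mathbb A^{(k)}_{\lambda\cup(\ell^{k-\ell+1})}$. Write $A_\lambda^{(k)}=A_\lambda^{(k)}[X;1]$. Then for every $k\ge1$, every $k$-bounded partition $\lambda$ and every $\ell\in\{1,\dots,k\}$, $$S_{(\ell^{k-\ell+1})}\,A_\lambda^{(k)}=A^{(k)}_{\lambda\cup(\ell^{k-\ell+1})}.$$
   Context: $(\ell^h)$ is the rectangular partition with $h$ parts equal to $\ell$; $\lambda\cup\mu$ is the partition rearrangement of the parts of $\lambda$ and $\mu$. Tableaux. Diagrams of partitions are drawn with row $i$ (counted from the bottom) of length $\lambda_i$. $\ell(\lambda)$ is the number of nonzero parts, and $\lambda$ is $k$-bounded if $\lambda_1\le k$. A tableau is a filling of a partition diagram by positive integers, nondecreasing along rows (left to right) and strictly increasing up columns. It is identified with its reading word, obtained by reading rows left to right, from the top row to the bottom row. The evaluation of a word is $(\rho_1,\rho_2,\dots)$, $\rho_i$ being the number of letters $i$. $\equiv$ denotes Knuth (plactic) equivalence: $acb\equiv cab$ for $a\le b<c$ and $bac\equiv bca$ for $a<b\le c$. Every word is Knuth equivalent to a unique tableau. $\mathbb H_0$ is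 the empty tableau. Sets of tableaux are identified with formal sums of their elements, and operators are extended linearly. Symmetric group action. $\sigma_i$ acts on a word through its subword in the letters $i,i+1$: successively pair every factor $(i+1)\,i$ (ignoring already paired letters) until the unpaired letters form $i^r(i+1)^s$; replace these by $i^s(i+1)^r$. This gives an action of the symmetric group on words, sending tableaux to tableaux of the same shape. Promotion. For $T$ of evaluation $(\lambda_1,\dots,\lambda_m)$, $\mathbb B_r(T)=\sigma_1\cdots\sigma_m\,\mathbb R_r T$, where $\mathbb R_rT$ is the sum of all tableaux obtained by adding to $T$ a horizontal $r$-strip of letters $m+1$. Rectangular promotion. The operator $\sigma_1^{(h)}$ acts on words $w$ in the letters $1,\dots,h+1$: let $(P(w),Q(w))$ be the Robinson–Schensted pair of $w$ ($P(w)$ the tableau Knuth equivalent to $w$, $Q(w)$ standard); let $w''$ be obtained from $w$ by erasing all letters $1$ and decreasing the others by $1$; the shape of $P(w'')$ differs from that of $P(w)$ by a horizontal strip; let $T'$ be obtained from $P(w'')$ by filling this strip with letters $h+1$; then $\sigma_1^{(h)}(w)$ is the word $w'$ with $(P(w'),Q(w'))=(T',Q(w))$. $\sigma_i^{(h)}$ acts on a word by applying the same operation (with letters shifted by $i-1$) to its subword in the letters $i,\dots,i+h$, leaving other letters in place. For $T$ of evaluation $(\lambda_1,\dots,\lambda_m)$, $\mathbb B_{(\ell^h)}(T)=\sigma_1^{(h)}\cdots\sigma_m^{(h)}\,\mathbb R_{(\ell^h)}T$, where $\mathbb R_{(\ell^h)}T$ is the sum of all tableaux obtained from $T$ by adding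 a horizontal $\ell$-strip of letters $m+1$, then a horizontal $\ell$-strip of letters $m+2$, ..., then a horizontal $\ell$-strip of letters $m+h$, such that the tableau is Yamanouchi in the added letters (every right factor of its reading word contains at least as many letters $m+i$ as letters $m+j$ for $1\le i<j\le h$). Filtering. The main hook-length is $h_M(\lambda)=\lambda_1+\ell(\lambda)-1$. The $k$-split of a $k$-bounded $\lambda$ is the sequence $\lambda^{\to k}=(\lambda^{(1)},\dots,\lambda^{(r)})$ obtained by cutting $\lambda$ (keeping the order of its parts) into consecutive partitions with $h_M(\lambda^{(i)})=k$ for all $i\ne r$ (the last one may have main hook-length less than $k$). For a tableau $T$ whose shape contains $\lambda$, let $T_\lambda$ be its subtableau of shape $\lambda$, $T_1$ the part of $T$ outside $T_\lambda$ in the first $\ell(\lambda)$ rows, $T_2$ the part of $T$ above those rows, and $\overline T$ the unique tableau Knuth equivalent to the word $T_1T_2$ (reading word of $T_1$ followed by that of $T_2$). $S(\lambda)$ is the set of tableaux of shape $\lambda$ and evaluation $(0^m,\lambda_1,\lambda_2,\dots)$, $m\in\mathbb N$. The restricted $\lambda$-katabolism is $\overline{\mathbb K}_\lambda(T)=\overline T$ if $\lambda\subseteq\mathrm{shape}(T)$ and $T_\lambda\in S(\lambda)$, and $0$ otherwise. For $S=(\lambda^{(1)},\dots,\lambda^{(r)})$, $\mathbb P_S(T)=T$ if $\overline{\mathbb K}_{\lambda^{(r)}}\cdots\overline{\mathbb K}_{\lambda^{(1)}}(T)=\mathbb H_0$, and $0$ otherwise. Super atoms. $\mathbb A^{(k)}_0=\mathbb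 H_0$ and, for a $k$-bounded partition $\lambda$, $\mathbb A_\lambda^{(k)}=\mathbb P_{\lambda^{\to k}}\,\mathbb B_{\lambda_1}\big(\mathbb A^{(k)}_{(\lambda_2,\lambda_3,\dots)}\big)$. Charge. For a word $w$ whose evaluation is a partition: read $w$ from right to left, cyclically. Starting at the right end with label $\ell=0$, label with $\ell$ the first $1$ met, then the first $2$ met after it, then the first $3$ after that, etc., increasing $\ell$ by $1$ each time one passes from the left end of $w$ back to its right end. When the letters are exhausted repeat on the unlabeled letters, again from the right end with $\ell=0$, until all letters are labeled. $\mathrm{charge}(w)$ is the sum of the labels. If the evaluation is not a partition, first apply a permutation $\sigma$ (via the $\sigma_i$) making it one and set $\mathrm{charge}(w)=\mathrm{charge}(\sigma w)$. Atoms. $S_\lambda=S_\lambda[X]$ is the Schur function in $X=x_1+x_2+\cdots$. $\digamma$ is the linear map $\digamma(T)=t^{\mathrm{charge}(T)}S_{\mathrm{shape}(T)}[X]$, and $A_\lambda^{(k)}[X;t]=\digamma(\mathbb A_\lambda^{(k)})$. Cyclage posets and copies. If a tableau word is $T=xw$ with $x$ a letter that is not the smallest letter of $T$, the cyclage of $T$ is the tableau Knuth equivalent to $wx$; if $T=wx$ with $x$ not the smallest letter of $T$, the cocyclage of $T$ is the tableau Knuth equivalent to $xw$. On tableaux of partition evaluation a cyclage raises charge by $1$ and a cocyclage lowers it by $1$. For a set $\mathbb T$ of tableaux of the same evaluation, $(\mathbb T,<_{cc})$ is the poset (ranked by charge) obtained by linking $T,T'\in\mathbb T$ when one of $\sigma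 T,\sigma T'$ is obtained from the other by a cyclage or a cocyclage, $\sigma$ being a permutation (acting via the $\sigma_i$) that makes the evaluation a partition. $\Gamma_{\mathbb T}$ is its Hasse diagram with each vertex labeled by the shape of the corresponding tableau, and $\Gamma_\lambda^{(k)}=\Gamma_{\mathbb T}$ for $\mathbb T=\mathbb A_\lambda^{(k)}$. A set $\mathbb T$ of tableaux (all of the same evaluation) is called a copy of $\mathbb A^{(k)}_{\mathrm{shape}(T)}$, and is denoted $\mathbb A_T^{(k)}$, if $T$ is the tableau of minimal charge in $\mathbb T$ and $\Gamma_{\mathbb T}=\Gamma^{(k)}_{\mathrm{shape}(T)}$. *)

theory Defs
  imports "HOL-Library.Multiset" "HOL-Computational_Algebra.Polynomial"
begin

text \<open>
  Partitions are weakly decreasing lists of positive integers.  A tableau is the list of its rows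
  from bottom to top (French convention).  Formal sums of tableaux are multisets; the scalar
  \<open>0\<close> is the empty multiset, and the empty tableau is \<open>[]\<close>.
\<close>

type_synonym tableau = "nat list list"

section \<open>Partitions\<close>

definition is_partition :: "nat list \<Rightarrow> bool" where
  "is_partition lam \<longleftrightarrow> sorted_wrt (\<ge>) lam \<and> 0 \<notin> set lam"

definition k_bounded :: "nat \<Rightarrow> nat list \<Rightarrow> bool" where
  "k_bounded k lam \<longleftrightarrow> (lam \<noteq> [] \<longrightarrow> hd lam \<le> k)"

text \<open>The rectangle \<open>(l\<^sup>h)\<close> has \<open>h\<close> parts equal to \<open>l\<close>.\<close>

definition rect :: "nat \<Rightarrow> nat \<Rightarrow> nat list" where
  "rect l h = replicate h l"

definition part_union :: "nat list \<Rightarrow> nat list \<Rightarrow> nat list" where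
  "part_union lam mu = rev (sort (lam @ mu))"

definition main_hook :: "nat list \<Rightarrow> nat" where
  "main_hook lam = hd lam + length lam - 1"

definition is_ksplit :: "nat \<Rightarrow> nat list \<Rightarrow> nat list list \<Rightarrow> bool" where
  "is_ksplit k lam S \<longleftrightarrow>
     concat S = lam \<and> [] \<notin> set S \<and>
     (\<forall>i. Suc i < length S \<longrightarrow> main_hook (S ! i) = k) \<and>
     (S \<noteq> [] \<longrightarrow> main_hook (last S) \<le> k)"

definition ksplit :: "nat \<Rightarrow> nat list \<Rightarrow> nat list list" where
  "ksplit k lam = (THE S. is_ksplit k lam S)"

section \<open>Tableaux and words\<close>

definition shape :: "tableau \<Rightarrow> nat list" where
  "shape T = map length T"

definition is_tableau :: "tableau \<Rightarrow> bool" where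
  "is_tableau T \<longleftrightarrow> is_partition (shape T) \<and>
     (\<forall>r\<in>set T. sorted r \<and> 0 \<notin> set r) \<and>
     (\<forall>i j. Suc i < length T \<longrightarrow> j < length (T ! Suc i) \<longrightarrow> T ! i ! j < T ! Suc i ! j)"

definition reading_word :: "tableau \<Rightarrow> nat list" where
  "reading_word T = concat (rev T)"

definition row :: "nat \<Rightarrow> tableau \<Rightarrow> nat list" where
  "row i T = (if i < length T then T ! i else [])"

definition max_letter :: "nat list \<Rightarrow> nat" where
  "max_letter w = Max (insert 0 (set w))"

inductive knuth_step :: "nat list \<Rightarrow> nat list \<Rightarrow> bool" where
  "a \<le> b \<Longrightarrow> b < c \<Longrightarrow> knuth_step (xs @ [a, c, b] @ ys) (xs @ [c, a, b] @ ys)"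
| "a < b \<Longrightarrow> b \<le> c \<Longrightarrow> knuth_step (xs @ [b, a, c] @ ys) (xs @ [b, c, a] @ ys)"

definition knuth_equiv :: "nat list \<Rightarrow> nat list \<Rightarrow> bool" where
  "knuth_equiv = equivclp knuth_step"

definition P_tab :: "nat list \<Rightarrow> tableau" where
  "P_tab w = (THE T. is_tableau T \<and> knuth_equiv w (reading_word T))"

text \<open>The entry \<open>i\<close> of the recording tableau marks the cell by which the shape of the insertion
  tableau grows when the \<open>i\<close>-th letter is read.\<close>

definition Q_tab :: "nat list \<Rightarrow> tableau" where
  "Q_tab w = map (\<lambda>j. filter (\<lambda>i. length (row j (P_tab (take i w)))
                                 \<noteq> length (row j (P_tab (take (i - 1) w))))
                       [1..<Suc (length w)])
                 [0..<length (P_tab w)]"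

text \<open>A tableau is identified with its reading word: this transports a word operator which maps
  reading words of tableaux to reading words of tableaux.\<close>

definition on_tableau :: "(nat list \<Rightarrow> nat list) \<Rightarrow> tableau \<Rightarrow> tableau" where
  "on_tableau f T = (THE T'. is_tableau T' \<and> reading_word T' = f (reading_word T))"

definition lin :: "(tableau \<Rightarrow> tableau multiset) \<Rightarrow> tableau multiset \<Rightarrow> tableau multiset" where
  "lin f M = (\<Sum>T\<in>#M. f T)"

section \<open>Symmetric group action\<close>

text \<open>The stack holds the positions, last one first, that are still unpaired; reading a letter
  \<open>i\<close> directly after an unpaired \<open>i + 1\<close> removes both.\<close>

definition push_letter :: "nat list \<Rightarrow> nat \<Rightarrow> nat list \<Rightarrow> nat \<Rightarrow> nat list" where
  "push_letter w i stk q =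
     (case stk of [] \<Rightarrow> [q]
      | p # ps \<Rightarrow> if w ! p = Suc i \<and> w ! q = i then ps else q # stk)"

definition unpaired :: "nat \<Rightarrow> nat list \<Rightarrow> nat list" where
  "unpaired i w =
     rev (foldl (push_letter w i) [] (filter (\<lambda>p. w ! p = i \<or> w ! p = Suc i) [0..<length w]))"

definition sigma :: "nat \<Rightarrow> nat list \<Rightarrow> nat list" where
  "sigma i w =
     (let U = unpaired i w;
          s = length (filter (\<lambda>p. w ! p = Suc i) U)
      in foldl (\<lambda>v j. v[U ! j := (if j < s then i else Suc i)]) w [0..<length U])"

definition sigmas :: "nat list \<Rightarrow> nat list \<Rightarrow> nat list" where
  "sigmas js w = foldr sigma js w"

definition partition_evaluation :: "nat list \<Rightarrow> bool" where
  "partition_evaluation w \<longleftrightarrow> (\<forall>i\<ge>1. count_list w (Suc i) \<le> count_list w i)"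

text \<open>The list \<open>js\<close> stands for a product of elementary transpositions, i.e. for a permutation,
  that makes the evaluation of \<open>w\<close> a partition.\<close>

definition straightens :: "nat list \<Rightarrow> nat list \<Rightarrow> bool" where
  "straightens js w \<longleftrightarrow> 0 \<notin> set js \<and> partition_evaluation (sigmas js w)"

section \<open>Promotion\<close>

text \<open>\<open>adds_strip a r T T'\<close> is used for letters \<open>a\<close> larger than all letters of \<open>T\<close>.  The added
  cells then form a horizontal strip because columns of \<open>T'\<close> are strictly increasing.\<close>

definition adds_strip :: "nat \<Rightarrow> nat \<Rightarrow> tableau \<Rightarrow> tableau \<Rightarrow> bool" where
  "adds_strip a r T T' \<longleftrightarrow>
     is_tableau T' \<and> length T \<le> length T' \<and>
     (\<forall>i<length T'. \<exists>n. T' ! i = row i T @ replicate n a) \<and>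
     length (reading_word T') = length (reading_word T) + r"

text \<open>For a tableau of evaluation \<open>(\<lambda>\<^sub>1,\<dots>,\<lambda>\<^sub>m)\<close>, the number \<open>m\<close> is read off as the largest letter.\<close>

definition promotion :: "nat \<Rightarrow> tableau \<Rightarrow> tableau multiset" where
  "promotion r T =
     (let m = max_letter (reading_word T)
      in image_mset (on_tableau (foldr sigma [1..<Suc m]))
           (mset_set {T'. adds_strip (Suc m) r T T'}))"

section \<open>Rectangular promotion\<close>

definition rect_sigma1 :: "nat \<Rightarrow> nat list \<Rightarrow> nat list" where
  "rect_sigma1 h w =
     (let w'' = map (\<lambda>x. x - 1) (filter (\<lambda>x. x \<noteq> 1) w);
          T' = map (\<lambda>i. row i (P_tab w'') @
                        replicate (length (P_tab w ! i) - length (row i (P_tab w''))) (h + 1))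
                   [0..<length (P_tab w)]
      in (THE w'. 0 \<notin> set w' \<and> P_tab w' = T' \<and> Q_tab w' = Q_tab w))"

text \<open>\<open>replace_letters S w v\<close> replaces the successive letters of \<open>w\<close> lying in \<open>S\<close> by those of \<open>v\<close>.\<close>

fun replace_letters :: "nat set \<Rightarrow> nat list \<Rightarrow> nat list \<Rightarrow> nat list" where
  "replace_letters S [] v = []"
| "replace_letters S (x # xs) v =
     (if x \<in> S then hd v # replace_letters S xs (tl v) else x # replace_letters S xs v)"

definition rect_sigma :: "nat \<Rightarrow> nat \<Rightarrow> nat list \<Rightarrow> nat list" where
  "rect_sigma h i w =
     replace_letters {i..i + h} w
       (map (\<lambda>x. x + (i - 1))
          (rect_sigma1 h (map (\<lambda>x. x - (i - 1)) (filter (\<lambda>x. x \<in> {i..i + h}) w))))"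

fun add_strips :: "nat \<Rightarrow> nat \<Rightarrow> nat \<Rightarrow> tableau \<Rightarrow> tableau set" where
  "add_strips m l 0 T = {T}"
| "add_strips m l (Suc h) T = {T''. \<exists>T'\<in>add_strips m l h T. adds_strip (m + Suc h) l T' T''}"

definition yamanouchi :: "nat \<Rightarrow> nat \<Rightarrow> nat list \<Rightarrow> bool" where
  "yamanouchi m h w \<longleftrightarrow>
     (\<forall>n i j. 1 \<le> i \<longrightarrow> i < j \<longrightarrow> j \<le> h \<longrightarrow>
        count_list (drop n w) (m + j) \<le> count_list (drop n w) (m + i))"

definition rect_promotion :: "nat \<Rightarrow> nat \<Rightarrow> tableau \<Rightarrow> tableau multiset" where
  "rect_promotion l h T =
     (let m = max_letter (reading_word T)
      in image_mset (on_tableau (foldr (rect_sigma h) [1..<Suc m]))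
           (mset_set {T'\<in>add_strips m l h T. yamanouchi m h (reading_word T')}))"

section \<open>Katabolism and super atoms\<close>

definition sub_tableau :: "nat list \<Rightarrow> tableau \<Rightarrow> tableau" where
  "sub_tableau lam T = map2 take lam T"

definition contains_shape :: "nat list \<Rightarrow> tableau \<Rightarrow> bool" where
  "contains_shape lam T \<longleftrightarrow>
     length lam \<le> length T \<and> (\<forall>i<length lam. lam ! i \<le> length (T ! i))"

text \<open>The set \<open>S(\<lambda>)\<close> of tableaux of shape \<open>\<lambda>\<close> and evaluation \<open>(0\<^sup>m, \<lambda>\<^sub>1, \<lambda>\<^sub>2, \<dots>)\<close> for some \<open>m\<close>.\<close>

definition shifted_canonical :: "nat list \<Rightarrow> tableau set" where
  "shifted_canonical lam =
     {U. is_tableau U \<and> shape U = lam \<and>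
         (\<exists>m. \<forall>j. count_list (reading_word U) j =
            (if m < j \<and> j \<le> m + length lam then lam ! (j - m - 1) else 0))}"

definition katabolism :: "nat list \<Rightarrow> tableau \<Rightarrow> tableau multiset" where
  "katabolism lam T =
     (if contains_shape lam T \<and> sub_tableau lam T \<in> shifted_canonical lam
      then {# P_tab (reading_word (map2 drop lam T) @ reading_word (drop (length lam) T)) #}
      else {#})"

definition katabolism_filter :: "nat list list \<Rightarrow> tableau \<Rightarrow> tableau multiset" where
  "katabolism_filter S T =
     (if fold (\<lambda>lam. lin (katabolism lam)) S {#T#} = {#[]#} then {#T#} else {#})"

fun super_atom :: "nat \<Rightarrow> nat list \<Rightarrow> tableau multiset" where
  "super_atom k [] = {#[]#}"
| "super_atom k (x # xs) =
     lin (katabolism_filter (ksplit k (x # xs))) (lin (promotion x) (super_atom k xs))"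

section \<open>Charge\<close>

text \<open>
  \<open>v\<close> is the word in the order in which it is read (from right to left).  A state
  \<open>(A, s, l, c)\<close> consists of the unlabeled positions of \<open>v\<close>, the position from which reading
  continues, the current label, and the sum of the labels given so far.
\<close>

definition charge_step ::
  "nat list \<Rightarrow> nat \<Rightarrow> nat set \<times> nat \<times> nat \<times> nat \<Rightarrow> nat set \<times> nat \<times> nat \<times> nat" where
  "charge_step v j = (\<lambda>(A, s, l, c).
     let C = {q\<in>A. q < length v \<and> v ! q = j};
         D = {q\<in>C. s \<le> q}
     in if D \<noteq> {} then (A - {Min D}, Suc (Min D), l, c + l)
        else if C \<noteq> {} then (A - {Min C}, Suc (Min C), l + 1, c + (l + 1))
        else (A, s, l, c))"

definition charge_round :: "nat list \<Rightarrow> nat set \<times> nat \<Rightarrow> nat set \<times> nat" where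
  "charge_round v = (\<lambda>(A, c).
     case fold (charge_step v) [1..<Suc (max_letter v)] (A, 0, 0, c) of
       (A', s', l', c') \<Rightarrow> (A', c'))"

text \<open>When the evaluation is a partition, every round labels exactly one letter \<open>1\<close>, so that all
  letters are labeled after as many rounds as there are letters \<open>1\<close>.\<close>

definition charge_partition :: "nat list \<Rightarrow> nat" where
  "charge_partition w = snd ((charge_round (rev w) ^^ count_list w 1) ({..<length w}, 0))"

definition word_charge :: "nat list \<Rightarrow> nat" where
  "word_charge w =
     (if partition_evaluation w then charge_partition w
      else charge_partition (sigmas (SOME js. straightens js w) w))"

definition charge :: "tableau \<Rightarrow> nat" where
  "charge T = word_charge (reading_word T)"

section \<open>Symmetric functions and atoms\<close>

text \<open>
  A monomial in \<open>x\<^sub>1, x\<^sub>2, \<dots>\<close> is the multiset of the indices of its variables.  A symmetric function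
  is given, as a formal power series, by the coefficients of its monomials.
\<close>

type_synonym 'c series = "nat multiset \<Rightarrow> 'c"

definition series_mult :: "'c::comm_semiring_1 series \<Rightarrow> 'c series \<Rightarrow> 'c series" where
  "series_mult f g = (\<lambda>M. \<Sum>N | N \<subseteq># M. f N * g (M - N))"

text \<open>The Schur function is the generating series of all tableaux of the given shape.\<close>

definition schur :: "nat list \<Rightarrow> 'c::comm_semiring_1 series" where
  "schur lam = (\<lambda>M. of_nat (card {T. is_tableau T \<and> shape T = lam \<and> mset (reading_word T) = M}))"

text \<open>Coefficients are polynomials in \<open>t\<close>; the monomial \<open>monom 1 n\<close> is \<open>t\<^sup>n\<close>.\<close>

definition digamma :: "tableau multiset \<Rightarrow> int poly series" where
  "digamma X = (\<lambda>M. \<Sum>T\<in>#X. monom 1 (charge T) * schur (shape T) M)"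

definition atom :: "nat \<Rightarrow> nat list \<Rightarrow> int poly series" where
  "atom k lam = digamma (super_atom k lam)"

definition specialize :: "int poly series \<Rightarrow> int \<Rightarrow> int series" where
  "specialize f a = (\<lambda>M. poly (f M) a)"

section \<open>Cyclage posets and copies\<close>

definition is_cyclage :: "tableau \<Rightarrow> tableau \<Rightarrow> bool" where
  "is_cyclage T T' \<longleftrightarrow>
     (\<exists>x w. reading_word T = x # w \<and> x \<noteq> Min (set (reading_word T)) \<and> T' = P_tab (w @ [x]))"

definition is_cocyclage :: "tableau \<Rightarrow> tableau \<Rightarrow> bool" where
  "is_cocyclage T T' \<longleftrightarrow>
     (\<exists>x w. reading_word T = w @ [x] \<and> x \<noteq> Min (set (reading_word T)) \<and> T' = P_tab (x # w))"

definition cc_linked :: "tableau \<Rightarrow> tableau \<Rightarrow> bool" where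
  "cc_linked T T' \<longleftrightarrow>
     (\<exists>js. straightens js (reading_word T) \<and> straightens js (reading_word T') \<and>
        (let U = on_tableau (sigmas js) T; U' = on_tableau (sigmas js) T'
         in is_cyclage U U' \<or> is_cyclage U' U \<or> is_cocyclage U U' \<or> is_cocyclage U' U))"

text \<open>Linked tableaux differ in charge by one, and the one of larger charge is larger.\<close>

definition cc_less :: "tableau set \<Rightarrow> tableau \<Rightarrow> tableau \<Rightarrow> bool" where
  "cc_less X = (\<lambda>T T'. T \<in> X \<and> T' \<in> X \<and> cc_linked T T' \<and> charge T < charge T')\<^sup>+\<^sup>+"

definition cc_covers :: "tableau set \<Rightarrow> tableau \<Rightarrow> tableau \<Rightarrow> bool" where
  "cc_covers X T T' \<longleftrightarrow> cc_less X T T' \<and> \<not> (\<exists>U. cc_less X T U \<and> cc_less X U T')"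

text \<open>Equality of Hasse diagrams whose vertices are labeled by the shapes, that is, isomorphism of
  labeled directed graphs.\<close>

definition same_diagram :: "tableau set \<Rightarrow> tableau set \<Rightarrow> bool" where
  "same_diagram X Y \<longleftrightarrow>
     (\<exists>f. bij_betw f X Y \<and> (\<forall>T\<in>X. shape (f T) = shape T) \<and>
          (\<forall>T\<in>X. \<forall>T'\<in>X. cc_covers X T T' \<longleftrightarrow> cc_covers Y (f T) (f T')))"

definition same_evaluation :: "tableau set \<Rightarrow> bool" where
  "same_evaluation X \<longleftrightarrow>
     (\<forall>T\<in>X. \<forall>T'\<in>X. mset (reading_word T) = mset (reading_word T'))"

text \<open>\<open>is_copy k X T\<close>: the set \<open>X\<close> is a copy, denoted by the index \<open>T\<close>, of the super atom of level
  \<open>k\<close> indexed by the shape of \<open>T\<close>.\<close>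

definition is_copy :: "nat \<Rightarrow> tableau set \<Rightarrow> tableau \<Rightarrow> bool" where
  "is_copy k X T \<longleftrightarrow>
     (\<forall>U\<in>X. is_tableau U) \<and> same_evaluation X \<and>
     T \<in> X \<and> (\<forall>U\<in>X. U \<noteq> T \<longrightarrow> charge T < charge U) \<and>
     same_diagram X (set_mset (super_atom k (shape T)))"

end

theory Submission
  imports Defs
begin

text \<open>
  At \<open>t = 1\<close> the charge disappears, and the atom of \<open>\<lambda>\<close> is the sum of the Schur functions of the shapes
  of the tableaux in the super atom \<open>A\<close> of \<open>\<lambda>\<close>.  The proof applies the hypothesis to \<open>A\<close> itself.  This is
  possible because \<open>A\<close> is a copy of itself (\<open>super_atom_is_copy\<close>): it contains the tableau of shape and
  evaluation \<open>\<lambda>\<close>, which has charge \<open>0\<close>, and every other tableau of evaluation \<open>\<lambda>\<close> has positive charge.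
  The hypothesis gives a set \<open>X'\<close> which is the rectangular promotion of \<open>A\<close> and a copy of the super atom
  of \<open>\<lambda>\<close> joined with the rectangle.  A copy has the same multiset of shapes as the super atom, and super
  atoms are multiplicity free (\<open>super_atom_multiplicity_free\<close>), so the atom of the union is the sum of
  the Schur functions of the shapes in \<open>X'\<close>.

  It remains to see that the rectangular promotion of one tableau \<open>T\<close> contributes the product of the Schur
  functions of the rectangle and of the shape of \<open>T\<close> (\<open>rect_promotion_schur\<close>).  Two facts give this.  The
  rectangular reflections do not change the shape of a tableau (\<open>rect_sigma_conn\<close> and
  \<open>on_tableau_conn\<close>), so only the operator that adds Yamanouchi strips matters; and this operator
  is the Littlewood--Richardson rule (\<open>littlewood_richardson\<close>).

  The theory of words that is needed is developed from crystal operators instead of insertion.  A crystal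
  step raises one letter \<open>x\<close> to \<open>x + 1\<close>.  Crystal steps are injective partial functions, commute with Knuth
  equivalence (\<open>knuth_crystal_step\<close>), and map tableaux to tableaux of the same shape
  (\<open>crystal_step_tableau\<close>).  Going up to Yamanouchi words, where everything is explicit, and back again
  gives existence and uniqueness of the tableau Knuth equivalent to a word.  The shape of this tableau, and
  the recording tableau, are constant on connected components, and a word is determined by its component
  and its Knuth class (\<open>conn_knuth_eq\<close>).  Consequently all operators of the statement, the reflections
  \<open>\<sigma>\<^sub>i\<close> as well as the rectangular ones, move words inside their components, and the product of two Schur
  functions is expanded by counting the components of the set of words that are concatenations of two
  tableaux.
\<close>

section \<open>Bracketing and crystal steps\<close>

text \<open>
  Cancelling the factors \<open>(x + 1) x\<close> of a word, ignoring all other letters, leaves a word of the form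
  \<open>x\<^sup>r (x + 1)\<^sup>s\<close>.  The numbers \<open>r\<close> and \<open>s\<close> are \<open>free_lo\<close> and \<open>free_hi\<close>.
\<close>

fun free_lo :: "nat \<Rightarrow> nat list \<Rightarrow> nat" where
  "free_lo x [] = 0"
| "free_lo x (y # w) =
     (if y = x then Suc (free_lo x w) else if y = Suc x then free_lo x w - 1 else free_lo x w)"

fun free_hi :: "nat \<Rightarrow> nat list \<Rightarrow> nat" where
  "free_hi x [] = 0"
| "free_hi x (y # w) =
     (if y = Suc x \<and> free_lo x w = 0 then Suc (free_hi x w) else free_hi x w)"

text \<open>
  The product of the bicyclic monoid: the \<open>s\<close> free letters \<open>x + 1\<close> of \<open>u\<close> cancel against the \<open>r\<close> free
  letters \<open>x\<close> of \<open>v\<close>.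
\<close>

lemma free_lo_append: "free_lo x (u @ v) = free_lo x u + (free_lo x v - free_hi x u)"
  and free_hi_append: "free_hi x (u @ v) = free_hi x v + (free_hi x u - free_lo x v)"
  by (induction u) auto

lemma free_count: "count_list w x + free_hi x w = count_list w (Suc x) + free_lo x w"
  by (induction w) auto

lemma free_lo_append_0: "free_lo x (u @ v) = 0 \<Longrightarrow> free_lo x u = 0"
  by (simp add: free_lo_append)

lemma free_hi_append_0: "free_hi x (u @ v) = 0 \<Longrightarrow> free_hi x v = 0"
  by (simp add: free_hi_append)

text \<open>
  The suffix that starts at a free letter \<open>x + 1\<close> contains more letters \<open>x + 1\<close> than \<open>x\<close>.  This links the
  cancellation to the Yamanouchi condition.
\<close>

lemma free_hi_0_iff:
  "free_hi x w = 0 \<longleftrightarrow> (\<forall>n. count_list (drop n w) (Suc x) \<le> count_list (drop n w) x)"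
proof
  assume w: "free_hi x w = 0"
  show "\<forall>n. count_list (drop n w) (Suc x) \<le> count_list (drop n w) x"
  proof
    fix n
    have "free_hi x (drop n w) = 0"
      by (rule free_hi_append_0[of x "take n w"]) (simp add: w)
    with free_count[of "drop n w" x] show "count_list (drop n w) (Suc x) \<le> count_list (drop n w) x"
      by simp
  qed
next
  assume R: "\<forall>n. count_list (drop n w) (Suc x) \<le> count_list (drop n w) x"
  then show "free_hi x w = 0"
  proof (induction w)
    case (Cons y w)
    have "count_list (drop n w) (Suc x) \<le> count_list (drop n w) x" for n
      using Cons.prems[rule_format, of "Suc n"] by simp
    then have w: "free_hi x w = 0" using Cons.IH by blast
    have "count_list (y # w) (Suc x) \<le> count_list (y # w) x"
      using Cons.prems[rule_format, of 0] by simp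
    with w free_count[of w x] show ?case by (auto split: if_splits)
  qed simp
qed

lemma free_cong:
  "filter (\<lambda>y. y = x \<or> y = Suc x) u = filter (\<lambda>y. y = x \<or> y = Suc x) v \<Longrightarrow>
     free_lo x u = free_lo x v \<and> free_hi x u = free_hi x v"
proof -
  have "free_lo x w = free_lo x (filter (\<lambda>y. y = x \<or> y = Suc x) w)"
    "free_hi x w = free_hi x (filter (\<lambda>y. y = x \<or> y = Suc x) w)" for w
    by (induction w) auto
  then show "filter (\<lambda>y. y = x \<or> y = Suc x) u = filter (\<lambda>y. y = x \<or> y = Suc x) v \<Longrightarrow>
     free_lo x u = free_lo x v \<and> free_hi x u = free_hi x v" by metis
qed

lemma free_filter:
  assumes "P x" "P (Suc x)"
  shows "free_lo x (filter P w) = free_lo x w" "free_hi x (filter P w) = free_hi x w"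
proof -
  have "filter (\<lambda>y. y = x \<or> y = Suc x) (filter P w) = filter (\<lambda>y. y = x \<or> y = Suc x) w"
    using assms by (auto intro: filter_cong)
  from free_cong[OF this]
  show "free_lo x (filter P w) = free_lo x w" "free_hi x (filter P w) = free_hi x w" by auto
qed

lemma free_map_add:
  "free_lo (x + d) (map (\<lambda>y. y + d) w) = free_lo x w"
  "free_hi (x + d) (map (\<lambda>y. y + d) w) = free_hi x w"
proof -
  show lo: "free_lo (x + d) (map (\<lambda>y. y + d) w) = free_lo x w" for w
    by (induction w) auto
  show "free_hi (x + d) (map (\<lambda>y. y + d) w) = free_hi x w"
    by (induction w) (auto simp: lo)
qed

text \<open>
  The raising operator turns the last free letter \<open>x\<close> into \<open>x + 1\<close>: nothing in \<open>u\<close> cancels it, and \<open>v\<close>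
  contains no free \<open>x\<close>.  The new letter \<open>x + 1\<close> is then the first free one, so that the same relation,
  read backwards, is the lowering operator.
\<close>

inductive crystal_step :: "nat \<Rightarrow> nat list \<Rightarrow> nat list \<Rightarrow> bool" where
  "free_hi x u = 0 \<Longrightarrow> free_lo x v = 0 \<Longrightarrow> crystal_step x (u @ [x] @ v) (u @ [Suc x] @ v)"

lemma crystal_step_lo_pos: "crystal_step x w w' \<Longrightarrow> free_lo x w = Suc (free_lo x w')"
  and crystal_step_hi_pos: "crystal_step x w w' \<Longrightarrow> free_hi x w' = Suc (free_hi x w)"
  by (auto elim!: crystal_step.cases simp: free_lo_append free_hi_append)

lemma crystal_step_exists: "free_lo x w > 0 \<Longrightarrow> \<exists>w'. crystal_step x w w'"
proof -
  assume "free_lo x w > 0"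
  then have "\<exists>u v. w = u @ [x] @ v \<and> free_hi x u = 0 \<and> free_lo x v = 0"
  proof (induction w)
    case (Cons y w)
    show ?case
    proof (cases "free_lo x w > 0 ")
      case True
      with Cons.IH obtain u v where *: "w = u @ [x] @ v" "free_hi x u = 0" "free_lo x v = 0" by blast
      have "free_hi x (y # u) = 0"
        using Cons.prems * by (auto simp: free_lo_append split: if_splits)
      with * show ?thesis by (intro exI[of _ "y # u"] exI[of _ v]) auto
    next
      case False
      with Cons.prems have "y = x" by (auto split: if_splits)
      with False show ?thesis by (intro exI[of _ "[]"] exI[of _ w]) auto
    qed
  qed simp
  then show ?thesis using crystal_step.intros by metis
qed

lemma crystal_step_exists_back: "free_hi x w > 0 \<Longrightarrow> \<exists>w'. crystal_step x w' w"
proof -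
  assume "free_hi x w > 0"
  then have "\<exists>u v. w = u @ [Suc x] @ v \<and> free_hi x u = 0 \<and> free_lo x v = 0"
  proof (induction w)
    case (Cons y w)
    show ?case
    proof (cases "y = Suc x \<and> free_lo x w = 0")
      case True
      then show ?thesis by (intro exI[of _ "[]"] exI[of _ w]) auto
    next
      case False
      with Cons.prems have "free_hi x w > 0" by (auto split: if_splits)
      with Cons.IH obtain u v where *: "w = u @ [Suc x] @ v" "free_hi x u = 0" "free_lo x v = 0" by blast
      have "free_hi x (y # u) = 0"
        using False * by (auto simp: free_lo_append split: if_splits)
      with * show ?thesis by (intro exI[of _ "y # u"] exI[of _ v]) auto
    qed
  qed simp
  then show ?thesis using crystal_step.intros by metis
qed

text \<open>
  Between two possible positions the conditions leave neither a free \<open>x\<close> nor a free \<open>x + 1\<close>.  Then one of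
  the two letters would be free in the part of the word that the other position requires to be cancelled.
\<close>

lemma crystal_split_unique:
  assumes eq: "u @ y # v = u' @ y # v'" and y: "y = x \<or> y = Suc x"
    and "free_hi x u = 0" "free_lo x v = 0" "free_hi x u' = 0" "free_lo x v' = 0"
  shows "u = u' \<and> v = v'"
proof -
  have no: False if h: "u @ y # v = u' @ y # v'" "length u < length u'"
      "free_hi x u' = 0" "free_lo x v = 0" "free_lo x v' = 0" "free_hi x u = 0" for u u' v v'
  proof -
    obtain m where m: "u' = u @ y # m" "v = m @ y # v'"
      using h(1,2) by (auto simp: append_eq_append_conv2 Cons_eq_append_conv)
    show False
      using h y by (auto simp: m free_lo_append free_hi_append split: if_splits)
  qed
  from no[OF eq] no[OF eq[symmetric]] assms have "length u = length u'"
    by (meson linorder_neqE_nat)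
  with eq show ?thesis by simp
qed

lemma crystal_step_det: "crystal_step x w w1 \<Longrightarrow> crystal_step x w w2 \<Longrightarrow> w1 = w2"
proof (elim crystal_step.cases)
  fix x1 x2 u1 u2 v1 v2
  assume *: "x = x1" "w = u1 @ [x1] @ v1" "w1 = u1 @ [Suc x1] @ v1" "free_hi x1 u1 = 0" "free_lo x1 v1 = 0"
    "x = x2" "w = u2 @ [x2] @ v2" "w2 = u2 @ [Suc x2] @ v2" "free_hi x2 u2 = 0" "free_lo x2 v2 = 0"
  have "u1 = u2 \<and> v1 = v2"
    by (rule crystal_split_unique[of _ x _ _ _ x]) (use * in auto)
  then show "w1 = w2" using * by auto
qed

lemma crystal_step_inj: "crystal_step x w1 w \<Longrightarrow> crystal_step x w2 w \<Longrightarrow> w1 = w2"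
proof (elim crystal_step.cases)
  fix x1 x2 u1 u2 v1 v2
  assume *: "x = x1" "w1 = u1 @ [x1] @ v1" "w = u1 @ [Suc x1] @ v1" "free_hi x1 u1 = 0" "free_lo x1 v1 = 0"
    "x = x2" "w2 = u2 @ [x2] @ v2" "w = u2 @ [Suc x2] @ v2" "free_hi x2 u2 = 0" "free_lo x2 v2 = 0"
  have "u1 = u2 \<and> v1 = v2"
    by (rule crystal_split_unique[of _ "Suc x" _ _ _ x]) (use * in auto)
  then show "w1 = w2" using * by auto
qed

lemma crystal_step_length: "crystal_step x w w' \<Longrightarrow> length w' = length w"
  by (auto elim!: crystal_step.cases)

text \<open>
  The conditions of a crystal step are inherited by prefixes and suffixes that contain the letter.  This
  is what makes recording tableaux and suffix shapes constant on components.
\<close>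

lemma crystal_step_take:
  "crystal_step x w w' \<Longrightarrow> take n w = take n w' \<or> crystal_step x (take n w) (take n w')"
proof (erule crystal_step.cases)
  fix x' u v assume *: "x = x'" "w = u @ [x'] @ v" "w' = u @ [Suc x'] @ v" "free_hi x' u = 0" "free_lo x' v = 0"
  show ?thesis
  proof (cases "n \<le> length u")
    case True then show ?thesis by (simp add: *)
  next
    case False
    then obtain k where k: "n - length u = Suc k" by (metis Suc_diff_Suc not_le)
    have "free_lo x' (take k v) = 0"
      by (rule free_lo_append_0[of _ _ "drop k v"]) (simp add: *)
    then show ?thesis using crystal_step.intros[of x' u "take k v"] * False k by simp
  qed
qed

lemma crystal_step_drop:
  "crystal_step x w w' \<Longrightarrow> drop n w = drop n w' \<or> crystal_step x (drop n w) (drop n w')"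
proof (erule crystal_step.cases)
  fix x' u v assume *: "x = x'" "w = u @ [x'] @ v" "w' = u @ [Suc x'] @ v" "free_hi x' u = 0" "free_lo x' v = 0"
  show ?thesis
  proof (cases "n \<le> length u")
    case True
    have "free_hi x' (drop n u) = 0"
      by (rule free_hi_append_0[of _ "take n u"]) (simp add: *)
    then show ?thesis using crystal_step.intros[of x' "drop n u" v] * True by simp
  next
    case False
    then obtain k where k: "n - length u = Suc k" by (metis Suc_diff_Suc not_le)
    with False show ?thesis by (simp add: *)
  qed
qed

section \<open>Knuth equivalence\<close>

lemma knuth_refl [simp]: "knuth_equiv w w"
  by (simp add: knuth_equiv_def)

lemma knuth_sym: "knuth_equiv w v \<Longrightarrow> knuth_equiv v w"
  by (simp add: knuth_equiv_def equivclp_sym)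

lemma knuth_trans [trans]: "knuth_equiv u v \<Longrightarrow> knuth_equiv v w \<Longrightarrow> knuth_equiv u w"
  unfolding knuth_equiv_def by (rule equivclp_trans)

lemma knuth_stepI: "knuth_step w v \<Longrightarrow> knuth_equiv w v"
  by (simp add: knuth_equiv_def r_into_equivclp)

lemma knuth_step_context: "knuth_step w v \<Longrightarrow> knuth_step (a @ w @ b) (a @ v @ b)"
proof (induction rule: knuth_step.induct)
  case (1 a' b' c xs ys)
  then show ?case using knuth_step.intros(1)[of a' b' c "a @ xs" "ys @ b"] by simp
next
  case (2 a' b' c xs ys)
  then show ?case using knuth_step.intros(2)[of a' b' c "a @ xs" "ys @ b"] by simp
qed

lemma knuth_context: "knuth_equiv w v \<Longrightarrow> knuth_equiv (a @ w @ b) (a @ v @ b)"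
  unfolding knuth_equiv_def
  by (induction rule: equivclp_induct)
     (auto intro: equivclp_into_equivclp dest: knuth_step_context[of _ _ a b])

lemma knuth_mset: "knuth_equiv w v \<Longrightarrow> mset w = mset v"
  unfolding knuth_equiv_def
  by (induction rule: equivclp_induct) (auto elim!: knuth_step.cases)

lemma knuth1: "a \<le> b \<Longrightarrow> b < c \<Longrightarrow> knuth_equiv (xs @ a # c # b # ys) (xs @ c # a # b # ys)"
  using knuth_step.intros(1)[of a b c xs ys] by (simp add: knuth_stepI)

lemma knuth2: "a < b \<Longrightarrow> b \<le> c \<Longrightarrow> knuth_equiv (xs @ b # a # c # ys) (xs @ b # c # a # ys)"
  using knuth_step.intros(2)[of a b c xs ys] by (simp add: knuth_stepI)

text \<open>
  Each Knuth move reorders three letters without changing the result of the cancellation.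
\<close>

lemma knuth_step_free:
  "knuth_step w v \<Longrightarrow> free_lo x w = free_lo x v \<and> free_hi x w = free_hi x v"
proof (induction rule: knuth_step.induct)
  case (1 a b c xs ys)
  then have "free_lo x [a, c, b] = free_lo x [c, a, b]" "free_hi x [a, c, b] = free_hi x [c, a, b]"
    by simp_all
  then show ?case by (simp only: free_lo_append free_hi_append)
next
  case (2 a b c xs ys)
  then have "free_lo x [b, a, c] = free_lo x [b, c, a]" "free_hi x [b, a, c] = free_hi x [b, c, a]"
    by simp_all
  then show ?case by (simp only: free_lo_append free_hi_append)
qed

lemma knuth_free:
  "knuth_equiv w v \<Longrightarrow> free_lo x w = free_lo x v \<and> free_hi x w = free_hi x v"
  unfolding knuth_equiv_def
  by (induction rule: equivclp_induct) (simp, metis knuth_step_free)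

section \<open>Crystal steps commute with Knuth moves\<close>

text \<open>
  The letters touched by a Knuth move, in both directions.
\<close>

inductive swap_triple :: "nat list \<Rightarrow> nat list \<Rightarrow> bool" where
  "a \<le> b \<Longrightarrow> b < c \<Longrightarrow> swap_triple [a, c, b] [c, a, b]"
| "a \<le> b \<Longrightarrow> b < c \<Longrightarrow> swap_triple [c, a, b] [a, c, b]"
| "a < b \<Longrightarrow> b \<le> c \<Longrightarrow> swap_triple [b, a, c] [b, c, a]"
| "a < b \<Longrightarrow> b \<le> c \<Longrightarrow> swap_triple [b, c, a] [b, a, c]"

lemma swap_triple_knuth: "swap_triple t t' \<Longrightarrow> knuth_equiv t t'"
proof (induction rule: swap_triple.induct)
  case (1 a b c)
  then show ?case using knuth1[of a b c "[]" "[]"] by simp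
next
  case (2 a b c)
  then show ?case using knuth1[of a b c "[]" "[]"] knuth_sym by simp
next
  case (3 a b c)
  then show ?case using knuth2[of a b c "[]" "[]"] by simp
next
  case (4 a b c)
  then show ?case using knuth2[of a b c "[]" "[]"] knuth_sym by simp
qed

lemma split_three:
  assumes "[a, b, c] = p @ y # q"
  shows "p = [] \<and> y = a \<and> q = [b, c] \<or> p = [a] \<and> y = b \<and> q = [c] \<or> p = [a, b] \<and> y = c \<and> q = []"
  using assms by (auto simp: Cons_eq_append_conv)

text \<open>
  A crystal step seen from a factor \<open>t\<close> of a word in which the left context offers \<open>H\<close> free letters
  \<open>x + 1\<close> and the right context \<open>L\<close> free letters \<open>x\<close>: both must be absorbed by the part of \<open>t\<close> between
  them and the letter that changes.  Raising is the case \<open>y = x\<close>, \<open>z = x + 1\<close>, and lowering the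
  converse.
\<close>

definition flips :: "nat \<Rightarrow> nat \<Rightarrow> nat \<Rightarrow> nat \<Rightarrow> nat \<Rightarrow> nat list \<Rightarrow> nat list \<Rightarrow> bool" where
  "flips x y z H L t s \<longleftrightarrow> (\<exists>p q. t = p @ y # q \<and> s = p @ z # q \<and>
      H \<le> free_lo x p \<and> free_hi x p = 0 \<and> L \<le> free_hi x q \<and> free_lo x q = 0)"

lemma flipsI:
  "H \<le> free_lo x p \<Longrightarrow> free_hi x p = 0 \<Longrightarrow> L \<le> free_hi x q \<Longrightarrow> free_lo x q = 0 \<Longrightarrow>
     flips x y z H L (p @ y # q) (p @ z # q)"
  unfolding flips_def by blast

lemma flips3:
  "flips x y z H L [a, b, c] s \<longleftrightarrow>
     a = y \<and> s = [z, b, c] \<and> H = 0 \<and> L \<le> free_hi x [b, c] \<and> free_lo x [b, c] = 0 \<or>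
     b = y \<and> s = [a, z, c] \<and> H \<le> free_lo x [a] \<and> free_hi x [a] = 0 \<and> L \<le> free_hi x [c] \<and> free_lo x [c] = 0 \<or>
     c = y \<and> s = [a, b, z] \<and> H \<le> free_lo x [a, b] \<and> free_hi x [a, b] = 0 \<and> L = 0"
  (is "?l \<longleftrightarrow> ?r")
proof
  assume ?l
  then obtain p q where eq: "[a, b, c] = p @ y # q" and "s = p @ z # q"
      "H \<le> free_lo x p" "free_hi x p = 0" "L \<le> free_hi x q" "free_lo x q = 0"
    unfolding flips_def by blast
  with split_three[OF eq] show ?r by (elim disjE) auto
next
  assume ?r
  then show ?l
    using flipsI[of H x "[]" L "[b, c]"] flipsI[of H x "[a]" L "[c]"] flipsI[of H x "[a, b]" L "[]"]
    by (elim disjE) simp_all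
qed

lemma swap_triple3:
  "swap_triple [p, q, r] [p', q', r'] \<longleftrightarrow>
     (q' = p \<and> p' = q \<and> r' = r \<and> (p \<le> r \<and> r < q \<or> q \<le> r \<and> r < p)) \<or>
     (p' = p \<and> q' = r \<and> r' = q \<and> (q < p \<and> p \<le> r \<or> r < p \<and> p \<le> q))"
  by (auto simp: swap_triple.simps)

lemma flips_ex3:
  assumes "b = y \<and> Q [a, z, c] \<and> H \<le> free_lo x [a] \<and> free_hi x [a] = 0 \<and> L \<le> free_hi x [c] \<and> free_lo x [c] = 0
      \<or> a = y \<and> Q [z, b, c] \<and> H = 0 \<and> L \<le> free_hi x [b, c] \<and> free_lo x [b, c] = 0
      \<or> c = y \<and> Q [a, b, z] \<and> H \<le> free_lo x [a, b] \<and> free_hi x [a, b] = 0 \<and> L = 0"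
  shows "\<exists>s'. flips x y z H L [a, b, c] s' \<and> Q s'"
  using assms unfolding flips3 by blast

text \<open>
  As a rule the same letter changes on both sides and the two results are again related by a Knuth move.
  The exception are the triples with letters \<open>x\<close> and \<open>x + 1\<close> only, such as \<open>x (x + 1) x\<close> and \<open>(x + 1) x x\<close>:
  there different positions are free, but the results \<open>(x + 1) (x + 1) x\<close> and \<open>(x + 1) x (x + 1)\<close> are related
  by the other Knuth move.
\<close>

lemma flips_swap:
  assumes "swap_triple t t'" "flips x y z H L t s" and yz: "y = x \<and> z = Suc x \<or> y = Suc x \<and> z = x"
  shows "\<exists>s'. flips x y z H L t' s' \<and> (s = s' \<or> swap_triple s s')"
  using assms(1)
proof (cases rule: swap_triple.cases)
  case (1 a b c)
  show ?thesis
    using assms(2)[unfolded 1(1,2) flips3] 1(3,4) yz unfolding 1(1,2)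
    by - (elim disjE conjE; intro flips_ex3[where Q="\<lambda>s'. s = s' \<or> swap_triple s s'"];
      simp add: swap_triple3 split: if_splits)
next
  case (2 a b c)
  show ?thesis
    using assms(2)[unfolded 2(1,2) flips3] 2(3,4) yz unfolding 2(1,2)
    by - (elim disjE conjE; intro flips_ex3[where Q="\<lambda>s'. s = s' \<or> swap_triple s s'"];
      simp add: swap_triple3 split: if_splits)
next
  case (3 a b c)
  show ?thesis
    using assms(2)[unfolded 3(1,2) flips3] 3(3,4) yz unfolding 3(1,2)
    by - (elim disjE conjE; intro flips_ex3[where Q="\<lambda>s'. s = s' \<or> swap_triple s s'"];
      simp add: swap_triple3 split: if_splits)
next
  case (4 a b c)
  show ?thesis
    using assms(2)[unfolded 4(1,2) flips3] 4(3,4) yz unfolding 4(1,2)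
    by - (elim disjE conjE; intro flips_ex3[where Q="\<lambda>s'. s = s' \<or> swap_triple s s'"];
      simp add: swap_triple3 split: if_splits)
qed

text \<open>
  Raising and lowering in one relation, so that each property needs one proof.
\<close>

definition crystal_move :: "nat \<Rightarrow> nat \<Rightarrow> nat \<Rightarrow> nat list \<Rightarrow> nat list \<Rightarrow> bool" where
  "crystal_move x y z w w' \<longleftrightarrow>
     (\<exists>u v. w = u @ y # v \<and> w' = u @ z # v \<and> free_hi x u = 0 \<and> free_lo x v = 0)"

lemma crystal_moveI:
  "free_hi x u = 0 \<Longrightarrow> free_lo x v = 0 \<Longrightarrow> crystal_move x y z (u @ y # v) (u @ z # v)"
  unfolding crystal_move_def by blast

lemma crystal_moveE:
  assumes "crystal_move x y z w w'"
  obtains u v where "w = u @ y # v" "w' = u @ z # v" "free_hi x u = 0" "free_lo x v = 0"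
  using assms unfolding crystal_move_def by blast

lemma crystal_step_iff_move:
  "crystal_step x w w' \<longleftrightarrow> crystal_move x x (Suc x) w w'"
  "crystal_step x w w' \<longleftrightarrow> crystal_move x (Suc x) x w' w"
  unfolding crystal_move_def by (auto simp: crystal_step.simps)

lemma free_hi_append_0_iff: "free_hi x (u @ v) = 0 \<longleftrightarrow> free_hi x v = 0 \<and> free_hi x u \<le> free_lo x v"
  by (auto simp: free_hi_append)

lemma free_lo_append_0_iff: "free_lo x (u @ v) = 0 \<longleftrightarrow> free_lo x u = 0 \<and> free_lo x v \<le> free_hi x u"
  by (auto simp: free_lo_append)

lemma append3_cases:
  assumes "u @ y # v = xs @ t @ ys"
  obtains (left) m where "xs = u @ y # m" "v = m @ t @ ys"
    | (middle) p q where "t = p @ y # q" "u = xs @ p" "v = q @ ys"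
    | (right) m where "ys = m @ y # v" "u = xs @ t @ m"
proof (cases "length u < length xs")
  case True
  with assms have "xs = u @ y # drop (Suc (length u)) xs"
    by (metis (no_types, lifting) Cons_nth_drop_Suc append_eq_conv_conj id_take_nth_drop
        nth_append nth_append_length take_all_iff take_append order_less_imp_le diff_is_0_eq' append_Nil2 take0)
  with assms left show ?thesis
    by (metis append_Cons append_assoc same_append_eq list.inject)
next
  case False
  then have "take (length xs) u = xs"
    using arg_cong[OF assms, of "take (length xs)"] by simp
  then obtain p where p: "u = xs @ p" by (metis append_take_drop_id)
  with assms have "p @ y # v = t @ ys" by simp
  with p show ?thesis
    using middle right by (auto simp: append_eq_append_conv2 Cons_eq_append_conv)
qed

lemma swap_context:
  "swap_triple t t' \<Longrightarrow> knuth_equiv (xs @ t @ ys) (xs @ t' @ ys)"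
  by (rule knuth_context) (rule swap_triple_knuth)

text \<open>
  Outside the three letters of the Knuth move only the result of their cancellation matters, and this is
  the same before and after the move.
\<close>

lemma crystal_move_swap:
  assumes t: "swap_triple t t'" and move: "crystal_move x y z (xs @ t @ ys) w'"
    and yz: "y = x \<and> z = Suc x \<or> y = Suc x \<and> z = x"
  shows "\<exists>v'. crystal_move x y z (xs @ t' @ ys) v' \<and> knuth_equiv w' v'"
proof -
  have eq: "free_lo x t = free_lo x t'" "free_hi x t = free_hi x t'"
    using knuth_free[OF swap_triple_knuth[OF t]] by auto
  obtain u v where uv: "xs @ t @ ys = u @ y # v" "w' = u @ z # v" "free_hi x u = 0" "free_lo x v = 0"
    by (rule crystal_moveE[OF move])
  from uv(1)[symmetric] show ?thesis
  proof (cases rule: append3_cases)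
    case (left m)
    then have "crystal_move x y z (u @ y # (m @ t' @ ys)) (u @ z # (m @ t' @ ys))"
      using uv eq by (intro crystal_moveI) (auto simp: free_lo_append)
    then show ?thesis using swap_context[OF t, of "u @ z # m" ys] left uv(2) by auto
  next
    case (right m)
    then have "crystal_move x y z ((xs @ t' @ m) @ y # v) ((xs @ t' @ m) @ z # v)"
      using uv eq by (intro crystal_moveI) (auto simp: free_hi_append free_lo_append)
    then show ?thesis using swap_context[OF t, of xs "m @ z # v"] right uv(2) by auto
  next
    case (middle p q)
    then have "flips x y z (free_hi x xs) (free_lo x ys) t (p @ z # q)"
      unfolding middle(1) using uv middle
      by (intro flipsI) (auto simp: free_hi_append_0_iff free_lo_append_0_iff)
    from flips_swap[OF t this yz] obtain s' where s': "flips x y z (free_hi x xs) (free_lo x ys) t' s'"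
        "p @ z # q = s' \<or> swap_triple (p @ z # q) s'" by blast
    from s'(1) obtain p' q' where pq: "t' = p' @ y # q'" "s' = p' @ z # q'"
       "free_hi x xs \<le> free_lo x p'" "free_hi x p' = 0" "free_lo x ys \<le> free_hi x q'" "free_lo x q' = 0"
      unfolding flips_def by blast
    have "crystal_move x y z ((xs @ p') @ y # (q' @ ys)) ((xs @ p') @ z # (q' @ ys))"
      using pq by (intro crystal_moveI) (auto simp: free_hi_append_0_iff free_lo_append_0_iff)
    moreover have "knuth_equiv (xs @ (p @ z # q) @ ys) (xs @ s' @ ys)"
      using s'(2) by (elim disjE) (simp_all only: knuth_refl swap_context)
    ultimately show ?thesis using pq uv(2) middle by (intro exI[of _ "xs @ s' @ ys"]) auto
  qed
qed

lemma knuth_step_swap: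
  "knuth_step w v \<or> knuth_step v w \<Longrightarrow>
     \<exists>xs t t' ys. w = xs @ t @ ys \<and> v = xs @ t' @ ys \<and> swap_triple t t'"
  by (elim disjE knuth_step.cases) (blast intro: swap_triple.intros)+

lemma knuth_crystal_move:
  assumes "knuth_equiv w v" and yz: "y = x \<and> z = Suc x \<or> y = Suc x \<and> z = x"
  shows "crystal_move x y z w w' \<Longrightarrow> \<exists>v'. crystal_move x y z v v' \<and> knuth_equiv w' v'"
  using assms(1) unfolding knuth_equiv_def
proof (induction rule: equivclp_induct)
  case base
  then show ?case by (auto simp: knuth_equiv_def[symmetric])
next
  case (step v1 v2)
  then obtain w1 where w1: "crystal_move x y z v1 w1" "knuth_equiv w' w1" by (auto simp: knuth_equiv_def)
  obtain xs t t' ys where "v1 = xs @ t @ ys" "v2 = xs @ t' @ ys" "swap_triple t t'"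
    using knuth_step_swap[OF step(2)] by blast
  with crystal_move_swap[of t t' x y z xs ys w1] w1(1) yz
  obtain w2 where "crystal_move x y z v2 w2" "knuth_equiv w1 w2" by blast
  with w1(2) show ?case using knuth_trans by (auto simp: knuth_equiv_def)
qed

lemma knuth_crystal_step:
  "knuth_equiv w v \<Longrightarrow> crystal_step x w w' \<Longrightarrow> \<exists>v'. crystal_step x v v' \<and> knuth_equiv w' v'"
  unfolding crystal_step_iff_move(1) by (rule knuth_crystal_move) simp_all

lemma knuth_crystal_step_back:
  "knuth_equiv w v \<Longrightarrow> crystal_step x w' w \<Longrightarrow> \<exists>v'. crystal_step x v' v \<and> knuth_equiv w' v'"
  unfolding crystal_step_iff_move(2) by (rule knuth_crystal_move) simp_all

section \<open>Connected components\<close>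

definition crystal_conn :: "nat set \<Rightarrow> nat list \<Rightarrow> nat list \<Rightarrow> bool" where
  "crystal_conn X = equivclp (\<lambda>w w'. \<exists>x\<in>X. crystal_step x w w')"

lemma conn_refl [simp]: "crystal_conn X w w"
  by (simp add: crystal_conn_def)

lemma conn_sym: "crystal_conn X w v \<Longrightarrow> crystal_conn X v w"
  by (simp add: crystal_conn_def equivclp_sym)

lemma conn_trans [trans]: "crystal_conn X u v \<Longrightarrow> crystal_conn X v w \<Longrightarrow> crystal_conn X u w"
  unfolding crystal_conn_def by (rule equivclp_trans)

lemma conn_step: "x \<in> X \<Longrightarrow> crystal_step x w v \<Longrightarrow> crystal_conn X w v"
  unfolding crystal_conn_def by (rule r_into_equivclp) blast

lemma conn_step_back: "x \<in> X \<Longrightarrow> crystal_step x w v \<Longrightarrow> crystal_conn X v w"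
  using conn_step conn_sym by blast

lemma conn_induct [consumes 1, case_names base up down]:
  assumes "crystal_conn X w v" "P w"
    "\<And>u u' x. x \<in> X \<Longrightarrow> crystal_conn X w u \<Longrightarrow> crystal_step x u u' \<Longrightarrow> P u \<Longrightarrow> P u'"
    "\<And>u u' x. x \<in> X \<Longrightarrow> crystal_conn X w u \<Longrightarrow> crystal_step x u' u \<Longrightarrow> P u \<Longrightarrow> P u'"
  shows "P v"
  using assms(1) unfolding crystal_conn_def
  by (induction rule: equivclp_induct) (use assms(2-) in \<open>auto simp: crystal_conn_def\<close>)

lemma conn_mono: "crystal_conn X w v \<Longrightarrow> X \<subseteq> Y \<Longrightarrow> crystal_conn Y w v"
proof (induction rule: conn_induct)
  case (up u u' x) then show ?case using conn_step[of x Y u u'] conn_trans by blast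
next
  case (down u u' x) then show ?case using conn_step_back[of x Y u' u] conn_trans by blast
qed simp

lemma conn_length: "crystal_conn X w v \<Longrightarrow> length v = length w"
  by (induction rule: conn_induct) (auto dest: crystal_step_length)

lemma conn_take: "crystal_conn X w v \<Longrightarrow> crystal_conn X (take n w) (take n v)"
proof (induction rule: conn_induct)
  case (up u u' x) then show ?case using crystal_step_take[of x u u' n] conn_step[of x X] conn_trans by metis
next
  case (down u u' x) then show ?case using crystal_step_take[of x u' u n] conn_step_back[of x X] conn_trans by metis
qed simp

lemma conn_drop: "crystal_conn X w v \<Longrightarrow> crystal_conn X (drop n w) (drop n v)"
proof (induction rule: conn_induct)
  case (up u u' x) then show ?case using crystal_step_drop[of x u u' n] conn_step[of x X] conn_trans by metis
next
  case (down u u' x) then show ?case using crystal_step_drop[of x u' u n] conn_step_back[of x X] conn_trans by metis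
qed simp

lemma conn_no_zero: "crystal_conn {1..} w v \<Longrightarrow> 0 \<notin> set w \<Longrightarrow> 0 \<notin> set v"
  by (induction rule: conn_induct) (auto elim!: crystal_step.cases)

lemma crystal_step_letters:
  assumes "crystal_step x w v" "x \<in> {1..<n}"
  shows "set w \<subseteq> {1..n} \<longleftrightarrow> set v \<subseteq> {1..n}"
  using assms by (elim crystal_step.cases) simp

lemma conn_letters: "crystal_conn {1..<n} w v \<Longrightarrow> set w \<subseteq> {1..n} \<Longrightarrow> set v \<subseteq> {1..n}"
  by (induction rule: conn_induct) (use crystal_step_letters in blast)+

text \<open>
  The same sequence of crystal steps is applied to both words.  As the steps are injective in both
  directions, words that become equal were equal at the start.
\<close>

lemma conn_knuth:
  assumes "crystal_conn X w w'" "knuth_equiv w v"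
  shows "\<exists>v'. crystal_conn X v v' \<and> knuth_equiv w' v' \<and> (w' = v' \<longrightarrow> w = v)"
  using assms(1)
proof (induction rule: conn_induct)
  case base
  then show ?case using assms(2) conn_refl by blast
next
  case (up u u' x)
  then obtain v1 where v1: "crystal_conn X v v1" "knuth_equiv u v1" "u = v1 \<longrightarrow> w = v" by blast
  obtain v2 where "crystal_step x v1 v2" "knuth_equiv u' v2"
    using knuth_crystal_step[OF v1(2) up(3)] by blast
  then show ?case
    using v1 up(1,3) conn_trans[OF v1(1) conn_step[of x X v1 v2]] crystal_step_inj by blast
next
  case (down u u' x)
  then obtain v1 where v1: "crystal_conn X v v1" "knuth_equiv u v1" "u = v1 \<longrightarrow> w = v" by blast
  obtain v2 where "crystal_step x v2 v1" "knuth_equiv u' v2"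
    using knuth_crystal_step_back[OF v1(2) down(3)] by blast
  then show ?case
    using v1 down(1,3) conn_trans[OF v1(1) conn_step_back[of x X v2 v1]] crystal_step_det by blast
qed

definition highest_weight :: "nat set \<Rightarrow> nat list \<Rightarrow> bool" where
  "highest_weight X w \<longleftrightarrow> (\<forall>x\<in>X. free_hi x w = 0)"

definition lowest_weight :: "nat set \<Rightarrow> nat list \<Rightarrow> bool" where
  "lowest_weight X w \<longleftrightarrow> (\<forall>x\<in>X. free_lo x w = 0)"

lemma highest_weight_knuth: "highest_weight X w \<Longrightarrow> knuth_equiv w v \<Longrightarrow> highest_weight X v"
  by (simp add: highest_weight_def knuth_free)

lemma lowest_weight_knuth: "lowest_weight X w \<Longrightarrow> knuth_equiv w v \<Longrightarrow> lowest_weight X v"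
  by (simp add: lowest_weight_def knuth_free)

lemma highest_weight_drop: "highest_weight X w \<Longrightarrow> highest_weight X (drop n w)"
  unfolding highest_weight_def by (metis append_take_drop_id free_hi_append_0)

lemma lowest_weight_take: "lowest_weight X w \<Longrightarrow> lowest_weight X (take n w)"
  unfolding lowest_weight_def by (metis append_take_drop_id free_lo_append_0)

text \<open>
  Lowering a letter decreases the sum of the letters.
\<close>

lemma ex_highest_weight: "\<exists>h. crystal_conn X w h \<and> highest_weight X h"
proof (induction "sum_list w" arbitrary: w rule: less_induct)
  case less
  show ?case
  proof (cases "highest_weight X w")
    case False
    then obtain x w' where x: "x \<in> X" "crystal_step x w' w"
      using crystal_step_exists_back unfolding highest_weight_def by blast
    then have "sum_list w' < sum_list w" by (auto elim!: crystal_step.cases)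
    with less x show ?thesis using conn_step_back conn_trans by blast
  qed (use conn_refl in blast)
qed

lemma ex_lowest_weight:
  assumes "set w \<subseteq> {1..n}"
  shows "\<exists>h. crystal_conn {1..<n} w h \<and> lowest_weight {1..<n} h"
  using assms
proof (induction "\<Sum>y\<leftarrow>w. n - y" arbitrary: w rule: less_induct)
  case less
  show ?case
  proof (cases "lowest_weight {1..<n} w")
    case False
    then obtain x w' where x: "x \<in> {1..<n}" "crystal_step x w w'"
      using crystal_step_exists unfolding lowest_weight_def by blast
    then have "(\<Sum>y\<leftarrow>w'. n - y) < (\<Sum>y\<leftarrow>w. n - y)" by (auto elim!: crystal_step.cases)
    with less x conn_step[OF x] show ?thesis
      using conn_letters[OF conn_step[OF x]] conn_trans by blast
  qed (use conn_refl in blast)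
qed

section \<open>Yamanouchi words\<close>

definition column :: "nat \<Rightarrow> nat list" where
  "column m = rev [1..<Suc m]"

lemma count_column: "1 \<le> x \<Longrightarrow> count_list (column m) x = (if x \<le> m then 1 else 0)"
proof -
  assume x: "1 \<le> x"
  have "distinct (column m)" by (simp add: column_def)
  then have "count_list (column m) x = (if x \<in> set (column m) then 1 else 0)"
    by (metis count_mset distinct_count_atmost_1 set_mset_mset)
  with x show ?thesis by (simp add: column_def)
qed

text \<open>
  Every Knuth move that transports \<open>x\<close> over a larger letter needs a letter in between as a witness behind
  it; in a decreasing word the next letter serves.
\<close>

lemma pass_larger:
  "sorted_wrt (>) (ds @ [x]) \<Longrightarrow> knuth_equiv (x # ds @ [x]) (ds @ [x, x])"
proof (induction ds)
  case (Cons d ds)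
  have "\<exists>y zs. ds @ [x] = y # zs \<and> x \<le> y \<and> y < d"
    using Cons.prems by (cases ds) auto
  then obtain y zs where y: "ds @ [x] = y # zs" "x \<le> y" "y < d" by blast
  have "knuth_equiv (x # d # ds @ [x]) (d # x # ds @ [x])"
    using knuth1[OF y(2,3), of "[]" zs] y(1) by simp
  also have "knuth_equiv \<dots> (d # ds @ [x, x])"
    using knuth_context[OF Cons.IH, of "[d]" "[]"] Cons.prems by simp
  finally show ?case by simp
qed simp

lemma pass_smaller:
  "sorted_wrt (>) (p # es) \<Longrightarrow> p \<le> x \<Longrightarrow> knuth_equiv (p # x # es) (p # es @ [x])"
proof (induction es arbitrary: p)
  case (Cons e es)
  have "knuth_equiv (p # x # e # es) (p # e # x # es)"
    using knuth2[of e p x "[]" es] Cons.prems knuth_sym by simp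
  also have "knuth_equiv \<dots> (p # e # es @ [x])"
    using knuth_context[OF Cons.IH[of e], of "[p]" "[]"] Cons.prems by simp
  finally show ?case by simp
qed simp

text \<open>
  The letter passes the larger entries, meets its own copy in the column, and then passes the smaller
  entries with that copy as witness.
\<close>

lemma column_commute:
  assumes "1 \<le> x" "x \<le> m"
  shows "knuth_equiv (x # column m) (column m @ [x])"
proof -
  define ds es where "ds = rev [Suc x..<Suc m]" and "es = rev [1..<x]"
  have "[1..<Suc m] = [1..<x] @ [x] @ [Suc x..<Suc m]"
    using assms upt_add_eq_append[of 1 x "Suc m - x"] by (simp add: upt_conv_Cons)
  then have c: "column m = ds @ x # es" by (simp add: column_def ds_def es_def)
  have dec: "sorted_wrt (>) (rev [a..<b])" for a b :: nat
    by (induction b) auto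
  have ds: "sorted_wrt (>) (ds @ [x])" 
    using dec[of "Suc x" "Suc m"] by (simp add: ds_def sorted_wrt_append Suc_le_eq del: upt_Suc)
  have es: "sorted_wrt (>) (x # es)"
    using dec[of 1 x] by (simp add: es_def)
  have "knuth_equiv (x # ds @ x # es) (ds @ x # x # es)"
    using knuth_context[OF pass_larger[OF ds], of "[]" es] by simp
  also have "knuth_equiv \<dots> (ds @ x # es @ [x])"
    using knuth_context[OF pass_smaller[OF es, of x], of ds "[]"] by simp
  finally show ?thesis by (simp add: c)
qed

lemma columns_commute:
  "1 \<le> x \<Longrightarrow> \<forall>m\<in>set ms. x \<le> m \<Longrightarrow>
     knuth_equiv (x # concat (map column ms)) (concat (map column ms) @ [x])"
proof (induction ms)
  case (Cons m ms)
  have "knuth_equiv (x # column m @ concat (map column ms)) (column m @ [x] @ concat (map column ms))"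
    using knuth_context[OF column_commute, of x m "[]"] Cons.prems by simp
  also have "knuth_equiv \<dots> (column m @ concat (map column ms) @ [x])"
    using knuth_context[OF Cons.IH, of "column m" "[]"] Cons.prems by simp
  finally show ?case by simp
qed simp

lemma count_columns:
  "1 \<le> x \<Longrightarrow> count_list (concat (map column ms)) x = length (filter (\<lambda>m. x \<le> m) ms)"
  by (induction ms) (auto simp: count_column)

text \<open>
  The first letter \<open>x\<close> of a Yamanouchi word commutes with all columns of height at least \<open>x\<close>.  By the
  Yamanouchi condition one of the remaining columns has height \<open>x - 1\<close>, and putting \<open>x\<close> on top of the
  first of them again gives a column.
\<close>

lemma yamanouchi_columns:
  "highest_weight {1..} w \<Longrightarrow> 0 \<notin> set w \<Longrightarrow>
     \<exists>ms. sorted_wrt (\<ge>) ms \<and> 0 \<notin> set ms \<and> knuth_equiv w (concat (map column ms))"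
proof (induction w)
  case Nil
  then show ?case by (intro exI[of _ "[]"]) simp
next
  case (Cons x w)
  from Cons.prems have x: "1 \<le> x" by (cases x) auto
  from Cons.prems(1) have "highest_weight {1..} w"
    using highest_weight_drop[of "{1..}" "x # w" 1] by simp
  with Cons obtain ms where ms: "sorted_wrt (\<ge>) ms" "0 \<notin> set ms" "knuth_equiv w (concat (map column ms))"
    by auto
  define as bs where "as = takeWhile (\<lambda>m. x \<le> m) ms" and "bs = dropWhile (\<lambda>m. x \<le> m) ms"
  have split: "ms = as @ bs" by (simp add: as_def bs_def)
  have as: "\<forall>m\<in>set as. x \<le> m" by (auto simp: as_def dest: set_takeWhileD)
  have bs: "\<forall>m\<in>set bs. m < x"
  proof (cases bs)
    case (Cons b bs')
    then have "b < x" using hd_dropWhile[of "\<lambda>m. x \<le> m" ms] by (simp add: bs_def)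
    with Cons ms(1) show ?thesis by (auto simp: split sorted_wrt_append)
  qed simp
  have "knuth_equiv (x # w) (x # concat (map column ms))"
    using knuth_context[OF ms(3), of "[x]" "[]"] by simp
  also have "knuth_equiv \<dots> (concat (map column as) @ [x] @ concat (map column bs))"
    using knuth_context[OF columns_commute[OF x as], of "[]" "concat (map column bs)"] by (simp add: split)
  finally have eq: "knuth_equiv (x # w) (concat (map column as) @ [x] @ concat (map column bs))" .
  show ?case
  proof (cases "x = 1")
    case True
    with bs ms(2) have "bs = []" by (cases bs) (auto simp: split)
    with eq True have "knuth_equiv (x # w) (concat (map column (as @ [1])))" by (simp add: column_def)
    moreover have "sorted_wrt (\<ge>) (as @ [1])" "0 \<notin> set (as @ [1])"
      using ms as True by (auto simp: split sorted_wrt_append)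
    ultimately show ?thesis by blast
  next
    case False
    with x obtain z where z: "x = Suc z" "1 \<le> z" by (cases x) auto
    have "free_hi z (x # w) = 0" using Cons.prems(1) z unfolding highest_weight_def by (metis atLeast_iff)
    then have "count_list (x # w) (Suc z) \<le> count_list (x # w) z"
      using free_count[of "x # w" z] by simp
    then have "count_list w (Suc z) < count_list w z" using z by simp
    then have "count_list (concat (map column ms)) (Suc z) < count_list (concat (map column ms)) z"
      using knuth_mset[OF ms(3)] by (simp flip: count_mset)
    then have "length (filter (\<lambda>m. x \<le> m) ms) < length (filter (\<lambda>m. z \<le> m) ms)"
      using count_columns z by simp
    have "z \<in> set bs"
    proof (rule ccontr)
      assume "z \<notin> set bs"
      then have "filter (\<lambda>m. z \<le> m) bs = []" 
        using bs z by (auto simp: filter_empty_conv less_Suc_eq_le intro: le_antisym)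
      then have "length (filter (\<lambda>m. z \<le> m) ms) \<le> length as" by (simp add: split)
      also have "\<dots> = length (filter (\<lambda>m. x \<le> m) as)" using as by simp
      also have "\<dots> \<le> length (filter (\<lambda>m. x \<le> m) ms)" by (simp add: split)
      finally show False using \<open>length (filter (\<lambda>m. x \<le> m) ms) < length (filter (\<lambda>m. z \<le> m) ms)\<close> by simp
    qed
    then obtain b bs' where b: "bs = b # bs'" by (cases bs) auto
    with \<open>z \<in> set bs\<close> ms(1) have "z \<le> b" by (auto simp: split sorted_wrt_append)
    with b bs z have bz: "b = z" by simp
    have cx: "column x = x # column z" by (simp add: column_def z(1))
    with eq have "knuth_equiv (x # w) (concat (map column (as @ x # bs')))" by (simp add: b bz cx)
    moreover have "sorted_wrt (\<ge>) (as @ x # bs')" "0 \<notin> set (as @ x # bs')"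
      using ms as z by (auto simp: split b bz sorted_wrt_append)
    ultimately show ?thesis by blast
  qed
qed

lemma partition_eq_by_counts:
  fixes ms ns :: "nat list"
  assumes "sorted_wrt (\<ge>) ms" "sorted_wrt (\<ge>) ns" "0 \<notin> set ms" "0 \<notin> set ns"
    and count: "\<And>x. 1 \<le> x \<Longrightarrow> length (filter (\<lambda>m. x \<le> m) ms) = length (filter (\<lambda>m. x \<le> m) ns)"
  shows "ms = ns"
proof -
  have *: "length (filter (\<lambda>m. x \<le> m) ks) = count (mset ks) x + length (filter (\<lambda>m. Suc x \<le> m) ks)"
    for ks x by (induction ks) auto
  have "count (mset ms) x = count (mset ns) x" for x
  proof (cases x)
    case 0
    then show ?thesis using assms(3,4) by (metis count_mset_0_iff)
  next
    case (Suc y)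
    then show ?thesis using count[of x] count[of "Suc x"] *[of x ms] *[of x ns] by simp
  qed
  then have "mset (rev ms) = mset (rev ns)" by (simp add: multiset_eqI)
  moreover have "sorted (rev ms)" "sorted (rev ns)"
    using assms(1,2) by (auto simp: sorted_wrt_rev)
  ultimately have "rev ms = rev ns" by (metis properties_for_sort)
  then show ?thesis by simp
qed

text \<open>
  The heights of the columns can be read off from the evaluation.
\<close>

lemma yamanouchi_knuth:
  assumes "highest_weight {1..} u" "highest_weight {1..} v" "0 \<notin> set u" "0 \<notin> set v" "mset u = mset v"
  shows "knuth_equiv u v"
proof -
  obtain ms where ms: "sorted_wrt (\<ge>) ms" "0 \<notin> set ms" "knuth_equiv u (concat (map column ms))"
    using yamanouchi_columns assms by blast
  obtain ns where ns: "sorted_wrt (\<ge>) ns" "0 \<notin> set ns" "knuth_equiv v (concat (map column ns))"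
    using yamanouchi_columns assms by blast
  have "ms = ns"
  proof (rule partition_eq_by_counts)
    fix x :: nat assume x: "1 \<le> x"
    have "count_list (concat (map column ms)) x = count_list (concat (map column ns)) x"
      using knuth_mset[OF ms(3)] knuth_mset[OF ns(3)] assms(5) by (simp flip: count_mset)
    then show "length (filter (\<lambda>m. x \<le> m) ms) = length (filter (\<lambda>m. x \<le> m) ns)"
      using count_columns[OF x] by simp
  qed (use ms ns in auto)
  with ms(3) ns(3) show ?thesis using knuth_trans knuth_sym by blast
qed

section \<open>Crystal steps on tableaux\<close>

definition le_count :: "nat list \<Rightarrow> nat \<Rightarrow> nat" where
  "le_count r x = length (filter (\<lambda>y. y \<le> x) r)"

lemma le_count_Nil [simp]: "le_count [] x = 0"
  by (simp add: le_count_def)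

lemma le_count_append [simp]: "le_count (u @ v) x = le_count u x + le_count v x"
  by (simp add: le_count_def)

lemma le_count_Cons [simp]: "le_count (y # v) x = (if y \<le> x then 1 else 0) + le_count v x"
  by (simp add: le_count_def)

lemma le_count_Suc: "le_count r (Suc x) = le_count r x + count_list r (Suc x)"
  by (induction r) auto

lemma le_count_0: "0 \<notin> set r \<Longrightarrow> le_count r 0 = 0"
  by (induction r) auto

lemma le_count_le: "le_count r x \<le> length r"
  by (simp add: le_count_def)

lemma le_count_all: "\<forall>y\<in>set r. y \<le> x \<Longrightarrow> le_count r x = length r"
  by (simp add: le_count_def)

lemma sorted_nth_le_iff:
  assumes "sorted r" "j < length r"
  shows "r ! j \<le> x \<longleftrightarrow> j < le_count r x"
  using assms
proof (induction r arbitrary: j)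
  case (Cons y r)
  show ?case
  proof (cases j)
    case 0
    with Cons.prems show ?thesis
      by (auto simp: le_count_def filter_empty_conv)
  next
    case (Suc k)
    have "r ! k \<le> x \<longleftrightarrow> k < le_count r x" using Cons Suc by auto
    moreover have "r ! k \<le> x \<Longrightarrow> y \<le> x" using Cons.prems Suc by (auto dest!: nth_mem)
    moreover have "\<not> y \<le> x \<Longrightarrow> le_count r x = 0"
      using Cons.prems by (auto simp: le_count_def filter_empty_conv)
    ultimately show ?thesis using Suc by auto
  qed
qed simp

lemma row_simps [simp]: "row i [] = []"
  by (simp add: row_def)

lemma row_ge [simp]: "length T \<le> i \<Longrightarrow> row i T = []"
  by (simp add: row_def)

lemma row_less: "i < length T \<Longrightarrow> row i T = T ! i"
  by (simp add: row_def)

lemma row_Cons [simp]: "row 0 (r # T) = r" "row (Suc i) (r # T) = row i T"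
  by (simp_all add: row_def)

lemma nonempty_rows_iff: "is_partition (shape T) \<Longrightarrow> [] \<notin> set T"
  unfolding is_partition_def shape_def by force

text \<open>
  A tableau is a Gelfand--Tsetlin pattern: in terms of the numbers of entries at most \<open>x\<close> in the rows,
  strictly increasing columns become interlacing inequalities.  They are insensitive to the positions of
  the entries, which makes them convenient for operators that change letters.
\<close>

lemma tableau_iff:
  "is_tableau T \<longleftrightarrow> [] \<notin> set T \<and> (\<forall>r\<in>set T. sorted r \<and> 0 \<notin> set r) \<and>
     (\<forall>i x. le_count (row (Suc i) T) (Suc x) \<le> le_count (row i T) x)"
proof
  assume T: "is_tableau T"
  have "le_count (row (Suc i) T) (Suc x) \<le> le_count (row i T) x" for i x
  proof (cases "Suc i < length T \<and> 0 < le_count (T ! Suc i) (Suc x)")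
    case True
    define j where "j = le_count (T ! Suc i) (Suc x) - 1"
    have sh: "shape T ! Suc i \<le> shape T ! i"
      using T True unfolding is_tableau_def is_partition_def shape_def
      by (auto simp: sorted_wrt_iff_nth_less)
    have j: "j < le_count (T ! Suc i) (Suc x)" using True by (simp add: j_def)
    with le_count_le[of "T ! Suc i"] have jl: "j < length (T ! Suc i)" by (metis order_less_le_trans)
    have s: "sorted (T ! Suc i)" "sorted (T ! i)"
      using T True unfolding is_tableau_def by (auto simp: Suc_lessD)
    have "T ! Suc i ! j \<le> Suc x" using sorted_nth_le_iff[OF s(1) jl] j by simp
    moreover have "T ! i ! j < T ! Suc i ! j" using T True jl unfolding is_tableau_def by blast
    ultimately have "T ! i ! j \<le> x" by simp
    moreover have "j < length (T ! i)" using jl sh True by (simp add: shape_def)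
    ultimately have "j < le_count (T ! i) x" using sorted_nth_le_iff[OF s(2)] by blast
    then show ?thesis using True by (simp add: row_def j_def)
  qed (auto simp: row_def)
  with T show "[] \<notin> set T \<and> (\<forall>r\<in>set T. sorted r \<and> 0 \<notin> set r) \<and>
     (\<forall>i x. le_count (row (Suc i) T) (Suc x) \<le> le_count (row i T) x)"
    using nonempty_rows_iff by (auto simp: is_tableau_def)
next
  assume R: "[] \<notin> set T \<and> (\<forall>r\<in>set T. sorted r \<and> 0 \<notin> set r) \<and>
     (\<forall>i x. le_count (row (Suc i) T) (Suc x) \<le> le_count (row i T) x)"
  have sh: "length (T ! Suc i) \<le> length (T ! i)" if i: "Suc i < length T" for i
  proof -
    define x where "x = Max (set (T ! Suc i) \<union> set (T ! i))"
    have "\<forall>y\<in>set (T ! Suc i). y \<le> Suc x" "\<forall>y\<in>set (T ! i). y \<le> x"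
      by (auto simp: x_def le_SucI)
    then have "le_count (T ! Suc i) (Suc x) = length (T ! Suc i)" "le_count (T ! i) x = length (T ! i)"
      by (auto intro: le_count_all)
    with R i show ?thesis by (metis Suc_lessD row_less)
  qed
  have "sorted_wrt (\<ge>) (shape T)"
    by (subst sorted_wrt_iff_nth_Suc_transp) (auto simp: transp_def shape_def sh)
  moreover have "T ! i ! j < T ! Suc i ! j" if i: "Suc i < length T" "j < length (T ! Suc i)" for i j
  proof -
    have s: "sorted (T ! Suc i)" "sorted (T ! i)" "0 \<notin> set (T ! Suc i)" using R i by auto
    then obtain x where x: "T ! Suc i ! j = Suc x" using i(2) by (metis nth_mem not0_implies_Suc)
    have "j < le_count (T ! Suc i) (Suc x)" using sorted_nth_le_iff[OF s(1) i(2), of "Suc x"] x by simp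
    also have "\<dots> \<le> le_count (T ! i) x" using R i by (metis Suc_lessD row_less)
    finally have "T ! i ! j \<le> x"
      using sorted_nth_le_iff[OF s(2), of j x] i sh[OF i(1)] by simp
    with x show ?thesis by simp
  qed
  ultimately show "is_tableau T"
    using R unfolding is_tableau_def is_partition_def shape_def by auto
qed

lemma tableau_row: "is_tableau T \<Longrightarrow> sorted (row i T) \<and> 0 \<notin> set (row i T)"
  by (auto simp: is_tableau_def row_def)

lemma tableau_interlacing:
  "is_tableau T \<Longrightarrow> le_count (row (Suc i) T) (Suc x) \<le> le_count (row i T) x"
  using tableau_iff by blast

lemma tableau_no_zero: "is_tableau T \<Longrightarrow> 0 \<notin> set (reading_word T)"
  by (auto simp: is_tableau_def reading_word_def)

lemma sorted_free:
  "sorted r \<Longrightarrow> free_lo x r = count_list r x"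
  "sorted r \<Longrightarrow> free_hi x r = count_list r (Suc x)"
proof -
  have *: "count_list r x = 0" if "\<forall>y\<in>set r. Suc x \<le> y" for r
    using that by (auto simp: count_list_0_iff)
  show lo: "sorted r \<Longrightarrow> free_lo x r = count_list r x" for r
    by (induction r) (auto simp: *)
  show "sorted r \<Longrightarrow> free_hi x r = count_list r (Suc x)"
    by (induction r) (auto simp: lo *)
qed

lemma concat_split:
  "concat xs = u @ y # v \<Longrightarrow>
     \<exists>B r A p q. xs = B @ r # A \<and> r = p @ y # q \<and> u = concat B @ p \<and> v = q @ concat A"
proof (induction xs arbitrary: u)
  case (Cons z xs)
  from Cons.prems have "z @ concat xs = u @ (y # v)" by simp
  then consider us where "z = u @ us" "us @ concat xs = y # v" "us \<noteq> []"
    | us where "u = z @ us" "concat xs = us @ y # v"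
    unfolding append_eq_append_conv2 by (metis append_Nil append_Nil2)
  then show ?case
  proof cases
    case 1
    then obtain q where "us = y # q" "v = q @ concat xs" by (cases us) auto
    with 1 show ?thesis
      by (intro exI[of _ "[]"] exI[of _ z] exI[of _ xs] exI[of _ u] exI[of _ q]) simp
  next
    case 2
    from Cons.IH[OF 2(2)] obtain B r A p q where
      "xs = B @ r # A" "r = p @ y # q" "us = concat B @ p" "v = q @ concat A" by blast
    with 2 show ?thesis
      by (intro exI[of _ "z # B"] exI[of _ r] exI[of _ A] exI[of _ p] exI[of _ q]) simp
  qed
qed simp

lemma reading_split:
  assumes "reading_word T = u @ y # v"
  obtains A B p q where "T = A @ (p @ y # q) # B" "u = reading_word B @ p" "v = q @ reading_word A"
proof -
  obtain B r A p q where "rev T = B @ r # A" "r = p @ y # q" "u = concat B @ p" "v = q @ concat A"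
    using concat_split assms unfolding reading_word_def by metis
  moreover from this(1) have "T = rev A @ r # rev B" by (metis append.assoc append_Cons append_Nil rev.simps(2) rev_append rev_rev_ident)
  ultimately show ?thesis using that[of "rev A" p q "rev B"] by (simp add: reading_word_def)
qed

lemma reading_word_simps [simp]:
  "reading_word [] = []"
  "reading_word (A @ B) = reading_word B @ reading_word A"
  "reading_word (r # B) = reading_word B @ r"
  by (simp_all add: reading_word_def)

lemma row_middle:
  "row i (A @ r # B) = (if i < length A then A ! i else if i = length A then r else row (i - Suc (length A)) B)"
proof -
  consider "i < length A" | "i = length A" | k where "i = Suc (length A) + k"
    by (metis less_iff_Suc_add linorder_neqE_nat add_Suc)
  then show ?thesis by cases (auto simp: row_def nth_append)
qed

lemma crystal_stepE:
  assumes "crystal_step x w w'"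
  obtains u v where "w = u @ x # v" "w' = u @ Suc x # v" "free_hi x u = 0" "free_lo x v = 0"
  using assms by cases simp

text \<open>
  Raising the entry only affects the inequality that compares row \<open>j\<close>, which contains it, with the row
  above.  This inequality is not tight: the entries \<open>x + 1\<close> of the row above are cancelled by entries \<open>x\<close>
  of row \<open>j\<close> that stand to the left of the free one.
\<close>

lemma crystal_step_tableau:
  assumes T: "is_tableau T" and x: "1 \<le> x" and step: "crystal_step x (reading_word T) w"
  shows "\<exists>T'. is_tableau T' \<and> shape T' = shape T \<and> reading_word T' = w"
proof -
  obtain u v where uv: "reading_word T = u @ x # v" "w = u @ Suc x # v" "free_hi x u = 0" "free_lo x v = 0"
    by (rule crystal_stepE[OF step])
  obtain A B p q where s: "T = A @ (p @ x # q) # B" "u = reading_word B @ p" "v = q @ reading_word A"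
    by (rule reading_split[OF uv(1)])
  define j where "j = length A"
  define T' where "T' = A @ (p @ Suc x # q) # B"
  have r: "sorted (p @ x # q)" using T s(1) by (auto simp: is_tableau_def)
  then have sp: "sorted p" "sorted q" "\<forall>y\<in>set p. y \<le> x" "\<forall>y\<in>set q. x \<le> y"
    by (auto simp: sorted_append)
  have "free_lo x q = 0" using uv(4) s(3) free_lo_append_0 by blast
  then have "x \<notin> set q" using sorted_free(1)[OF sp(2)] by (simp add: count_list_0_iff)
  then have q: "\<forall>y\<in>set q. Suc x \<le> y" using sp(4) by (metis le_antisym not_less_eq_eq)
  have above: "count_list (row (Suc j) T) (Suc x) < count_list (row j T) x"
  proof (cases B)
    case Nil
    then show ?thesis by (simp add: s(1) row_middle j_def)
  next
    case (Cons b B')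
    have "sorted b" using T s(1) Cons by (auto simp: is_tableau_def)
    have "count_list b (Suc x) = free_hi x b" using sorted_free(2)[OF \<open>sorted b\<close>] by simp
    also have "\<dots> \<le> free_hi x (reading_word B)" by (simp add: Cons free_hi_append)
    also have "\<dots> \<le> free_lo x p" using uv(3) s(2) by (simp add: free_hi_append)
    also have "\<dots> = count_list p x" using sorted_free(1)[OF sp(1)] .
    finally show ?thesis by (simp add: s(1) row_middle j_def Cons)
  qed
  have E: "le_count (row i T') y = le_count (row i T) y - (if i = j \<and> y = x then 1 else 0)" for i y
    by (auto simp: T'_def s(1) row_middle j_def)
  have "le_count (row (Suc i) T') (Suc y) \<le> le_count (row i T') y" for i y
  proof (cases "i = j \<and> y = x")
    case True
    obtain z where z: "x = Suc z" using x by (cases x) auto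
    have "le_count (row (Suc j) T) (Suc x) = le_count (row (Suc j) T) x + count_list (row (Suc j) T) (Suc x)"
      by (rule le_count_Suc)
    also have "\<dots> < le_count (row j T) z + count_list (row j T) x"
      using above tableau_interlacing[OF T, of j z] z by simp
    also have "\<dots> = le_count (row j T) x" by (simp add: z le_count_Suc)
    finally show ?thesis using True E by simp
  next
    case False
    then show ?thesis using E[of "Suc i" "Suc y"] E[of i y] tableau_interlacing[OF T, of i y] by auto
  qed
  moreover have "sorted (p @ Suc x # q)" using r q by (auto simp: sorted_append le_SucI)
  ultimately have "is_tableau T'" using T unfolding tableau_iff T'_def s(1) by auto
  then show ?thesis by (intro exI[of _ T']) (simp add: T'_def s uv shape_def)
qed

text \<open>
  Dually, the only inequality at risk compares row \<open>j\<close> with the row below, whose entries \<open>x\<close> are all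
  cancelled by entries \<open>x + 1\<close> of row \<open>j\<close> to the right of the free one.
\<close>

lemma crystal_step_tableau_back:
  assumes T: "is_tableau T" and x: "1 \<le> x" and step: "crystal_step x w (reading_word T)"
  shows "\<exists>T'. is_tableau T' \<and> shape T' = shape T \<and> reading_word T' = w"
proof -
  obtain u v where uv: "reading_word T = u @ Suc x # v" "w = u @ x # v" "free_hi x u = 0" "free_lo x v = 0"
    by (rule crystal_stepE[OF step])
  obtain A B p q where s: "T = A @ (p @ Suc x # q) # B" "u = reading_word B @ p" "v = q @ reading_word A"
    by (rule reading_split[OF uv(1)])
  define j where "j = length A"
  define T' where "T' = A @ (p @ x # q) # B"
  have r: "sorted (p @ Suc x # q)" using T s(1) by (auto simp: is_tableau_def)
  then have sp: "sorted p" "sorted q" "\<forall>y\<in>set p. y \<le> Suc x" "\<forall>y\<in>set q. Suc x \<le> y"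
    by (auto simp: sorted_append)
  have "free_hi x p = 0" using uv(3) s(2) free_hi_append_0 by blast
  then have "Suc x \<notin> set p" using sorted_free(2)[OF sp(1)] by (simp add: count_list_0_iff)
  then have p: "\<forall>y\<in>set p. y \<le> x" using sp(3) by (metis le_Suc_eq)
  have below: "count_list (row i T) x < count_list (row j T) (Suc x)" if "j = Suc i" for i
  proof -
    have i: "i < length A" using that j_def by simp
    then have "A ! i = last A" using that j_def by (metis diff_Suc_1 last_conv_nth length_greater_0_conv list.size(3) not_less0)
    moreover have "sorted (A ! i)" using T s(1) i by (auto simp: is_tableau_def)
    ultimately have "count_list (A ! i) x = free_lo x (last A)" using sorted_free(1) by metis
    also have "\<dots> \<le> free_lo x (reading_word A)"
      using i by (cases A rule: rev_cases) (auto simp: free_lo_append)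
    also have "\<dots> \<le> free_hi x q" using uv(4) s(3) by (simp add: free_lo_append)
    also have "\<dots> = count_list q (Suc x)" using sorted_free(2)[OF sp(2)] .
    finally show ?thesis using i by (simp add: s(1) row_middle j_def)
  qed
  have E: "le_count (row i T') y = le_count (row i T) y + (if i = j \<and> y = x then 1 else 0)" for i y
    by (auto simp: T'_def s(1) row_middle j_def)
  have "le_count (row (Suc i) T') (Suc y) \<le> le_count (row i T') y" for i y
  proof (cases "Suc i = j \<and> Suc y = x")
    case True
    have "le_count (row j T) x + count_list (row j T) (Suc x) = le_count (row j T) (Suc x)"
      by (rule le_count_Suc[symmetric])
    also have "\<dots> \<le> le_count (row i T) x" using tableau_interlacing[OF T, of i x] True by simp
    also have "\<dots> = le_count (row i T) y + count_list (row i T) x"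
      using True by (metis le_count_Suc)
    also have "\<dots> < le_count (row i T) y + count_list (row j T) (Suc x)" using below[of i] True by simp
    finally show ?thesis using True E by simp
  next
    case False
    then show ?thesis using E[of "Suc i" "Suc y"] E[of i y] tableau_interlacing[OF T, of i y] by auto
  qed
  moreover have "sorted (p @ x # q)" using r p by (auto simp: sorted_append)
  moreover have "0 \<notin> set (p @ x # q)" using T x unfolding s(1) is_tableau_def by auto
  ultimately have "is_tableau T'" using T unfolding tableau_iff T'_def s(1) by auto
  then show ?thesis by (intro exI[of _ T']) (simp add: T'_def s uv shape_def)
qed

lemma conn_tableau:
  assumes "crystal_conn {1..} (reading_word T) w" "is_tableau T"
  shows "\<exists>T'. is_tableau T' \<and> shape T' = shape T \<and> reading_word T' = w"
  using assms(1)
proof (induction rule: conn_induct)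
  case base
  then show ?case using assms(2) by blast
next
  case (up u u' x)
  then show ?case using crystal_step_tableau[of _ x u'] by fastforce
next
  case (down u u' x)
  then show ?case using crystal_step_tableau_back[of _ x u'] by fastforce
qed

section \<open>Canonical tableaux\<close>

text \<open>
  The tableau of shape \<open>\<lambda>\<close> and evaluation \<open>(0\<^sup>m, \<lambda>)\<close>.
\<close>

definition canonical :: "nat \<Rightarrow> nat list \<Rightarrow> tableau" where
  "canonical m lam = map (\<lambda>i. replicate (lam ! i) (Suc (m + i))) [0..<length lam]"

lemma canonical_Nil [simp]: "canonical m [] = []"
  by (simp add: canonical_def)

lemma canonical_snoc: "canonical m (lam @ [a]) = canonical m lam @ [replicate a (Suc (m + length lam))]"
  by (simp add: canonical_def nth_append)

lemma canonical_append: "canonical m (lam @ mu) = canonical m lam @ canonical (m + length lam) mu"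
  by (induction mu rule: rev_induct) (simp_all add: canonical_snoc flip: append_assoc)

lemma length_canonical [simp]: "length (canonical m lam) = length lam"
  by (simp add: canonical_def)

lemma nth_canonical: "i < length lam \<Longrightarrow> canonical m lam ! i = replicate (lam ! i) (Suc (m + i))"
  by (simp add: canonical_def)

lemma shape_canonical [simp]: "shape (canonical m lam) = lam"
  by (simp add: canonical_def shape_def comp_def map_nth)

lemma partition_decreasing: "is_partition lam \<Longrightarrow> i \<le> j \<Longrightarrow> j < length lam \<Longrightarrow> lam ! j \<le> lam ! i"
  unfolding is_partition_def by (cases "i = j") (auto simp: sorted_wrt_iff_nth_less)

lemma canonical_tableau:
  assumes "is_partition lam"
  shows "is_tableau (canonical m lam)"
proof -
  have "sorted r \<and> 0 \<notin> set r" if "r \<in> set (canonical m lam)" for r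
    using that by (auto simp: canonical_def sorted_replicate)
  moreover have "canonical m lam ! i ! j < canonical m lam ! Suc i ! j"
    if "Suc i < length lam" "j < length (canonical m lam ! Suc i)" for i j
    using that partition_decreasing[OF assms, of i "Suc i"] by (simp add: nth_canonical)
  ultimately show ?thesis using assms unfolding is_tableau_def by simp
qed

lemma count_canonical:
  "count_list (reading_word (canonical m lam)) y =
     (if m < y \<and> y \<le> m + length lam then lam ! (y - Suc m) else 0)"
proof (induction lam rule: rev_induct)
  case (snoc a lam)
  have "count_list (replicate a z) y = (if z = y then a else 0)" for z by (induction a) auto
  with snoc show ?case by (auto simp: canonical_snoc nth_append not_le)
qed simp

lemma free_hi_replicate: "free_hi x (replicate a y) = (if y = Suc x then a else 0)"
  by (subst sorted_free(2)) (auto simp: sorted_replicate, (induction a, auto)+)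

lemma partition_snocD: "is_partition (lam @ [a]) \<Longrightarrow> is_partition lam \<and> a > 0 \<and> (lam \<noteq> [] \<longrightarrow> a \<le> last lam)"
  by (auto simp: is_partition_def sorted_wrt_append)

lemma canonical_highest: "is_partition lam \<Longrightarrow> highest_weight {1..} (reading_word (canonical 0 lam))"
proof (induction lam rule: rev_induct)
  case Nil
  then show ?case by (simp add: highest_weight_def)
next
  case (snoc a lam)
  note p = partition_snocD[OF snoc.prems]
  have IH: "free_hi x (reading_word (canonical 0 lam)) = 0" if "1 \<le> x" for x
    using snoc.IH p that by (auto simp: highest_weight_def)
  have "free_hi x (replicate a (Suc (length lam))) \<le> free_lo x (reading_word (canonical 0 lam))" if "1 \<le> x" for x
  proof (cases "x = length lam")
    case True
    with that have "lam \<noteq> []" by auto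
    with p True have "a \<le> lam ! (x - 1)" by (simp add: last_conv_nth)
    moreover have "count_list (reading_word (canonical 0 lam)) x = lam ! (x - 1)"
      using that True \<open>lam \<noteq> []\<close> by (simp add: count_canonical)
    moreover have "count_list (reading_word (canonical 0 lam)) (Suc x) = 0"
      using True by (simp add: count_canonical)
    moreover note free_count[of "reading_word (canonical 0 lam)" x] IH[OF that]
    ultimately show ?thesis using True by (simp add: free_hi_replicate)
  qed (simp add: free_hi_replicate)
  with IH show ?case by (simp add: highest_weight_def canonical_snoc free_hi_append)
qed

lemma tableau_entry_gt: "is_tableau T \<Longrightarrow> y \<in> set (row i T) \<Longrightarrow> i < y"
proof -
  assume T: "is_tableau T"
  have "le_count (row i T) i = 0" for i
  proof (induction i)
    case 0
    then show ?case using tableau_row[OF T] le_count_0 by blast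
  next
    case (Suc i)
    then show ?case using tableau_interlacing[OF T, of i i] by simp
  qed
  then show "y \<in> set (row i T) \<Longrightarrow> i < y"
    by (force simp: le_count_def filter_empty_conv)
qed

lemma reading_take_row:
  "i < length T \<Longrightarrow> reading_word T = reading_word (drop (Suc i) T) @ row i T @ reading_word (take i T)"
  by (metis append_assoc id_take_nth_drop reading_word_simps(2,3) row_less)

lemma sorted_le_last: "sorted r \<Longrightarrow> y \<in> set r \<Longrightarrow> y \<le> last r"
  by (induction r) auto

text \<open>
  The last entry of row \<open>i\<close> is read before the rows below.  If it were too large, the letter one less
  could not occur in those rows, so that it would be free.  For \<open>d = 0\<close> this says that a Yamanouchi
  tableau is canonical; the case \<open>d = 1\<close> is used when the letter \<open>1\<close> is left out of consideration.
\<close>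

lemma highest_weight_rows:
  assumes T: "is_tableau T" and h: "highest_weight {Suc d..} (reading_word T)"
  shows "y \<in> set (row i T) \<Longrightarrow> y \<le> Suc i + d"
proof (induction i arbitrary: y rule: less_induct)
  case (less i)
  have i: "i < length T" using less.prems by (cases "i < length T") auto
  define z where "z = last (row i T)"
  have ne: "row i T \<noteq> []" using less.prems by auto
  have "y \<le> z"
    unfolding z_def by (rule sorted_le_last) (simp_all add: less.prems tableau_row[OF T])
  moreover have "z \<le> Suc i + d"
  proof (rule ccontr)
    assume "\<not> z \<le> Suc i + d"
    then obtain x where x: "z = Suc x" "Suc i + d \<le> x" by (cases z) auto
    have "reading_word T = (reading_word (drop (Suc i) T) @ butlast (row i T)) @ ([z] @ reading_word (take i T))"
      using reading_take_row[OF i] append_butlast_last_id[OF ne, folded z_def] by (metis append.assoc)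
    moreover have "free_hi x (reading_word T) = 0"
      using h x(2) unfolding highest_weight_def by simp
    ultimately have "free_hi x ([z] @ reading_word (take i T)) = 0"
      using free_hi_append_0 by metis
    then have "0 < free_lo x (reading_word (take i T))"
      by (simp add: x(1) split: if_splits)
    then have "count_list (reading_word (take i T)) x > 0"
    proof -
      have "free_lo x w \<le> count_list w x" for w by (induction w) auto
      with \<open>0 < free_lo x (reading_word (take i T))\<close> show ?thesis by (metis le_zero_eq not_gr_zero)
    qed
    then have "x \<in> set (reading_word (take i T))" by (metis count_list_0_iff less_irrefl)
    then obtain k where k: "k < i" "x \<in> set (row k T)"
      using i by (auto simp: reading_word_def in_set_conv_nth[of _ "take i T"] row_def)
    from less.IH[OF this] k(1) x(2) show False by simp
  qed
  ultimately show ?case by simp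
qed

lemma tableau_eqI:
  "reading_word T = reading_word T' \<Longrightarrow> shape T = shape T' \<Longrightarrow> T = T'"
proof -
  assume *: "reading_word T = reading_word T'" "shape T = shape T'"
  have l: "length (rev T) = length (rev T')" using *(2) unfolding shape_def by (metis length_map length_rev)
  have "length (T ! i) = length (T' ! i)" if "i < length T" for i
    using *(2) that l unfolding shape_def by (metis length_rev nth_map)
  then have "\<forall>(x, y) \<in> set (zip (rev T) (rev T')). length x = length y"
    using l by (auto simp: set_zip rev_nth)
  with *(1) l have "rev T = rev T'"
    unfolding reading_word_def by (intro concat_injective)
  then show "T = T'" by simp
qed


lemma yamanouchi_tableau:
  assumes T: "is_tableau T" and h: "highest_weight {1..} (reading_word T)"
  shows "T = canonical 0 (shape T)"
proof (rule nth_equalityI)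
  fix i assume i: "i < length T"
  have "y = Suc i" if "y \<in> set (T ! i)" for y
    using tableau_entry_gt[OF T, of y i] highest_weight_rows[OF T, of 0 y i] h that i
    by (simp add: row_less)
  then have "T ! i = replicate (length (T ! i)) (Suc i)"
    by (metis replicate_eqI)
  then show "T ! i = canonical 0 (shape T) ! i"
    using i by (simp add: nth_canonical shape_def)
qed (simp add: shape_def)

lemma yamanouchi_row_length:
  assumes T: "is_tableau T" and h: "highest_weight {1..} (reading_word T)"
  shows "count_list (reading_word T) (Suc i) = length (row i T)"
proof -
  have "count_list (reading_word T) (Suc i) = count_list (reading_word (canonical 0 (shape T))) (Suc i)"
    by (rule arg_cong[OF yamanouchi_tableau[OF assms], of "\<lambda>T. count_list (reading_word T) (Suc i)"])
  then show ?thesis by (simp add: count_canonical row_def shape_def)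
qed

lemma shape_eqI:
  assumes "is_tableau T" "is_tableau T'" "\<And>i. length (row i T) = length (row i T')"
  shows "shape T = shape T'"
proof -
  have *: "i < length T \<longleftrightarrow> length (row i T) > 0" if "is_tableau T" for T i
    using that nth_mem[of i T] by (cases "i < length T") (auto simp: row_less tableau_iff simp del: nth_mem)
  have "i < length T \<longleftrightarrow> i < length T'" for i
    using *[OF assms(1)] *[OF assms(2)] assms(3) by simp
  then have l: "length T = length T'" by (meson linorder_neqE_nat less_irrefl)
  show ?thesis
  proof (rule nth_equalityI)
    fix i assume "i < length (shape T)"
    then have "i < length T" "i < length T'" using l by (simp_all add: shape_def)
    then show "shape T ! i = shape T' ! i" using assms(3)[of i] by (simp add: shape_def row_less)
  qed (simp add: shape_def l)
qed

lemma tableau_eqI_rows: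
  assumes "is_tableau T" "is_tableau T'" "\<And>i. row i T = row i T'"
  shows "T = T'"
proof -
  have "shape T = shape T'" by (rule shape_eqI) (use assms in auto)
  then have "length T = length T'" by (metis shape_def length_map)
  then show ?thesis
  proof (rule nth_equalityI)
    fix i assume "i < length T"
    then show "T ! i = T' ! i" using assms(3)[of i] \<open>length T = length T'\<close> by (simp add: row_less)
  qed
qed

text \<open>
  The same crystal steps bring both tableaux to highest weight without changing their shapes.  There they
  are canonical tableaux of the same evaluation, hence equal, and the steps can be undone.
\<close>

lemma knuth_tableau_unique:
  assumes T: "is_tableau T" "is_tableau T'" and k: "knuth_equiv (reading_word T) (reading_word T')"
  shows "T = T'"
proof -
  obtain h where h: "crystal_conn {1..} (reading_word T) h" "highest_weight {1..} h"
    using ex_highest_weight by blast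
  obtain h' where h': "crystal_conn {1..} (reading_word T') h'" "knuth_equiv h h'"
      "h = h' \<longrightarrow> reading_word T = reading_word T'"
    using conn_knuth[OF h(1) k] by blast
  obtain U where U: "is_tableau U" "shape U = shape T" "reading_word U = h"
    using conn_tableau[OF h(1) T(1)] by blast
  obtain U' where U': "is_tableau U'" "shape U' = shape T'" "reading_word U' = h'"
    using conn_tableau[OF h'(1) T(2)] by blast
  have hw': "highest_weight {1..} h'" using highest_weight_knuth[OF h(2) h'(2)] .
  have "count_list h y = count_list h' y" for y
    using knuth_mset[OF h'(2)] by (simp flip: count_mset)
  then have "length (row i U) = length (row i U')" for i
    using yamanouchi_row_length[OF U(1)] yamanouchi_row_length[OF U'(1)] U(3) U'(3) h(2) hw' by metis
  then have sh: "shape U = shape U'" by (rule shape_eqI[OF U(1) U'(1)])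
  then have "U = U'" using yamanouchi_tableau[OF U(1)] yamanouchi_tableau[OF U'(1)] U(3) U'(3) h(2) hw' by metis
  then show "T = T'" using h'(3) U U' sh tableau_eqI by metis
qed

lemma yamanouchi_content:
  assumes h: "highest_weight {1..} h" "0 \<notin> set h"
  defines "lam \<equiv> map (\<lambda>i. count_list h (Suc i)) [0..<max_letter h]"
  shows "is_partition lam" "mset (reading_word (canonical 0 lam)) = mset h"
proof -
  have dec: "count_list h (Suc x) \<le> count_list h x" if "1 \<le> x" for x
    using h(1) free_count[of h x] that unfolding highest_weight_def
    by (metis add_diff_cancel_right' atLeast_iff diff_le_self le_add1 add.right_neutral)
  have mono: "1 \<le> x \<Longrightarrow> x \<le> y \<Longrightarrow> count_list h y \<le> count_list h x" for x y
  proof (induction y)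
    case (Suc y)
    then show ?case using dec[of y] by (cases "x = Suc y") auto
  qed simp
  have max: "y \<in> set h \<Longrightarrow> y \<le> max_letter h" for y by (simp add: max_letter_def)
  have pos: "0 < count_list h (Suc i)" if "i < max_letter h" for i
  proof -
    have "max_letter h \<in> insert 0 (set h)" unfolding max_letter_def by (intro Max_in) auto
    with that have "max_letter h \<in> set h" by auto
    then have "0 < count_list h (max_letter h)" by (metis count_list_0_iff not_gr_zero)
    also have "\<dots> \<le> count_list h (Suc i)" using mono that by simp
    finally show ?thesis .
  qed
  then show "is_partition lam"
    unfolding is_partition_def lam_def
    by (auto simp: sorted_wrt_iff_nth_less image_iff intro!: mono)
  show "mset (reading_word (canonical 0 lam)) = mset h"
  proof (rule multiset_eqI)
    fix y
    have "count_list (reading_word (canonical 0 lam)) y = count_list h y"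
      using max[of y] h(2) by (auto simp: count_canonical lam_def count_list_0_iff)
    then show "count (mset (reading_word (canonical 0 lam))) y = count (mset h) y"
      by (simp add: count_mset)
  qed
qed

lemma yamanouchi_knuth_canonical:
  assumes h: "highest_weight {1..} h" "0 \<notin> set h"
  shows "\<exists>lam. is_partition lam \<and> knuth_equiv h (reading_word (canonical 0 lam))"
  using yamanouchi_content[OF h] yamanouchi_knuth[OF h(1) canonical_highest h(2) tableau_no_zero] canonical_tableau
  by metis

text \<open>
  A Yamanouchi word is Knuth equivalent to a canonical tableau; the way down to \<open>w\<close> maps this tableau to
  a tableau Knuth equivalent to \<open>w\<close>.
\<close>

lemma knuth_tableau_exists:
  assumes "0 \<notin> set w"
  shows "\<exists>T. is_tableau T \<and> knuth_equiv w (reading_word T)"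
proof -
  obtain h where h: "crystal_conn {1..} w h" "highest_weight {1..} h"
    using ex_highest_weight by blast
  then obtain lam where lam: "is_partition lam" "knuth_equiv h (reading_word (canonical 0 lam))"
    using yamanouchi_knuth_canonical conn_no_zero assms by metis
  obtain v where v: "crystal_conn {1..} (reading_word (canonical 0 lam)) v" "knuth_equiv w v"
    using conn_knuth[OF conn_sym[OF h(1)] lam(2)] by blast
  with conn_tableau[OF v(1) canonical_tableau[OF lam(1)]] show ?thesis by blast
qed

lemma P_tab:
  assumes "0 \<notin> set w"
  shows "is_tableau (P_tab w)" "knuth_equiv w (reading_word (P_tab w))"
proof -
  obtain T where T: "is_tableau T" "knuth_equiv w (reading_word T)"
    using knuth_tableau_exists[OF assms] by blast
  have "\<exists>!T. is_tableau T \<and> knuth_equiv w (reading_word T)"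
  proof (rule ex1I[of _ T])
    fix U assume U: "is_tableau U \<and> knuth_equiv w (reading_word U)"
    then have "knuth_equiv (reading_word U) (reading_word T)"
      using T(2) knuth_trans[OF knuth_sym] by blast
    with U T show "U = T" using knuth_tableau_unique by blast
  qed (use T in blast)
  from theI'[OF this] show "is_tableau (P_tab w)" "knuth_equiv w (reading_word (P_tab w))"
    unfolding P_tab_def by auto
qed

lemma P_tab_eqI:
  assumes "is_tableau T" "knuth_equiv w (reading_word T)"
  shows "P_tab w = T"
proof -
  have "mset w = mset (reading_word T)" by (rule knuth_mset[OF assms(2)])
  then have z: "0 \<notin> set w" using tableau_no_zero[OF assms(1)] mset_eq_setD by metis
  have "knuth_equiv (reading_word (P_tab w)) (reading_word T)"
    by (rule knuth_trans[OF knuth_sym[OF P_tab(2)[OF z]] assms(2)])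
  then show ?thesis by (rule knuth_tableau_unique[OF P_tab(1)[OF z] assms(1)])
qed

lemma P_tab_reading: "is_tableau T \<Longrightarrow> P_tab (reading_word T) = T"
  by (rule P_tab_eqI) simp_all

lemma P_tab_knuth:
  assumes "knuth_equiv w v" "0 \<notin> set w"
  shows "P_tab w = P_tab v"
proof -
  have z: "0 \<notin> set v" using mset_eq_setD[OF knuth_mset[OF assms(1)]] assms(2) by simp
  show ?thesis by (rule P_tab_eqI[OF P_tab(1)[OF z] knuth_trans[OF assms(1) P_tab(2)[OF z]]])
qed

lemma P_tab_mset: "0 \<notin> set w \<Longrightarrow> mset (reading_word (P_tab w)) = mset w"
  using P_tab(2) knuth_mset by metis

text \<open>
  The steps that lead from \<open>w\<close> to \<open>v\<close> lead from the tableau of \<open>w\<close> to that of \<open>v\<close>.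
\<close>

lemma conn_shape:
  assumes "crystal_conn {1..} w v" "0 \<notin> set w"
  shows "shape (P_tab w) = shape (P_tab v)"
proof -
  obtain u where u: "crystal_conn {1..} (reading_word (P_tab w)) u" "knuth_equiv v u"
    using conn_knuth[OF assms(1) P_tab(2)[OF assms(2)]] by blast
  obtain T where T: "is_tableau T" "shape T = shape (P_tab w)" "reading_word T = u"
    using conn_tableau[OF u(1) P_tab(1)[OF assms(2)]] by blast
  have "P_tab v = T" using P_tab_eqI[OF T(1)] u(2) T(3) by simp
  with T(2) show ?thesis by simp
qed

lemma shape_row_length: "shape T = shape T' \<Longrightarrow> length (row i T) = length (row i T')"
  proof -
  assume *: "shape T = shape T'"
  then have "length T = length T'" unfolding shape_def by (rule map_eq_imp_length_eq)
  moreover have "length (T ! i) = length (T' ! i)" if "i < length T" for i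
    using arg_cong[OF *, of "\<lambda>s. s ! i"] that calculation by (simp add: shape_def)
  ultimately show ?thesis by (simp add: row_def)
qed

lemma yamanouchi_P_row_length:
  assumes "highest_weight {1..} h" "0 \<notin> set h"
  shows "length (row i (P_tab h)) = count_list h (Suc i)"
proof -
  have "count_list (reading_word (P_tab h)) (Suc i) = length (row i (P_tab h))"
    by (rule yamanouchi_row_length[OF P_tab(1)[OF assms(2)]
        highest_weight_knuth[OF assms(1) P_tab(2)[OF assms(2)]]])
  then show ?thesis using P_tab_mset[OF assms(2)] by (simp flip: count_mset)
qed

lemma eq_by_drop_mset: "(\<And>n. mset (drop n u) = mset (drop n v)) \<Longrightarrow> u = v"
proof (induction u arbitrary: v)
  case Nil
  from Nil[of 0] show ?case by simp
next
  case (Cons a u)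
  from Cons.prems[of 0] obtain b v' where v: "v = b # v'" by (cases v) auto
  have "mset (drop n u) = mset (drop n v')" for n using Cons.prems[of "Suc n"] v by simp
  then have "u = v'" by (rule Cons.IH)
  with Cons.prems[of 0] v show ?case by simp
qed

text \<open>
  Suffixes of connected words are connected, and suffixes of Yamanouchi words are Yamanouchi, so that
  their evaluations are their shapes.  Hence corresponding suffixes have the same evaluation.
\<close>

lemma yamanouchi_conn_eq:
  assumes h: "highest_weight {1..} h" "highest_weight {1..} h'" and c: "crystal_conn {1..} h h'" and z: "0 \<notin> set h"
  shows "h = h'"
proof (rule eq_by_drop_mset)
  fix n
  have z': "0 \<notin> set (drop n h)" "0 \<notin> set (drop n h')"
    using z conn_no_zero[OF c z] by (meson in_set_dropD)+
  have "count_list (drop n h) (Suc i) = count_list (drop n h') (Suc i)" for i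
    using shape_row_length[OF conn_shape[OF conn_drop[OF c] z'(1)], of i]
      yamanouchi_P_row_length[OF highest_weight_drop[OF h(1)] z'(1)]
      yamanouchi_P_row_length[OF highest_weight_drop[OF h(2)] z'(2)] by simp
  then have "count_list (drop n h) y = count_list (drop n h') y" for y
    using z' by (cases y) (simp_all add: count_list_0_iff)
  then show "mset (drop n h) = mset (drop n h')" by (intro multiset_eqI) (simp add: count_mset)
qed

text \<open>
  Bringing \<open>w\<close> to highest weight brings the Knuth equivalent word \<open>v\<close> to highest weight at the same time,
  and a component has only one highest weight word.
\<close>

lemma conn_knuth_eq:
  assumes c: "crystal_conn {1..} w v" and k: "knuth_equiv w v" and z: "0 \<notin> set w"
  shows "w = v"
proof -
  obtain h where h: "crystal_conn {1..} w h" "highest_weight {1..} h"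
    using ex_highest_weight by blast
  obtain h' where h': "crystal_conn {1..} v h'" "knuth_equiv h h'" "h = h' \<longrightarrow> w = v"
    using conn_knuth[OF h(1) k] by blast
  have "crystal_conn {1..} h h'" using h(1) h'(1) c conn_sym conn_trans by blast
  with yamanouchi_conn_eq[OF h(2) highest_weight_knuth[OF h(2) h'(2)] this conn_no_zero[OF h(1) z]] h'(3)
  show ?thesis by blast
qed

section \<open>Lowest weight words and recording tableaux\<close>

lemma count_reading: "count_list (reading_word T) x = (\<Sum>i<length T. count_list (row i T) x)"
proof (induction T)
  case (Cons r T)
  then show ?case by (simp add: sum.lessThan_Suc_shift del: sum.lessThan_Suc)
qed simp

lemma sorted_split_le: "sorted r \<Longrightarrow> r = filter (\<lambda>y. y \<le> x) r @ filter (\<lambda>y. \<not> y \<le> x) r"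
proof (induction r)
  case (Cons a r)
  show ?case
  proof (cases "a \<le> x")
    case False
    with Cons.prems have "filter (\<lambda>y. y \<le> x) r = []" by (auto simp: filter_empty_conv)
    with False Cons show ?thesis by simp
  qed (use Cons in simp)
qed simp

lemma count_filter_le: "count_list (filter (\<lambda>y. y \<le> x) r) z = (if z \<le> x then count_list r z else 0)"
  by (induction r) auto

text \<open>
  In a tableau of lowest weight all interlacing inequalities for \<open>x < n\<close> are equalities.  By induction on
  \<open>x\<close>, the cancellation condition for the prefix of the reading word that ends with the letters at most
  \<open>x\<close> of the bottom row bounds the sum over all rows of the left sides by that of the right sides, whereas
  interlacing gives the opposite inequality row by row.
\<close>

lemma lowest_weight_interlacing:
  assumes T: "is_tableau T" and low: "lowest_weight {1..<n} (reading_word T)"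
  shows "x < n \<Longrightarrow> le_count (row i T) x = le_count (row (Suc i) T) (Suc x)"
proof (induction x arbitrary: i)
  case 0
  have "le_count (row i T) 0 = 0" for i using tableau_row[OF T] le_count_0 by blast
  with tableau_interlacing[OF T, of i 0] show ?case by simp
next
  case (Suc z)
  define x where "x = Suc z"
  define N where "N = length T"
  have IH: "le_count (row i T) z = le_count (row (Suc i) T) x" for i
    using Suc x_def by simp
  have end0: "le_count (row N T) y = 0" for y by (simp add: N_def)
  have c: "(\<Sum>i<N. count_list (row i T) x) \<le> (\<Sum>i<N. count_list (row (Suc i) T) (Suc x))"
  proof (cases T)
    case Nil
    then show ?thesis by (simp add: N_def)
  next
    case (Cons r T')
    have r: "sorted r" using T Cons by (simp add: is_tableau_def)
    \<comment> \<open>the prefix of the reading word that stops before the letters of the bottom row above \<open>x\<close>\<close>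
    define u where "u = reading_word T' @ filter (\<lambda>y. y \<le> x) r"
    have "reading_word T = u @ filter (\<lambda>y. \<not> y \<le> x) r"
      using sorted_split_le[OF r, of x] by (simp add: Cons u_def)
    moreover have "free_lo x (reading_word T) = 0"
      using low Suc.prems by (simp add: lowest_weight_def x_def)
    ultimately have "free_lo x u = 0" using free_lo_append_0 by metis
    then have "count_list u x \<le> count_list u (Suc x)" using free_count[of u x] by simp
    then have "count_list (reading_word T') x + count_list r x \<le> count_list (reading_word T') (Suc x)"
      by (simp add: u_def count_filter_le)
    moreover have "(\<Sum>i<N. count_list (row i T) x) = count_list r x + (\<Sum>i<length T'. count_list (row i T') x)"
      by (simp add: N_def Cons sum.lessThan_Suc_shift del: sum.lessThan_Suc)
    moreover have "(\<Sum>i<N. count_list (row (Suc i) T) (Suc x)) = (\<Sum>i<length T'. count_list (row i T') (Suc x))"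
      by (simp add: N_def Cons)
    ultimately show ?thesis by (simp add: count_reading)
  qed
  have "(\<Sum>i<N. le_count (row i T) x) = (\<Sum>i<N. le_count (row i T) z) + (\<Sum>i<N. count_list (row i T) x)"
    by (simp add: x_def le_count_Suc sum.distrib)
  also have "\<dots> \<le> (\<Sum>i<N. le_count (row (Suc i) T) x) + (\<Sum>i<N. count_list (row (Suc i) T) (Suc x))"
    using c IH by simp
  also have "\<dots> = (\<Sum>i<N. le_count (row (Suc i) T) (Suc x))"
    by (simp add: le_count_Suc sum.distrib)
  finally have le: "(\<Sum>i<N. le_count (row i T) x) \<le> (\<Sum>i<N. le_count (row (Suc i) T) (Suc x))" .
  have ge: "le_count (row (Suc i) T) (Suc x) \<le> le_count (row i T) x" for i
    by (rule tableau_interlacing[OF T])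
  have "(\<Sum>i<N. le_count (row (Suc i) T) (Suc x)) = (\<Sum>i<N. le_count (row i T) x)"
    by (rule antisym[OF sum_mono[OF ge] le])
  then have "i < N \<Longrightarrow> le_count (row (Suc i) T) (Suc x) = le_count (row i T) x"
    by (rule sum_mono_inv) (use ge in auto)
  then show ?case by (cases "i < N") (simp_all add: N_def x_def)
qed

lemma row_subset: "set (row i T) \<subseteq> set (reading_word T)"
proof (cases "i < length T")
  case True
  then have "row i T \<in> set T" by (simp add: row_less)
  then show ?thesis unfolding reading_word_def by auto
qed simp

text \<open>
  The equalities telescope: the evaluation of a lowest weight tableau is its shape read backwards.
\<close>

lemma lowest_weight_row_length:
  assumes T: "is_tableau T" and low: "lowest_weight {1..<n} (reading_word T)"
    and letters: "set (reading_word T) \<subseteq> {1..n}" and x: "1 \<le> x" "x \<le> n"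
  shows "count_list (reading_word T) x = length (row (n - x) T)"
proof -
  note I = lowest_weight_interlacing[OF T low]
  define N where "N = length T"
  obtain z where z: "x = Suc z" using x by (cases x) auto
  have "(\<Sum>i<N. le_count (row i T) x) = (\<Sum>i<N. le_count (row i T) z) + count_list (reading_word T) x"
    by (simp add: z le_count_Suc sum.distrib count_reading N_def)
  also have "(\<Sum>i<N. le_count (row i T) z) = (\<Sum>i<N. le_count (row (Suc i) T) x)"
    using I[of z] x z by simp
  finally have 1: "(\<Sum>i<N. le_count (row i T) x) = (\<Sum>i<N. le_count (row (Suc i) T) x) + count_list (reading_word T) x" .
  have "(\<Sum>i<N. le_count (row i T) x) = (\<Sum>i<Suc N. le_count (row i T) x)"
    by (simp add: N_def)
  also have "\<dots> = le_count (row 0 T) x + (\<Sum>i<N. le_count (row (Suc i) T) x)"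
    by (rule sum.lessThan_Suc_shift)
  finally have 2: "count_list (reading_word T) x = le_count (row 0 T) x" using 1 by simp
  have "x + d \<le> n \<Longrightarrow> le_count (row 0 T) x = le_count (row d T) (x + d)" for d
  proof (induction d)
    case (Suc d)
    then show ?case using I[of "x + d" d] by simp
  qed simp
  from this[of "n - x"] x 2 have "count_list (reading_word T) x = le_count (row (n - x) T) n" by simp
  moreover have "\<forall>y\<in>set (row (n - x) T). y \<le> n"
    using letters row_subset by fastforce
  ultimately show ?thesis by (simp add: le_count_all)
qed

lemma row_beyond_letters:
  assumes T: "is_tableau T" and "set (reading_word T) \<subseteq> {1..n}" "n \<le> i"
  shows "row i T = []"
proof (rule ccontr)
  assume "row i T \<noteq> []"
  then obtain y where y: "y \<in> set (row i T)" by (meson list.set_sel(1))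
  then have "i < y" by (rule tableau_entry_gt[OF T])
  moreover have "y \<le> n" using y assms(2) row_subset by fastforce
  ultimately show False using assms(3) by simp
qed

lemma P_tab_letters: "0 \<notin> set w \<Longrightarrow> set (reading_word (P_tab w)) = set w"
  using mset_eq_setD[OF P_tab_mset] .

lemma lowest_P_row_length:
  assumes w: "set w \<subseteq> {1..n}" and low: "lowest_weight {1..<n} w"
  shows "length (row i (P_tab w)) = (if i < n then count_list w (n - i) else 0)"
proof -
  have z: "0 \<notin> set w" using w by auto
  have T: "is_tableau (P_tab w)" and L: "set (reading_word (P_tab w)) \<subseteq> {1..n}"
    using P_tab(1)[OF z] P_tab_letters[OF z] w by auto
  show ?thesis
  proof (cases "i < n")
    case True
    have "count_list (reading_word (P_tab w)) (n - i) = length (row (n - (n - i)) (P_tab w))"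
      by (rule lowest_weight_row_length[OF T _ L])
        (use True lowest_weight_knuth[OF low P_tab(2)[OF z]] in auto)
    with True show ?thesis using P_tab_mset[OF z] by (simp flip: count_mset)
  next
    case False
    then show ?thesis using row_beyond_letters[OF T L] by simp
  qed
qed

text \<open>
  Prefixes of connected words are connected.  Hence connected words have the same recording tableau.
\<close>

lemma conn_prefix_row:
  assumes c: "crystal_conn {1..} w v" and z: "0 \<notin> set w"
  shows "length (row j (P_tab (take i w))) = length (row j (P_tab (take i v)))"
proof -
  have "0 \<notin> set (take i w)" using z by (meson in_set_takeD)
  then show ?thesis by (rule shape_row_length[OF conn_shape[OF conn_take[OF c]]])
qed

lemma Q_tab_conn:
  assumes c: "crystal_conn {1..} w v" and z: "0 \<notin> set w"
  shows "Q_tab w = Q_tab v"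
proof -
  have "length (P_tab w) = length (P_tab v)"
    using conn_shape[OF c z] unfolding shape_def by (rule map_eq_imp_length_eq)
  then show ?thesis
    unfolding Q_tab_def using conn_prefix_row[OF c z] conn_length[OF c] by simp
qed

lemma take_count_Suc:
  "i < length l \<Longrightarrow> count_list (take (Suc i) l) y = count_list (take i l) y + (if l ! i = y then 1 else 0)"
  by (simp add: take_Suc_conv_app_nth)

text \<open>
  Prefixes of a lowest weight word have lowest weight, so that the shapes that define the recording tableau
  are the evaluations of these prefixes, read backwards: an entry in row \<open>j\<close> stands for a letter
  \<open>n - j\<close>.  Lowest weight is used because prefixes of Yamanouchi words need not be Yamanouchi.
\<close>

lemma Q_tab_lowest:
  assumes w: "set w \<subseteq> {1..n}" and c: "crystal_conn {1..<n} w l" and low: "lowest_weight {1..<n} l"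
    and i: "i < length w" and j: "j < length (Q_tab w)"
  shows "Suc i \<in> set (Q_tab w ! j) \<longleftrightarrow> j < n \<and> l ! i = n - j"
proof -
  have z: "0 \<notin> set w" using w by auto
  have c': "crystal_conn {1..} w l" by (rule conn_mono[OF c]) auto
  have l: "set l \<subseteq> {1..n}" "length l = length w"
    using conn_letters[OF c w] conn_length[OF c] by auto
  have len: "length (row j (P_tab (take k w))) = (if j < n then count_list (take k l) (n - j) else 0)" for k
  proof -
    have "length (row j (P_tab (take k w))) = length (row j (P_tab (take k l)))"
      by (rule conn_prefix_row[OF c' z])
    also have "\<dots> = (if j < n then count_list (take k l) (n - j) else 0)"
      by (rule lowest_P_row_length[OF subset_trans[OF set_take_subset l(1)] lowest_weight_take[OF low]])
    finally show ?thesis .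
  qed
  have jP: "j < length (P_tab w)" using j by (simp add: Q_tab_def)
  have "Suc i \<in> set (Q_tab w ! j) \<longleftrightarrow>
      length (row j (P_tab (take (Suc i) w))) \<noteq> length (row j (P_tab (take i w)))"
    using jP i by (simp add: Q_tab_def del: upt_Suc)
  also have "\<dots> \<longleftrightarrow> j < n \<and> l ! i = n - j"
    unfolding len using take_count_Suc[of i l "n - j"] i l(2) by simp
  finally show ?thesis .
qed

lemma Q_tab_length: "length (Q_tab w) = length (P_tab w)"
  by (simp add: Q_tab_def)

lemma Q_tab_eq_lowest_eq:
  assumes w: "set w \<subseteq> {1..n}" "crystal_conn {1..<n} w l" "lowest_weight {1..<n} l"
    and v: "set v \<subseteq> {1..n}" "crystal_conn {1..<n} v m" "lowest_weight {1..<n} m"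
    and Q: "Q_tab w = Q_tab v" and len: "length w = length v"
  shows "l = m"
proof (rule nth_equalityI)
  show "length l = length m" using conn_length[OF w(2)] conn_length[OF v(2)] len by simp
next
  fix i assume i: "i < length l"
  have ll: "length l = length w" using conn_length[OF w(2)] .
  have l: "set l \<subseteq> {1..n}" using conn_letters[OF w(2,1)] .
  define j where "j = n - l ! i"
  have li: "1 \<le> l ! i" "l ! i \<le> n" using l i by (auto dest!: nth_mem)
  have z: "0 \<notin> set w" using w(1) by auto
  have c': "crystal_conn {1..} w l" by (rule conn_mono[OF w(2)]) auto
  have "length (row j (P_tab w)) = length (row j (P_tab l))"
    by (rule shape_row_length[OF conn_shape[OF c' z]])
  also have "\<dots> = count_list l (l ! i)"
    using lowest_P_row_length[OF l w(3), of j] li by (simp add: j_def)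
  also have "\<dots> \<noteq> 0" using i by (simp add: count_list_0_iff)
  finally have "row j (P_tab w) \<noteq> []" by simp
  then have j: "j < length (Q_tab w)" unfolding Q_tab_length by (metis row_ge not_le)
  have "Suc i \<in> set (Q_tab w ! j)"
    using Q_tab_lowest[OF w _ j, of i] i ll li by (simp add: j_def)
  then have "m ! i = n - j"
    using Q_tab_lowest[OF v, of i j] j Q len i ll by simp
  with li show "l ! i = m ! i" by (simp add: j_def)
qed

text \<open>
  The recording tableau determines the lowest weight word, hence the component, and the insertion tableau
  the Knuth class.
\<close>

lemma P_Q_unique:
  assumes w: "0 \<notin> set w" and v: "0 \<notin> set v" and P: "P_tab w = P_tab v" and Q: "Q_tab w = Q_tab v"
  shows "w = v"
proof -
  have eq: "mset w = mset v" using P_tab_mset[OF w] P_tab_mset[OF v] P by simp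
  define n where "n = Max (insert 1 (set w))"
  have wn: "set w \<subseteq> {1..n}"
  proof
    fix y assume "y \<in> set w"
    moreover from this have "y \<noteq> 0" using w by metis
    ultimately show "y \<in> {1..n}" by (simp add: n_def)
  qed
  then have vn: "set v \<subseteq> {1..n}" using mset_eq_setD[OF eq] by simp
  obtain l where l: "crystal_conn {1..<n} w l" "lowest_weight {1..<n} l"
    using ex_lowest_weight[OF wn] by blast
  obtain m where m: "crystal_conn {1..<n} v m" "lowest_weight {1..<n} m"
    using ex_lowest_weight[OF vn] by blast
  have "l = m"
    by (rule Q_tab_eq_lowest_eq[OF wn l vn m Q mset_eq_length[OF eq]])
  with l m have "crystal_conn {1..<n} w v" using conn_trans conn_sym by blast
  then have c: "crystal_conn {1..} w v" by (rule conn_mono) auto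
  have "knuth_equiv w v"
    using P_tab(2)[OF w] P_tab(2)[OF v] P knuth_sym knuth_trans by metis
  then show ?thesis by (rule conn_knuth_eq[OF c _ w])
qed

lemma free_hi_le_count: "free_hi x w \<le> count_list w (Suc x)"
  by (induction w) auto

lemma canonical_shape_conn:
  assumes T: "is_tableau T" and letters: "set (reading_word T) \<subseteq> {1..n}"
  shows "crystal_conn {1..<n} (reading_word T) (reading_word (canonical 0 (shape T)))"
proof -
  obtain h where h: "crystal_conn {1..<n} (reading_word T) h" "highest_weight {1..<n} h"
    using ex_highest_weight by blast
  have hl: "set h \<subseteq> {1..n}" using conn_letters[OF h(1) letters] .
  have "free_hi x h = 0" if "n \<le> x" for x
  proof -
    have "Suc x \<notin> set h" using hl that by auto
    then show ?thesis using free_hi_le_count[of x h] by (simp add: count_list_0_iff)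
  qed
  then have hw: "highest_weight {1..} h"
    using h(2) unfolding highest_weight_def by (meson atLeastLessThan_iff atLeast_iff not_le)
  have sub: "{1..<n} \<subseteq> {1..}" by auto
  obtain U where U: "is_tableau U" "shape U = shape T" "reading_word U = h"
    using conn_tableau[OF conn_mono[OF h(1) sub] T] by blast
  have "U = canonical 0 (shape T)"
    using yamanouchi_tableau[OF U(1)] U(2,3) hw by simp
  with U(3) h(1) show ?thesis by simp
qed

text \<open>
  All tableaux of one shape are connected through the canonical one.  The crystal steps from \<open>P_tab w\<close> to
  \<open>U\<close>, applied to \<open>w\<close>, give the word.
\<close>

lemma component_P_surj:
  assumes w: "set w \<subseteq> {1..n}" and U: "is_tableau U" "shape U = shape (P_tab w)" "set (reading_word U) \<subseteq> {1..n}"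
  shows "\<exists>v. crystal_conn {1..<n} w v \<and> P_tab v = U"
proof -
  have z: "0 \<notin> set w" using w by auto
  have "crystal_conn {1..<n} (reading_word (P_tab w)) (reading_word (canonical 0 (shape U)))"
    using canonical_shape_conn[OF P_tab(1)[OF z], of n] P_tab_letters[OF z] w U(2) by simp
  then have "crystal_conn {1..<n} (reading_word (P_tab w)) (reading_word U)"
    using canonical_shape_conn[OF U(1,3)] conn_sym conn_trans by blast
  from conn_knuth[OF this knuth_sym[OF P_tab(2)[OF z]]] obtain v
    where v: "crystal_conn {1..<n} w v" "knuth_equiv (reading_word U) v" by blast
  have "P_tab v = U" by (rule P_tab_eqI[OF U(1) knuth_sym[OF v(2)]])
  with v(1) show ?thesis by blast
qed

section \<open>Rectangular reflections stay in the component\<close>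

definition remove_ones :: "nat list \<Rightarrow> nat list" where
  "remove_ones w = map (\<lambda>x. x - 1) (filter (\<lambda>x. x \<noteq> 1) w)"

lemma remove_ones_simps [simp]:
  "remove_ones [] = []"
  "remove_ones (x # w) = (if x = 1 then remove_ones w else (x - 1) # remove_ones w)"
  "remove_ones (u @ v) = remove_ones u @ remove_ones v"
  by (simp_all add: remove_ones_def)

lemma free_remove_ones:
  assumes "1 \<le> x"
  shows "free_lo x (remove_ones w) = free_lo (Suc x) w" "free_hi x (remove_ones w) = free_hi (Suc x) w"
proof -
  show lo: "free_lo x (remove_ones w) = free_lo (Suc x) w" for w
    using assms by (induction w) auto
  show "free_hi x (remove_ones w) = free_hi (Suc x) w"
    using assms by (induction w) (auto simp: lo)
qed

lemma count_remove_ones: "count_list (remove_ones w) (Suc i) = count_list w (Suc (Suc i))"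
  by (induction w) auto

lemma crystal_step_remove_ones:
  assumes "1 \<le> x" "crystal_step (Suc x) u v"
  shows "crystal_step x (remove_ones u) (remove_ones v)"
proof -
  obtain p q where "u = p @ Suc x # q" "v = p @ Suc (Suc x) # q" "free_hi (Suc x) p = 0" "free_lo (Suc x) q = 0"
    by (rule crystal_stepE[OF assms(2)])
  with assms(1) crystal_step.intros[of x "remove_ones p" "remove_ones q"] show ?thesis
    by (simp add: free_remove_ones)
qed

lemma conn_remove_ones: "crystal_conn {2..} u v \<Longrightarrow> crystal_conn {1..} (remove_ones u) (remove_ones v)"
proof (induction rule: conn_induct)
  case (up v v' x)
  then obtain y where "x = Suc y" "1 \<le> y" by (cases x) auto
  with up crystal_step_remove_ones[of y v v'] conn_step[of y "{1..}"] show ?case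
    using conn_trans by auto
next
  case (down v v' x)
  then obtain y where "x = Suc y" "1 \<le> y" by (cases x) auto
  with down crystal_step_remove_ones[of y v' v] conn_step_back[of y "{1..}"] show ?case
    using conn_trans by auto
qed simp

text \<open>
  If the letter that witnesses the exchange of two others is a \<open>1\<close>, then so is the smaller one of these.
\<close>

lemma knuth_step_remove_ones:
  assumes "knuth_step u v" "0 \<notin> set u"
  shows "knuth_equiv (remove_ones u) (remove_ones v)"
  using assms
proof (induction rule: knuth_step.induct)
  case (1 a b c xs ys)
  then show ?case
    using knuth1[of "a - 1" "b - 1" "c - 1" "remove_ones xs" "remove_ones ys"] by auto
next
  case (2 a b c xs ys)
  then show ?case
    using knuth2[of "a - 1" "b - 1" "c - 1" "remove_ones xs" "remove_ones ys"] by auto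
qed

lemma knuth_remove_ones:
  assumes "knuth_equiv u v" "0 \<notin> set u"
  shows "knuth_equiv (remove_ones u) (remove_ones v)"
  using assms(1) unfolding knuth_equiv_def
proof (induction rule: equivclp_induct)
  case (step y z)
  have eq: "set y = set u"
    using step(1) mset_eq_setD[OF knuth_mset, of u y] by (simp add: knuth_equiv_def)
  have "set z = set y"
    using step(2) mset_eq_setD[OF knuth_mset[OF knuth_stepI]] by blast
  with eq assms(2) step(2) have "knuth_equiv (remove_ones y) (remove_ones z)"
    using knuth_step_remove_ones[of y z] knuth_step_remove_ones[of z y] knuth_sym by auto
  with step(3) show ?case using knuth_trans by (simp add: knuth_equiv_def[symmetric])
qed (simp add: knuth_equiv_def[symmetric])

lemma remove_ones_no_zero: "0 \<notin> set w \<Longrightarrow> 0 \<notin> set (remove_ones w)"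
  by (induction w) auto

lemma free_lo_le_count: "free_lo x w \<le> count_list w x"
  by (induction w) auto

text \<open>
  Row \<open>i\<close>, counted from \<open>0\<close>, contains the letters \<open>i + 1\<close> and \<open>i + 2\<close> only.  The first inequality is then
  interlacing, and the second one the Yamanouchi condition for the letters \<open>i + 2\<close> and \<open>i + 3\<close>.
\<close>

lemma two_letter_rows:
  assumes U: "is_tableau U" and hw: "highest_weight {2..} (reading_word U)"
  shows "count_list (reading_word U) (Suc (Suc i)) \<le> length (row i U)"
    and "length (row (Suc i) U) \<le> count_list (reading_word U) (Suc (Suc i))"
proof -
  have le: "y \<le> Suc (Suc k)" if "y \<in> set (row k U)" for y k
    using highest_weight_rows[OF U, of 1 y k] hw that by (simp add: numeral_2_eq_2)
  have gt: "k < y" if "y \<in> set (row k U)" for y k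
    using tableau_entry_gt[OF U that] .
  define c where "c k = count_list (row k U) (Suc (Suc i))" for k
  have c0: "c k = 0" if "k \<noteq> i" "k \<noteq> Suc i" for k
    using le[of "Suc (Suc i)" k] gt[of "Suc (Suc i)" k] that unfolding c_def count_list_0_iff by fastforce
  have "count_list (reading_word U) (Suc (Suc i)) = (\<Sum>k<length U. c k)"
    by (simp add: count_reading c_def)
  also have "\<dots> = (\<Sum>k\<in>{i, Suc i}. c k)"
    by (rule sum.mono_neutral_cong) (use c0 in \<open>auto simp: c_def\<close>)
  finally have total: "count_list (reading_word U) (Suc (Suc i)) = c i + c (Suc i)" by simp
  have len: "length (row k U) = le_count (row k U) (Suc (Suc k))" for k
    using le_count_all[of "row k U" "Suc (Suc k)"] le by simp
  have "c (Suc i) \<le> le_count (row (Suc i) U) (Suc (Suc i))"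
    by (simp add: le_count_Suc c_def)
  also have "\<dots> \<le> le_count (row i U) (Suc i)" by (rule tableau_interlacing[OF U])
  finally show "count_list (reading_word U) (Suc (Suc i)) \<le> length (row i U)"
    unfolding total len[of i] by (simp add: le_count_Suc[of _ "Suc i"] c_def)
  show "length (row (Suc i) U) \<le> count_list (reading_word U) (Suc (Suc i))"
  proof (cases "Suc i < length U")
    case True
    have z: "le_count (row (Suc i) U) (Suc i) = 0"
      using gt[of _ "Suc i"] by (force simp: le_count_def filter_empty_conv)
    have "free_hi (Suc (Suc i)) (reading_word U) = 0"
      using hw by (simp add: highest_weight_def)
    then have "free_hi (Suc (Suc i)) (row (Suc i) U @ reading_word (take (Suc i) U)) = 0"
      using reading_take_row[OF True] free_hi_append_0 by metis
    then have "free_hi (Suc (Suc i)) (row (Suc i) U) \<le> free_lo (Suc (Suc i)) (reading_word (take (Suc i) U))"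
      by (simp add: free_hi_append)
    also have "\<dots> \<le> count_list (reading_word (take (Suc i) U)) (Suc (Suc i))"
      by (rule free_lo_le_count)
    also have "\<dots> = (\<Sum>k<Suc i. c k)"
      using True by (simp add: count_reading c_def row_def)
    also have "\<dots> = c i" using c0 by simp
    finally have "count_list (row (Suc i) U) (Suc (Suc (Suc i))) \<le> c i"
      using sorted_free(2) tableau_row[OF U] by metis
    then show ?thesis
      unfolding total len[of "Suc i"] using z by (simp add: le_count_Suc c_def)
  qed simp
qed

text \<open>
  Both shapes are constant on the components for the letters from \<open>2\<close> on, so that \<open>w\<close> may be replaced by a
  highest weight tableau, for which the previous lemma applies.  The inequalities say that the two shapes
  differ by a horizontal strip.
\<close>

lemma remove_ones_strip:
  assumes w: "0 \<notin> set w"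
  shows "length (row i (P_tab (remove_ones w))) \<le> length (row i (P_tab w))"
    and "length (row (Suc i) (P_tab w)) \<le> length (row i (P_tab (remove_ones w)))"
proof -
  obtain r where r: "crystal_conn {2..} (reading_word (P_tab w)) r" "highest_weight {2..} r"
    using ex_highest_weight by blast
  have sub: "{2..} \<subseteq> {1::nat..}" by auto
  obtain U where U: "is_tableau U" "shape U = shape (P_tab w)" "reading_word U = r"
    using conn_tableau[OF conn_mono[OF r(1) sub] P_tab(1)[OF w]] by blast
  have z: "0 \<notin> set (reading_word (P_tab w))" by (rule tableau_no_zero[OF P_tab(1)[OF w]])
  have z': "0 \<notin> set r" using tableau_no_zero[OF U(1)] U(3) by simp
  have "P_tab (remove_ones w) = P_tab (remove_ones (reading_word (P_tab w)))"
    by (rule P_tab_knuth[OF knuth_remove_ones[OF P_tab(2)[OF w] w] remove_ones_no_zero[OF w]])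
  then have "shape (P_tab (remove_ones w)) = shape (P_tab (remove_ones r))"
    using conn_shape[OF conn_remove_ones[OF r(1)] remove_ones_no_zero[OF z]] by simp
  then have "length (row i (P_tab (remove_ones w))) = length (row i (P_tab (remove_ones r)))"
    by (rule shape_row_length)
  also have "\<dots> = count_list (remove_ones r) (Suc i)"
    by (rule yamanouchi_P_row_length[OF _ remove_ones_no_zero[OF z']])
      (use r(2) in \<open>simp add: highest_weight_def free_remove_ones\<close>)
  also have "\<dots> = count_list (reading_word U) (Suc (Suc i))"
    by (simp add: count_remove_ones U(3))
  finally have eq: "length (row i (P_tab (remove_ones w))) = count_list (reading_word U) (Suc (Suc i))" .
  have hw: "highest_weight {2..} (reading_word U)" using r(2) U(3) by simp
  have len: "length (row k U) = length (row k (P_tab w))" for k by (rule shape_row_length[OF U(2)])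
  show "length (row i (P_tab (remove_ones w))) \<le> length (row i (P_tab w))"
    "length (row (Suc i) (P_tab w)) \<le> length (row i (P_tab (remove_ones w)))"
    using two_letter_rows[OF U(1) hw, of i] by (simp_all add: eq len)
qed

text \<open>
  The prescribed insertion tableau is a tableau of the shape of \<open>P_tab w\<close>, so the component of \<open>w\<close>
  contains a word with this insertion tableau.  It has the recording tableau of \<open>w\<close>, and by injectivity
  of the correspondence it is the word that the definition describes.
\<close>

lemma rect_sigma1_conn:
  assumes w: "set w \<subseteq> {1..Suc h}"
  shows "crystal_conn {1..<Suc h} w (rect_sigma1 h w)"
proof -
  have z: "0 \<notin> set w" using w by auto
  define P where "P = P_tab w"
  define R where "R = P_tab (remove_ones w)"
  define rw where "rw i = row i R @ replicate (length (P ! i) - length (row i R)) (h + 1)" for i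
  define T where "T = map rw [0..<length P]"
  have P: "is_tableau P" by (simp add: P_def P_tab(1)[OF z])
  have R: "is_tableau R" by (simp add: R_def P_tab(1)[OF remove_ones_no_zero[OF z]])
  have "set (remove_ones w) \<subseteq> {1..h}"
    using w by (force simp: remove_ones_def)
  then have "set (reading_word R) \<subseteq> {1..h}"
    using P_tab_letters[OF remove_ones_no_zero[OF z]] by (simp add: R_def)
  then have Rh: "\<forall>y\<in>set (row i R). 1 \<le> y \<and> y \<le> h" for i using row_subset[of i R] by fastforce
  have strip: "length (row i R) \<le> length (row i P)" "length (row (Suc i) P) \<le> length (row i R)" for i
    using remove_ones_strip[OF z] by (simp_all add: R_def P_def)
  have len: "length (rw i) = length (P ! i)" if "i < length P" for i
    using strip(1)[of i] that by (simp add: rw_def row_less)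
  have shape: "shape T = shape P"
    unfolding shape_def T_def by (rule nth_equalityI) (simp_all add: len)
  have rw_letters: "\<forall>y\<in>set (rw i). 1 \<le> y \<and> y \<le> Suc h" for i
    using Rh[of i] by (auto simp: rw_def)
  have "sorted (rw i)" for i
    using Rh[of i] tableau_row[OF R, of i] by (auto simp: rw_def sorted_append sorted_replicate)
  moreover have "rw i ! j < rw (Suc i) ! j" if ij: "Suc i < length P" "j < length (P ! Suc i)" for i j
  proof -
    have jR: "j < length (row i R)" using strip(2)[of i] ij by (simp add: row_less)
    then have i: "rw i ! j = row i R ! j" by (simp add: rw_def nth_append)
    show ?thesis
    proof (cases "j < length (row (Suc i) R)")
      case True
      then have "Suc i < length R" by (auto simp: row_def split: if_splits)
      then have "row i R ! j < row (Suc i) R ! j"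
        using True R unfolding is_tableau_def by (simp add: row_less)
      with i True show ?thesis by (simp add: rw_def nth_append)
    next
      case False
      then have "rw (Suc i) ! j = Suc h" using len[of "Suc i"] ij by (simp add: rw_def nth_append)
      moreover have "row i R ! j \<le> h" using Rh[of i] jR nth_mem by blast
      ultimately show ?thesis using i by simp
    qed
  qed
  moreover have "0 \<notin> set (rw i)" for i using rw_letters[of i] by force
  moreover have "is_partition (shape T)" using P shape by (simp add: is_tableau_def)
  ultimately have T: "is_tableau T"
    unfolding is_tableau_def by (auto simp: T_def len)
  have letters: "set (reading_word T) \<subseteq> {1..Suc h}"
    using rw_letters by (auto simp: reading_word_def T_def Suc_le_eq)
  obtain v where v: "crystal_conn {1..<Suc h} w v" "P_tab v = T"
    using component_P_surj[OF w T _ letters] shape by (auto simp: P_def)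
  have c: "crystal_conn {1..} w v" by (rule conn_mono[OF v(1)]) auto
  have Q: "Q_tab v = Q_tab w" using Q_tab_conn[OF c z] by simp
  have zv: "0 \<notin> set v" by (rule conn_no_zero[OF c z])
  have "rect_sigma1 h w = (THE w'. 0 \<notin> set w' \<and> P_tab w' = T \<and> Q_tab w' = Q_tab w)"
    unfolding rect_sigma1_def Let_def T_def rw_def[abs_def] R_def P_def remove_ones_def ..
  also have "\<dots> = v"
    by (rule the_equality) (use v(2) Q zv P_Q_unique in auto)
  finally show ?thesis using v(1) by simp
qed

lemma replace_letters_filter: "replace_letters S w (filter (\<lambda>x. x \<in> S) w) = w"
  by (induction w) auto

lemma filter_replace_letters:
  "length z = length (filter (\<lambda>x. x \<in> S) w) \<Longrightarrow> set z \<subseteq> S \<Longrightarrow>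
     filter (\<lambda>x. x \<in> S) (replace_letters S w z) = z"
proof (induction w arbitrary: z)
  case (Cons x w)
  then show ?case by (cases z) (auto split: if_splits)
qed simp

lemma replace_letters_twice:
  "length z = length (filter (\<lambda>x. x \<in> S) w) \<Longrightarrow> set z \<subseteq> S \<Longrightarrow>
     replace_letters S (replace_letters S w z) z' = replace_letters S w z'"
proof (induction w arbitrary: z z')
  case (Cons x w)
  then show ?case by (cases z) (auto split: if_splits)
qed simp

lemma replace_letters_append:
  "replace_letters S (u @ v) (filter (\<lambda>x. x \<in> S) u @ z) = u @ replace_letters S v z"
  by (induction u) auto

lemma filter_split:
  assumes "filter P w = u @ y # v"
  obtains a b where "w = a @ y # b" "filter P a = u" "filter P b = v"
proof -
  have "\<exists>a b. w = a @ y # b \<and> filter P a = u \<and> filter P b = v"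
    using assms
  proof (induction w arbitrary: u)
    case (Cons x w)
    show ?case
    proof (cases "P x \<and> u = []")
      case True
      with Cons.prems show ?thesis by (intro exI[of _ "[]"] exI[of _ w]) simp
    next
      case False
      define u' where "u' = (if P x then tl u else u)"
      have "filter P w = u' @ y # v"
        using Cons.prems False by (cases u) (auto simp: u'_def)
      from Cons.IH[OF this] obtain a b where "w = a @ y # b" "filter P a = u'" "filter P b = v" by blast
      then show ?thesis
        using Cons.prems False
        by (intro exI[of _ "x # a"] exI[of _ b]) (cases u; auto simp: u'_def split: if_splits)
    qed
  qed simp
  then show ?thesis using that by blast
qed

lemma crystal_move_replace:
  assumes S: "x \<in> S" "Suc x \<in> S" "y \<in> S" and move: "crystal_move x y z (filter (\<lambda>y. y \<in> S) w) v"
  shows "crystal_move x y z w (replace_letters S w v)"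
proof -
  obtain p q where pq: "filter (\<lambda>y. y \<in> S) w = p @ y # q" "v = p @ z # q" "free_hi x p = 0" "free_lo x q = 0"
    by (rule crystal_moveE[OF move])
  obtain a b where ab: "w = a @ y # b" "filter (\<lambda>y. y \<in> S) a = p" "filter (\<lambda>y. y \<in> S) b = q"
    by (rule filter_split[OF pq(1)])
  have "replace_letters S w v = a @ z # b"
    using replace_letters_append[of S a "y # b" "z # q"] replace_letters_filter[of S b] S ab pq(2) by simp
  moreover have "free_hi x a = 0" "free_lo x b = 0"
    using pq(3,4) ab(2,3) free_filter[of "\<lambda>y. y \<in> S" x] S by auto
  ultimately show ?thesis using crystal_moveI[of x a b y z] ab(1) by simp
qed

lemma crystal_step_replace:
  assumes "x \<in> S" "Suc x \<in> S"
  shows "crystal_step x (filter (\<lambda>y. y \<in> S) w) v \<Longrightarrow> crystal_step x w (replace_letters S w v)"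
    and "crystal_step x v (filter (\<lambda>y. y \<in> S) w) \<Longrightarrow> crystal_step x (replace_letters S w v) w"
  unfolding crystal_step_iff_move(1)
   apply (rule crystal_move_replace; use assms in simp)
  unfolding crystal_step_iff_move(1)[symmetric] crystal_step_iff_move(2)
  by (rule crystal_move_replace; use assms in simp)

lemma crystal_step_shift:
  assumes "crystal_step x u v"
  shows "crystal_step (x + d) (map (\<lambda>y. y + d) u) (map (\<lambda>y. y + d) v)"
proof -
  obtain p q where "u = p @ x # q" "v = p @ Suc x # q" "free_hi x p = 0" "free_lo x q = 0"
    by (rule crystal_stepE[OF assms])
  then show ?thesis
    using crystal_step.intros[of "x + d" "map (\<lambda>y. y + d) p" "map (\<lambda>y. y + d) q"]
    by (simp add: free_map_add)
qed

text \<open>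
  Crystal steps for letters in an interval see a word only through its subword in that interval.
\<close>

lemma conn_replace:
  assumes d: "S = {Suc d..Suc d + h}" and u: "set u \<subseteq> {1..Suc h}"
    and c: "crystal_conn {1..<Suc h} u v" and w: "filter (\<lambda>x. x \<in> S) w = map (\<lambda>y. y + d) u"
  shows "crystal_conn {1..} w (replace_letters S w (map (\<lambda>y. y + d) v))"
  using c
proof (induction rule: conn_induct)
  case base
  have "replace_letters S w (map (\<lambda>y. y + d) u) = w"
    using replace_letters_filter[of S w] w by simp
  then show ?case by simp
next
  case (up v v' x)
  let ?z = "map (\<lambda>y. y + d) v" and ?w = "replace_letters S w (map (\<lambda>y. y + d) v)"
  have z: "length ?z = length (filter (\<lambda>x. x \<in> S) w)" "set ?z \<subseteq> S"
    using conn_length[OF up(2)] conn_letters[OF up(2) u] w d by auto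
  have "crystal_step (x + d) (filter (\<lambda>x. x \<in> S) ?w) (map (\<lambda>y. y + d) v')"
    using crystal_step_shift[OF up(3)] filter_replace_letters[OF z] by simp
  then have "crystal_step (x + d) ?w (replace_letters S ?w (map (\<lambda>y. y + d) v'))"
    by (rule crystal_step_replace(1)[rotated -1]) (use up(1) d in auto)
  then have "crystal_step (x + d) ?w (replace_letters S w (map (\<lambda>y. y + d) v'))"
    by (simp add: replace_letters_twice[OF z])
  then show ?case using conn_trans[OF up(4) conn_step[of "x + d"]] up(1) by simp
next
  case (down v v' x)
  let ?z = "map (\<lambda>y. y + d) v" and ?w = "replace_letters S w (map (\<lambda>y. y + d) v)"
  have z: "length ?z = length (filter (\<lambda>x. x \<in> S) w)" "set ?z \<subseteq> S"
    using conn_length[OF down(2)] conn_letters[OF down(2) u] w d by auto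
  have "crystal_step (x + d) (map (\<lambda>y. y + d) v') (filter (\<lambda>x. x \<in> S) ?w)"
    using crystal_step_shift[OF down(3)] filter_replace_letters[OF z] by simp
  then have "crystal_step (x + d) (replace_letters S ?w (map (\<lambda>y. y + d) v')) ?w"
    by (rule crystal_step_replace(2)[rotated -1]) (use down(1) d in auto)
  then have "crystal_step (x + d) (replace_letters S w (map (\<lambda>y. y + d) v')) ?w"
    by (simp add: replace_letters_twice[OF z])
  then show ?case using conn_trans[OF down(4) conn_step_back[of "x + d"]] down(1) by simp
qed

lemma rect_sigma_conn:
  assumes "1 \<le> i"
  shows "crystal_conn {1..} w (rect_sigma h i w)"
proof -
  obtain d where d: "i = Suc d" using assms by (cases i) auto
  define S where "S = {i..i + h}"
  define u where "u = map (\<lambda>x. x - d) (filter (\<lambda>x. x \<in> S) w)"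
  have u: "set u \<subseteq> {1..Suc h}" by (auto simp: u_def S_def d)
  have "map (\<lambda>y. y + d) u = map (\<lambda>x. x) (filter (\<lambda>x. x \<in> S) w)"
    unfolding u_def map_map by (rule map_cong) (auto simp: S_def d)
  then have w: "filter (\<lambda>x. x \<in> S) w = map (\<lambda>y. y + d) u" by simp
  have "crystal_conn {1..} w (replace_letters S w (map (\<lambda>y. y + d) (rect_sigma1 h u)))"
    by (rule conn_replace[OF _ u rect_sigma1_conn[OF u] w]) (simp add: S_def d)
  then show ?thesis by (simp add: rect_sigma_def u_def S_def d)
qed

lemma rect_sigmas_conn: "0 \<notin> set js \<Longrightarrow> crystal_conn {1..} w (foldr (rect_sigma h) js w)"
proof (induction js)
  case (Cons j js)
  then have "1 \<le> j" by (cases j) auto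
  then show ?case using Cons conn_trans rect_sigma_conn by auto
qed simp

text \<open>
  An operator that moves the reading word inside its component acts on tableaux and keeps the shape.
\<close>

lemma on_tableau_conn:
  assumes T: "is_tableau T" and c: "crystal_conn {1..} (reading_word T) (f (reading_word T))"
  shows "is_tableau (on_tableau f T)" "reading_word (on_tableau f T) = f (reading_word T)"
    "shape (on_tableau f T) = shape T"
proof -
  obtain U where U: "is_tableau U" "shape U = shape T" "reading_word U = f (reading_word T)"
    using conn_tableau[OF c T] by blast
  have "on_tableau f T = U"
    unfolding on_tableau_def
  proof (rule the_equality)
    fix V assume V: "is_tableau V \<and> reading_word V = f (reading_word T)"
    then show "V = U" using knuth_tableau_unique[of V U] U by simp
  qed (use U in simp)
  then show "is_tableau (on_tableau f T)" "reading_word (on_tableau f T) = f (reading_word T)"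
    "shape (on_tableau f T) = shape T" using U by auto
qed

section \<open>Products of Schur functions by components\<close>

lemma bij_betw_from_relation:
  assumes ex: "\<And>a. a \<in> A \<Longrightarrow> \<exists>b\<in>B. R a b" "\<And>b. b \<in> B \<Longrightarrow> \<exists>a\<in>A. R a b"
    and det: "\<And>a b b'. a \<in> A \<Longrightarrow> b \<in> B \<Longrightarrow> b' \<in> B \<Longrightarrow> R a b \<Longrightarrow> R a b' \<Longrightarrow> b = b'"
      "\<And>a a' b. a \<in> A \<Longrightarrow> a' \<in> A \<Longrightarrow> b \<in> B \<Longrightarrow> R a b \<Longrightarrow> R a' b \<Longrightarrow> a = a'"
  shows "\<exists>f. bij_betw f A B \<and> (\<forall>a\<in>A. R a (f a))"
proof -
  obtain f where f: "\<forall>a\<in>A. f a \<in> B \<and> R a (f a)" using ex(1) by metis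
  have "inj_on f A"
  proof (rule inj_onI)
    fix a a' assume a: "a \<in> A" "a' \<in> A" "f a = f a'"
    then show "a = a'" using det(2)[of a a' "f a"] f by auto
  qed
  moreover have "f ` A = B"
  proof (intro equalityI subsetI)
    fix b assume b: "b \<in> B"
    then obtain a where a: "a \<in> A" "R a b" using ex(2) by blast
    then have "f a = b" using det(1)[of a "f a" b] f b by blast
    with a show "b \<in> f ` A" by blast
  qed (use f in blast)
  ultimately show ?thesis using f by (auto simp: bij_betw_def)
qed

definition tableaux :: "nat list \<Rightarrow> nat multiset \<Rightarrow> tableau set" where
  "tableaux lam M = {T. is_tableau T \<and> shape T = lam \<and> mset (reading_word T) = M}"

lemma schur_tableaux: "schur lam M = of_nat (card (tableaux lam M))"
  by (simp add: schur_def tableaux_def)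

lemma finite_tableaux_content: "finite {T. is_tableau T \<and> mset (reading_word T) = M}"
proof (rule finite_imageD)
  have "reading_word ` {T. is_tableau T \<and> mset (reading_word T) = M}
      \<subseteq> {w. set w \<subseteq> set_mset M \<and> length w = size M}"
    by auto
  then show "finite (reading_word ` {T. is_tableau T \<and> mset (reading_word T) = M})"
    by (rule finite_subset) (simp add: finite_lists_length_eq)
  show "inj_on reading_word {T. is_tableau T \<and> mset (reading_word T) = M}"
    by (rule inj_onI) (simp add: knuth_tableau_unique)
qed

lemma finite_tableaux: "finite (tableaux lam M)"
  by (rule finite_subset[OF _ finite_tableaux_content[of M]]) (auto simp: tableaux_def)

definition tableau_pairs :: "nat list \<Rightarrow> nat list \<Rightarrow> (tableau \<times> tableau) set" where
  "tableau_pairs nu mu = {(V, S). is_tableau V \<and> shape V = nu \<and> is_tableau S \<and> shape S = mu}"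

definition pair_word :: "tableau \<times> tableau \<Rightarrow> nat list" where
  "pair_word p = reading_word (fst p) @ reading_word (snd p)"

text \<open>
  A pair of tableaux is a term of the product; the coefficient of a monomial collects the pairs whose
  joint evaluation is that monomial.
\<close>

lemma series_mult_schur:
  "series_mult (schur nu) (schur mu) M =
     of_nat (card {p \<in> tableau_pairs nu mu. mset (pair_word p) = M})"
proof -
  let ?A = "{N. N \<subseteq># M}"
  let ?B = "\<lambda>N. tableaux nu N \<times> tableaux mu (M - N)"
  have fin: "finite ?A"
  proof (rule finite_subset)
    show "?A \<subseteq> mset ` {w. set w \<subseteq> set_mset M \<and> length w \<le> size M}"
    proof
      fix N assume "N \<in> ?A"
      then have N: "N \<subseteq># M" by simp
      obtain w where w: "mset w = N" using ex_mset[of N] by blast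
      have "set w \<subseteq> set_mset M" using set_mset_mono[OF N] by (simp flip: w)
      moreover have "length w \<le> size M" using size_mset_mono[OF N] by (simp flip: w)
      ultimately show "N \<in> mset ` {w. set w \<subseteq> set_mset M \<and> length w \<le> size M}"
        unfolding w[symmetric] by (intro imageI) simp
    qed
    show "finite (mset ` {w. set w \<subseteq> set_mset M \<and> length w \<le> size M})"
      by (rule finite_imageI[OF finite_lists_length_le[OF finite_set_mset]])
  qed
  have "series_mult (schur nu) (schur mu) M = of_nat (\<Sum>N\<in>?A. card (?B N))"
    by (simp add: series_mult_def schur_tableaux card_cartesian_product)
  also have "(\<Sum>N\<in>?A. card (?B N)) = card (Sigma ?A ?B)"
    by (rule card_SigmaI[symmetric]) (simp_all add: fin finite_tableaux)
  also have "\<dots> = card {p \<in> tableau_pairs nu mu. mset (pair_word p) = M}"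
  proof (rule bij_betw_same_card)
    have "inj_on snd (Sigma ?A ?B)"
    proof (rule inj_onI)
      fix a b assume ab: "a \<in> Sigma ?A ?B" "b \<in> Sigma ?A ?B" "snd a = snd b"
      have "fst c = mset (reading_word (fst (snd c)))" if "c \<in> Sigma ?A ?B" for c
        using that by (cases c) (simp add: tableaux_def mem_Times_iff)
      with ab show "a = b" by (simp add: prod_eq_iff)
    qed
    moreover have "snd ` Sigma ?A ?B = {p \<in> tableau_pairs nu mu. mset (pair_word p) = M}"
    proof (intro equalityI subsetI)
      fix p assume p: "p \<in> {p \<in> tableau_pairs nu mu. mset (pair_word p) = M}"
      obtain V S where VS: "p = (V, S)" by (cases p)
      have t: "is_tableau V" "shape V = nu" "is_tableau S" "shape S = mu"
        and M: "M = mset (reading_word V) + mset (reading_word S)"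
        using p by (auto simp: VS tableau_pairs_def pair_word_def)
      have "(mset (reading_word V), p) \<in> Sigma ?A ?B"
        unfolding M VS by (simp add: t tableaux_def)
      then show "p \<in> snd ` Sigma ?A ?B" by (rule rev_image_eqI) simp
    next
      fix p assume "p \<in> snd ` Sigma ?A ?B"
      then obtain N where N: "N \<subseteq># M" "p \<in> ?B N" by auto
      then show "p \<in> {p \<in> tableau_pairs nu mu. mset (pair_word p) = M}"
        by (simp add: tableau_pairs_def tableaux_def mem_Times_iff case_prod_beta pair_word_def)
    qed
    ultimately show "bij_betw snd (Sigma ?A ?B) {p \<in> tableau_pairs nu mu. mset (pair_word p) = M}"
      unfolding bij_betw_def ..
  qed
  finally show ?thesis .
qed

lemma crystal_move_append:
  assumes "crystal_move x y z (u @ v) w"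
  shows "(\<exists>u'. crystal_move x y z u u' \<and> w = u' @ v) \<or> (\<exists>v'. crystal_move x y z v v' \<and> w = u @ v')"
proof -
  obtain p q where pq: "u @ v = p @ y # q" "w = p @ z # q" "free_hi x p = 0" "free_lo x q = 0"
    by (rule crystal_moveE[OF assms])
  have "p @ y # q = [] @ u @ v" using pq(1) by simp
  then show ?thesis
  proof (cases rule: append3_cases)
    case (left m)
    then show ?thesis by simp
  next
    case (middle p' m)
    then have "free_lo x m = 0" using pq(4) free_lo_append_0[of x m v] by simp
    with crystal_moveI[of x p m y z] middle pq show ?thesis by simp
  next
    case (right m)
    then have "free_hi x m = 0" using pq(3) free_hi_append_0[of x u m] by simp
    with crystal_moveI[of x m q y z] right pq show ?thesis by simp
  qed
qed

lemmas crystal_step_append = crystal_move_append[of x x "Suc x" for x, folded crystal_step_iff_move(1)]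
lemmas crystal_step_append_back = crystal_move_append[of x "Suc x" x for x, folded crystal_step_iff_move(2)]

text \<open>
  A crystal step on a concatenation changes one of the two words only, and does so by a crystal step.
\<close>

lemma conn_pair:
  assumes p: "p \<in> tableau_pairs nu mu" and c: "crystal_conn {1..} (pair_word p) w"
  shows "\<exists>q\<in>tableau_pairs nu mu. pair_word q = w"
  using c
proof (induction rule: conn_induct)
  case base
  then show ?case using p by blast
next
  case (up u u' x)
  then obtain V S where q: "is_tableau V" "shape V = nu" "is_tableau S" "shape S = mu"
      "u = reading_word V @ reading_word S"
    by (auto simp: tableau_pairs_def pair_word_def)
  have x: "1 \<le> x" using up(1) by simp
  from crystal_step_append[OF up(3)[unfolded q(5)]] show ?case
  proof (elim disjE exE conjE)
    fix u1 assume "crystal_step x (reading_word V) u1" "u' = u1 @ reading_word S"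
    with crystal_step_tableau[OF q(1) x this(1)] q show ?thesis
      by (auto simp: tableau_pairs_def pair_word_def)
  next
    fix v1 assume "crystal_step x (reading_word S) v1" "u' = reading_word V @ v1"
    with crystal_step_tableau[OF q(3) x this(1)] q show ?thesis
      by (auto simp: tableau_pairs_def pair_word_def)
  qed
next
  case (down u u' x)
  then obtain V S where q: "is_tableau V" "shape V = nu" "is_tableau S" "shape S = mu"
      "u = reading_word V @ reading_word S"
    by (auto simp: tableau_pairs_def pair_word_def)
  have x: "1 \<le> x" using down(1) by simp
  from crystal_step_append_back[OF down(3)[unfolded q(5)]] show ?case
  proof (elim disjE exE conjE)
    fix u1 assume "crystal_step x u1 (reading_word V)" "u' = u1 @ reading_word S"
    with crystal_step_tableau_back[OF q(1) x this(1)] q show ?thesis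
      by (auto simp: tableau_pairs_def pair_word_def)
  next
    fix v1 assume "crystal_step x v1 (reading_word S)" "u' = reading_word V @ v1"
    with crystal_step_tableau_back[OF q(3) x this(1)] q show ?thesis
      by (auto simp: tableau_pairs_def pair_word_def)
  qed
qed

lemma length_reading_word: "length (reading_word T) = sum_list (shape T)"
  by (induction T) (simp_all add: shape_def)

lemma pair_word_inj:
  assumes p: "p \<in> tableau_pairs nu mu" and q: "q \<in> tableau_pairs nu mu" and eq: "pair_word p = pair_word q"
  shows "p = q"
proof -
  have "length (reading_word (fst p)) = length (reading_word (fst q))"
    using p q by (auto simp: length_reading_word tableau_pairs_def)
  with eq have "reading_word (fst p) = reading_word (fst q)" "reading_word (snd p) = reading_word (snd q)"
    by (auto simp: pair_word_def)
  with p q show ?thesis using tableau_eqI by (auto simp: tableau_pairs_def)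
qed

lemma pair_word_no_zero: "p \<in> tableau_pairs nu mu \<Longrightarrow> 0 \<notin> set (pair_word p)"
  by (auto simp: tableau_pairs_def pair_word_def dest: tableau_no_zero)

definition yamanouchi_pairs :: "nat list \<Rightarrow> nat list \<Rightarrow> (tableau \<times> tableau) set" where
  "yamanouchi_pairs nu mu = {p \<in> tableau_pairs nu mu. highest_weight {1..} (pair_word p)}"

text \<open>
  The words of pairs form a union of components.  Inside a component the insertion tableau determines the
  word and runs through all tableaux of the shape of the component; components are represented by their
  Yamanouchi words.
\<close>

lemma pairs_by_components:
  assumes fin: "finite (yamanouchi_pairs nu mu)"
  shows "card {p \<in> tableau_pairs nu mu. mset (pair_word p) = M} =
     (\<Sum>p\<in>yamanouchi_pairs nu mu. card (tableaux (shape (P_tab (pair_word p))) M))"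
proof -
  let ?A = "{p \<in> tableau_pairs nu mu. mset (pair_word p) = M}"
  let ?B = "Sigma (yamanouchi_pairs nu mu) (\<lambda>p. tableaux (shape (P_tab (pair_word p))) M)"
  define R where "R q pU \<longleftrightarrow> crystal_conn {1..} (pair_word q) (pair_word (fst pU)) \<and> P_tab (pair_word q) = snd pU"
    for q :: "tableau \<times> tableau" and pU :: "(tableau \<times> tableau) \<times> tableau"
  have "\<exists>f. bij_betw f ?A ?B \<and> (\<forall>a\<in>?A. R a (f a))"
  proof (rule bij_betw_from_relation)
    fix q assume q: "q \<in> ?A"
    then have z: "0 \<notin> set (pair_word q)" using pair_word_no_zero by blast
    obtain h where h: "crystal_conn {1..} (pair_word q) h" "highest_weight {1..} h"
      using ex_highest_weight by blast
    obtain p where p: "p \<in> tableau_pairs nu mu" "pair_word p = h"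
      using conn_pair[OF _ h(1)] q by blast
    have "P_tab (pair_word q) \<in> tableaux (shape (P_tab (pair_word p))) M"
      using P_tab(1)[OF z] P_tab_mset[OF z] conn_shape[OF h(1) z] p(2) q by (simp add: tableaux_def)
    with p h show "\<exists>b\<in>?B. R q b"
      by (intro bexI[of _ "(p, P_tab (pair_word q))"]) (simp_all add: R_def yamanouchi_pairs_def)
  next
    fix b assume "b \<in> ?B"
    then obtain p U where b: "b = (p, U)" "p \<in> yamanouchi_pairs nu mu"
        "U \<in> tableaux (shape (P_tab (pair_word p))) M" by blast
    have p: "p \<in> tableau_pairs nu mu" using b(2) by (simp add: yamanouchi_pairs_def)
    have U: "is_tableau U" "shape U = shape (P_tab (pair_word p))" "mset (reading_word U) = M"
      using b(3) by (auto simp: tableaux_def)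
    define n where "n = Max (insert 0 (set (pair_word p) \<union> set (reading_word U)))"
    have n: "y \<le> n" if "y \<in> set (pair_word p) \<union> set (reading_word U)" for y
      unfolding n_def using that by (intro Max_ge) auto
    have le1: "1 \<le> y" if "y \<in> set (pair_word p) \<union> set (reading_word U)" for y
      using that pair_word_no_zero[OF p] tableau_no_zero[OF U(1)] by (cases y) auto
    have "set (pair_word p) \<subseteq> {1..n}" "set (reading_word U) \<subseteq> {1..n}"
      using n le1 by auto
    from component_P_surj[OF this(1) U(1,2) this(2)] obtain v
      where v: "crystal_conn {1..<n} (pair_word p) v" "P_tab v = U" by blast
    have sub: "{1..<n} \<subseteq> {1..}" by auto
    have c: "crystal_conn {1..} (pair_word p) v" by (rule conn_mono[OF v(1) sub])
    obtain q where q: "q \<in> tableau_pairs nu mu" "pair_word q = v"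
      using conn_pair[OF p c] by blast
    have "mset (pair_word q) = M"
      using P_tab_mset[OF pair_word_no_zero[OF q(1)]] q(2) v(2) U(3) by simp
    with q b(1) v(2) conn_sym[OF c] show "\<exists>a\<in>?A. R a b"
      by (intro bexI[of _ q]) (simp_all add: R_def)
  next
    fix q b b' assume h: "q \<in> ?A" "b \<in> ?B" "b' \<in> ?B" "R q b" "R q b'"
    then have b: "fst b \<in> yamanouchi_pairs nu mu" "fst b' \<in> yamanouchi_pairs nu mu" by auto
    have t: "fst b \<in> tableau_pairs nu mu" "fst b' \<in> tableau_pairs nu mu"
      using b by (simp_all add: yamanouchi_pairs_def)
    have "crystal_conn {1..} (pair_word (fst b)) (pair_word (fst b'))"
      using h(4,5) conn_sym conn_trans unfolding R_def by blast
    then have "pair_word (fst b) = pair_word (fst b')"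
      using b pair_word_no_zero[OF t(1)] by (intro yamanouchi_conn_eq) (simp_all add: yamanouchi_pairs_def)
    then have "fst b = fst b'" by (rule pair_word_inj[OF t])
    moreover have "snd b = snd b'" using h(4,5) by (simp add: R_def)
    ultimately show "b = b'" by (rule prod_eqI)
  next
    fix q q' b assume h: "q \<in> ?A" "q' \<in> ?A" "b \<in> ?B" "R q b" "R q' b"
    have t: "q \<in> tableau_pairs nu mu" "q' \<in> tableau_pairs nu mu" using h by auto
    have z: "0 \<notin> set (pair_word q)" "0 \<notin> set (pair_word q')" using pair_word_no_zero t by auto
    have c: "crystal_conn {1..} (pair_word q) (pair_word q')"
      using h(4,5) conn_sym conn_trans unfolding R_def by blast
    have "P_tab (pair_word q) = P_tab (pair_word q')" using h(4,5) by (simp add: R_def)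
    then have "knuth_equiv (pair_word q) (pair_word q')"
      using knuth_trans[OF P_tab(2)[OF z(1)]] knuth_sym[OF P_tab(2)[OF z(2)]] by simp
    then have "pair_word q = pair_word q'" by (rule conn_knuth_eq[OF c _ z(1)])
    then show "q = q'" by (rule pair_word_inj[OF t])
  qed
  then have "card ?A = card ?B" using bij_betw_same_card by blast
  also have "\<dots> = (\<Sum>p\<in>yamanouchi_pairs nu mu. card (tableaux (shape (P_tab (pair_word p))) M))"
    by (rule card_SigmaI) (simp_all add: fin finite_tableaux)
  finally show ?thesis .
qed

section \<open>The Littlewood--Richardson rule\<close>

lemma count_replicate: "count_list (replicate n z) y = (if z = y then n else 0)"
  by (induction n) auto

text \<open>
  The part of a row occupied by added letters, given by the multiplicities of the letters \<open>m + 1, \<dots>, m + h\<close>.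
\<close>

definition blocks :: "nat \<Rightarrow> nat \<Rightarrow> (nat \<Rightarrow> nat) \<Rightarrow> nat list" where
  "blocks m h a = concat (map (\<lambda>j. replicate (a j) (Suc (m + j))) [0..<h])"

lemma blocks_0 [simp]: "blocks m 0 a = []"
  by (simp add: blocks_def)

lemma blocks_Suc: "blocks m (Suc h) a = blocks m h a @ replicate (a h) (Suc (m + h))"
  by (simp add: blocks_def)

lemma blocks_cong: "(\<And>j. j < h \<Longrightarrow> a j = b j) \<Longrightarrow> blocks m h a = blocks m h b"
  by (induction h) (simp_all add: blocks_Suc)

lemma count_blocks: "count_list (blocks m h a) y = (if m < y \<and> y \<le> m + h then a (y - Suc m) else 0)"
  by (induction h) (auto simp: blocks_Suc count_replicate le_Suc_eq)

lemma set_blocks: "set (blocks m h a) \<subseteq> {Suc m..m + h}"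
  by (induction h) (auto simp: blocks_Suc)

lemma sorted_blocks: "sorted (blocks m h a)"
proof (induction h)
  case (Suc h)
  then show ?case using set_blocks[of m h a] by (auto simp: blocks_Suc sorted_append sorted_replicate subset_iff)
qed simp

lemma le_count_sum: "le_count r (m + j) = le_count r m + (\<Sum>t<j. count_list r (Suc (m + t)))"
  by (induction j) (simp_all add: le_count_Suc)

lemma sorted_eqI_count:
  assumes "sorted r" "sorted s" "\<And>y::nat. count_list r y = count_list s y"
  shows "r = s"
proof -
  have "mset r = mset s" using assms(3) by (intro multiset_eqI) (simp add: count_mset)
  then show ?thesis using assms(1,2) by (metis properties_for_sort)
qed

text \<open>
  Interlacing forces all rows above an empty row to be empty, so the nonempty rows form a tableau.
\<close>

lemma tableau_of_rows:
  assumes r: "\<And>i. sorted (r i)" "\<And>i. 0 \<notin> set (r i)" and end0: "\<And>i. N \<le> i \<Longrightarrow> r i = []"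
    and I: "\<And>i x. le_count (r (Suc i)) (Suc x) \<le> le_count (r i) x"
  shows "\<exists>T. is_tableau T \<and> (\<forall>i. row i T = r i)"
proof -
  have emp: "r (Suc i) = []" if "r i = []" for i
  proof -
    have "le_count (r (Suc i)) (Suc x) = 0" for x using I[of i x] that by simp
    from this[of "Max (insert 0 (set (r (Suc i))))"] have "length (r (Suc i)) = 0"
      by (subst (asm) le_count_all) (auto intro: le_SucI)
    then show ?thesis by simp
  qed
  define n where "n = (LEAST i. r i = [])"
  have n: "r n = []" unfolding n_def by (rule LeastI[of _ N]) (simp add: end0)
  have ge: "r (n + d) = []" for d by (induction d) (use n emp in auto)
  have less: "r i \<noteq> []" if "i < n" for i using not_less_Least[of i "\<lambda>i. r i = []"] that n_def by blast
  define T where "T = map r [0..<n]"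
  have row: "row i T = r i" for i
    using ge[of "i - n"] by (cases "i < n") (simp_all add: T_def row_def)
  have "[] \<notin> set T"
  proof
    assume "[] \<in> set T"
    then obtain i where "i < n" "r i = []" by (auto simp: T_def)
    with less show False by blast
  qed
  then have "is_tableau T"
    unfolding tableau_iff row using r I by (auto simp: T_def)
  with row show ?thesis by blast
qed

lemma count_reading_ge:
  "length T \<le> N \<Longrightarrow> count_list (reading_word T) x = (\<Sum>i<N. count_list (row i T) x)"
  unfolding count_reading by (rule sum.mono_neutral_left) auto

lemma length_reading_rows: "length T \<le> N \<Longrightarrow> length (reading_word T) = (\<Sum>i<N. length (row i T))"
proof -
  have "length (reading_word T) = (\<Sum>i<length T. length (row i T))"
  proof (induction T)
    case (Cons r T)
    then show ?case by (simp add: sum.lessThan_Suc_shift del: sum.lessThan_Suc)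
  qed simp
  also assume "length T \<le> N"
  then have "(\<Sum>i<length T. length (row i T)) = (\<Sum>i<N. length (row i T))"
    by (intro sum.mono_neutral_left) auto
  finally show ?thesis .
qed

lemma sum_row_Cons: "(\<Sum>t<Suc i. f (row t (r # T))) = f r + (\<Sum>t<i. f (row t T))"
  by (simp add: sum.lessThan_Suc_shift del: sum.lessThan_Suc)

text \<open>
  In a sorted row the letters \<open>x\<close> precede the letters \<open>x + 1\<close>.  Hence the number of letters \<open>x + 1\<close> minus that
  of letters \<open>x\<close> in a suffix can only be critical when the suffix starts at the first letter \<open>x + 1\<close> of
  some row.
\<close>

lemma free_hi_reading:
  assumes "\<forall>r\<in>set T. sorted r"
  shows "free_hi x (reading_word T @ z) = 0 \<longleftrightarrow> free_hi x z = 0 \<and>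
     (\<forall>i. (\<Sum>t<Suc i. count_list (row t T) (Suc x)) + count_list z (Suc x)
           \<le> (\<Sum>t<i. count_list (row t T) x) + count_list z x)"
  using assms
proof (induction T arbitrary: z)
  case Nil
  show ?case using free_count[of z x] by auto
next
  case (Cons r T)
  have r: "sorted r" using Cons.prems by simp
  define Q where "Q i \<longleftrightarrow> (\<Sum>t<Suc i. count_list (row t (r # T)) (Suc x)) + count_list z (Suc x)
           \<le> (\<Sum>t<i. count_list (row t (r # T)) x) + count_list z x" for i
  have "free_hi x (r @ z) = 0 \<longleftrightarrow> free_hi x z = 0 \<and> count_list r (Suc x) + count_list z (Suc x) \<le> count_list z x"
    using free_count[of z x] by (auto simp: free_hi_append sorted_free(2)[OF r])
  moreover have "free_hi x (reading_word T @ (r @ z)) = 0 \<longleftrightarrow> free_hi x (r @ z) = 0 \<and>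
     (\<forall>i. (\<Sum>t<Suc i. count_list (row t T) (Suc x)) + count_list (r @ z) (Suc x)
           \<le> (\<Sum>t<i. count_list (row t T) x) + count_list (r @ z) x)"
    by (rule Cons.IH) (use Cons.prems in simp)
  moreover have "Q (Suc i) \<longleftrightarrow> (\<Sum>t<Suc i. count_list (row t T) (Suc x)) + count_list (r @ z) (Suc x)
           \<le> (\<Sum>t<i. count_list (row t T) x) + count_list (r @ z) x" for i
    unfolding Q_def sum_row_Cons[of "\<lambda>r. count_list r (Suc x)"] sum_row_Cons[of "\<lambda>r. count_list r x"]
    by (simp only: count_list_append) linarith
  moreover have "Q 0 \<longleftrightarrow> count_list r (Suc x) + count_list z (Suc x) \<le> count_list z x"
    by (simp add: Q_def)
  moreover have "(\<forall>i. Q i) \<longleftrightarrow> Q 0 \<and> (\<forall>i. Q (Suc i))"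
  proof
    assume "Q 0 \<and> (\<forall>i. Q (Suc i))"
    then show "\<forall>i. Q i" by (metis not0_implies_Suc)
  qed blast
  ultimately have "free_hi x (reading_word T @ r @ z) = 0 \<longleftrightarrow> free_hi x z = 0 \<and> (\<forall>i. Q i)"
    by (simp only: conj_assoc)
  then show ?case by (simp only: Q_def reading_word_simps append_assoc)
qed

lemma adds_strip_iff:
  assumes T: "is_tableau T"
  shows "adds_strip a r T U \<longleftrightarrow> is_tableau U \<and> (\<exists>n. (\<forall>i. row i U = row i T @ replicate (n i) a)) \<and>
     length (reading_word U) = length (reading_word T) + r"
proof
  assume A: "adds_strip a r T U"
  then have "\<exists>n. row i U = row i T @ replicate n a" for i
    unfolding adds_strip_def by (cases "i < length U") (auto simp: row_less)
  with A show "is_tableau U \<and> (\<exists>n. (\<forall>i. row i U = row i T @ replicate (n i) a)) \<and>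
     length (reading_word U) = length (reading_word T) + r"
    unfolding adds_strip_def by metis
next
  assume R: "is_tableau U \<and> (\<exists>n. (\<forall>i. row i U = row i T @ replicate (n i) a)) \<and>
     length (reading_word U) = length (reading_word T) + r"
  have "length T \<le> length U"
  proof (rule ccontr)
    assume "\<not> length T \<le> length U"
    then have "row (length U) T \<noteq> []" using T unfolding tableau_iff by (metis nth_mem not_le row_less)
    moreover have "row (length U) U = []" by simp
    ultimately show False using R by (metis append_is_Nil_conv)
  qed
  with R show "adds_strip a r T U" unfolding adds_strip_def by (metis row_less)
qed

lemma le_count_filter: "le_count (filter (\<lambda>y. y \<le> b) r) x = le_count r (min x b)"
  by (induction r) auto

lemma row_blocks_filter:
  assumes "\<forall>y\<in>set r. y \<le> m"
  shows "filter (\<lambda>y. y \<le> m + h) (r @ blocks m (Suc h) a) = r @ blocks m h a"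
proof -
  have "filter (\<lambda>y. y \<le> m + h) r = r" using assms by (auto simp: filter_id_conv)
  moreover have "filter (\<lambda>y. y \<le> m + h) (blocks m h a) = blocks m h a"
    using set_blocks[of m h a] by (auto simp: filter_id_conv)
  ultimately show ?thesis by (simp add: blocks_Suc)
qed

lemma restrict_tableau:
  assumes U: "is_tableau U"
  shows "\<exists>T. is_tableau T \<and> (\<forall>i. row i T = filter (\<lambda>y. y \<le> b) (row i U))"
proof (rule tableau_of_rows[of _ "length U"])
  fix i x
  have mono: "x \<le> y \<Longrightarrow> le_count r x \<le> le_count r y" for r x y
    by (induction r) auto
  have "le_count (row (Suc i) U) (min (Suc x) b) \<le> le_count (row (Suc i) U) (Suc (min x b))"
    by (rule mono) auto
  also have "\<dots> \<le> le_count (row i U) (min x b)" by (rule tableau_interlacing[OF U])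
  finally show "le_count (filter (\<lambda>y. y \<le> b) (row (Suc i) U)) (Suc x) \<le> le_count (filter (\<lambda>y. y \<le> b) (row i U)) x"
    by (simp add: le_count_filter)
qed (use tableau_row[OF U] in \<open>auto intro: sorted_wrt_filter\<close>)

text \<open>
  The intermediate tableaux are the restrictions of \<open>U\<close> to the letters at most \<open>m + j\<close>, so that it suffices
  to require that \<open>U\<close> is a tableau.
\<close>

lemma add_strips_iff:
  assumes T: "is_tableau T" and m: "\<forall>y\<in>set (reading_word T). y \<le> m"
  shows "U \<in> add_strips m l h T \<longleftrightarrow> is_tableau U \<and> (\<exists>a. \<forall>i. row i U = row i T @ blocks m h (a i)) \<and>
     (\<forall>j<h. count_list (reading_word U) (Suc (m + j)) = l)"
proof (induction h arbitrary: U)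
  case 0
  show ?case using tableau_eqI_rows[OF _ T] T by auto
next
  case (Suc h)
  have rT: "\<forall>y\<in>set (row i T). y \<le> m" for i using m row_subset by fastforce
  show ?case
  proof
    assume "U \<in> add_strips m l (Suc h) T"
    then obtain V where V: "V \<in> add_strips m l h T" and VU: "adds_strip (m + Suc h) l V U" by auto
    from V Suc.IH obtain a where a: "is_tableau V" "\<forall>i. row i V = row i T @ blocks m h (a i)"
      "\<forall>j<h. count_list (reading_word V) (Suc (m + j)) = l" by blast
    from VU adds_strip_iff[OF a(1)] obtain n where n: "is_tableau U"
      "\<forall>i. row i U = row i V @ replicate (n i) (m + Suc h)"
      "length (reading_word U) = length (reading_word V) + l" by blast
    define N where "N = max (length U) (length V)"
    have le: "length U \<le> N" "length V \<le> N" by (simp_all add: N_def)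
    have "row i U = row i T @ blocks m (Suc h) ((a i)(h := n i))" for i
      using a(2) n(2) blocks_cong[of h "a i" "(a i)(h := n i)" m] by (simp add: blocks_Suc)
    moreover have "count_list (reading_word U) (Suc (m + j)) = l" if "j < Suc h" for j
    proof (cases "j = h")
      case False
      with that have j: "j < h" by simp
      have "count_list (reading_word U) (Suc (m + j)) = count_list (reading_word V) (Suc (m + j))"
        using n(2) j by (simp add: count_reading_ge[OF le(1)] count_reading_ge[OF le(2)] count_replicate)
      then show ?thesis using a(3) j by simp
    next
      case True
      have "Suc (m + h) \<notin> set (row i V)" for i
        using a(2) rT[of i] set_blocks[of m h "a i"] by force
      then have "count_list (reading_word U) (Suc (m + h)) = (\<Sum>i<N. n i)"
        using n(2) by (simp add: count_reading_ge[OF le(1)] count_replicate count_list_0_iff)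
      moreover have "length (reading_word U) = length (reading_word V) + (\<Sum>i<N. n i)"
        using n(2) by (simp add: length_reading_rows[OF le(1)] length_reading_rows[OF le(2)] sum.distrib)
      ultimately show ?thesis using n(3) True by simp
    qed
    ultimately show "is_tableau U \<and> (\<exists>a. \<forall>i. row i U = row i T @ blocks m (Suc h) (a i)) \<and>
     (\<forall>j<Suc h. count_list (reading_word U) (Suc (m + j)) = l)"
      using n(1) by (intro conjI exI[of _ "\<lambda>i. (a i)(h := n i)"]) auto
  next
    assume "is_tableau U \<and> (\<exists>a. \<forall>i. row i U = row i T @ blocks m (Suc h) (a i)) \<and>
     (\<forall>j<Suc h. count_list (reading_word U) (Suc (m + j)) = l)"
    then obtain a where U: "is_tableau U" and a: "\<forall>i. row i U = row i T @ blocks m (Suc h) (a i)"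
      and l: "\<forall>j<Suc h. count_list (reading_word U) (Suc (m + j)) = l" by blast
    from restrict_tableau[OF U, of "m + h"] obtain V where
      V: "is_tableau V" "\<forall>i. row i V = filter (\<lambda>y. y \<le> m + h) (row i U)" by blast
    have rV: "row i V = row i T @ blocks m h (a i)" for i
      using V(2) a row_blocks_filter[OF rT] by simp
    have rU: "row i U = row i V @ replicate (a i h) (m + Suc h)" for i
      using rV a by (simp add: blocks_Suc)
    define N where "N = max (length U) (length V)"
    have le: "length U \<le> N" "length V \<le> N" by (simp_all add: N_def)
    have "count_list (reading_word V) (Suc (m + j)) = l" if "j < h" for j
    proof -
      have "count_list (reading_word V) (Suc (m + j)) = count_list (reading_word U) (Suc (m + j))"
        using that by (simp add: count_reading_ge[OF le(1)] count_reading_ge[OF le(2)] rU count_replicate)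
      then show ?thesis using l that by simp
    qed
    then have "V \<in> add_strips m l h T" using Suc.IH V(1) rV by blast
    moreover have "length (reading_word U) = length (reading_word V) + l"
    proof -
      have "Suc (m + h) \<notin> set (row i V)" for i
        using rV rT[of i] set_blocks[of m h "a i"] by force
      then have "count_list (reading_word U) (Suc (m + h)) = (\<Sum>i<N. a i h)"
        by (simp add: count_reading_ge[OF le(1)] rU count_replicate count_list_0_iff)
      moreover have "length (reading_word U) = length (reading_word V) + (\<Sum>i<N. a i h)"
        by (simp add: length_reading_rows[OF le(1)] length_reading_rows[OF le(2)] rU sum.distrib)
      ultimately show ?thesis using l by simp
    qed
    then have "adds_strip (m + Suc h) l V U"
      unfolding adds_strip_iff[OF V(1)] using U rU by (intro conjI exI[of _ "\<lambda>i. a i h"]) auto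
    ultimately show "U \<in> add_strips m l (Suc h) T" by auto
  qed
qed

lemma yamanouchi_iff:
  "yamanouchi m h w \<longleftrightarrow> (\<forall>j. Suc j < h \<longrightarrow> free_hi (Suc (m + j)) w = 0)"
proof
  assume Y: "yamanouchi m h w"
  show "\<forall>j. Suc j < h \<longrightarrow> free_hi (Suc (m + j)) w = 0"
  proof (intro allI impI)
    fix j assume "Suc j < h"
    then show "free_hi (Suc (m + j)) w = 0"
      using Y[unfolded yamanouchi_def, rule_format, of "Suc j" "Suc (Suc j)"]
      unfolding free_hi_0_iff by simp
  qed
next
  assume F: "\<forall>j. Suc j < h \<longrightarrow> free_hi (Suc (m + j)) w = 0"
  show "yamanouchi m h w"
    unfolding yamanouchi_def
  proof (intro allI impI)
    fix n i j :: nat assume ij: "1 \<le> i" "i < j" "j \<le> h"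
    have step: "count_list (drop n w) (m + Suc x) \<le> count_list (drop n w) (m + x)" if "1 \<le> x" "x < h" for x
      using F[rule_format, of "x - 1"] that unfolding free_hi_0_iff by simp
    have "i + d \<le> h \<Longrightarrow> count_list (drop n w) (m + (i + d)) \<le> count_list (drop n w) (m + i)" for d
    proof (induction d)
      case (Suc d)
      then show ?case using step[of "i + d"] ij by simp
    qed simp
    from this[of "j - i"] ij show "count_list (drop n w) (m + j) \<le> count_list (drop n w) (m + i)" by simp
  qed
qed

lemma blocks_zero: "(\<And>j. j < h \<Longrightarrow> a j = 0) \<Longrightarrow> blocks m h a = []"
  by (induction h) (simp_all add: blocks_Suc)

lemma length_blocks: "length (blocks m h a) = (\<Sum>j<h. a j)"
  by (induction h) (simp_all add: blocks_Suc)

lemma le_count_blocks: "y \<le> m \<Longrightarrow> le_count (blocks m h a) y = 0"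
  using set_blocks[of m h a] by (auto simp: le_count_def filter_empty_conv subset_iff)

text \<open>
  The Littlewood--Richardson tableaux on top of \<open>T\<close>, that is, the summands of the operator
  \<open>R\<close> for a rectangle.
\<close>

definition lr_tableaux :: "nat \<Rightarrow> nat \<Rightarrow> nat \<Rightarrow> tableau \<Rightarrow> tableau set" where
  "lr_tableaux m l h T = {U \<in> add_strips m l h T. yamanouchi m h (reading_word U)}"

lemma add_strips_length: "U \<in> add_strips m l h T \<Longrightarrow> length (reading_word U) = length (reading_word T) + h * l"
  by (induction h arbitrary: U) (auto simp: adds_strip_def)

context
  fixes T :: tableau and m :: nat
  assumes T: "is_tableau T" and m: "\<forall>y\<in>set (reading_word T). y \<le> m"
begin

lemma T_row_le: "\<forall>y\<in>set (row i T). y \<le> m"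
  using m row_subset by fastforce

lemma finite_lr_tableaux: "finite (lr_tableaux m l h T)"
proof (rule finite_imageD)
  have "set (reading_word U) \<subseteq> {0..m + h}" if U: "U \<in> add_strips m l h T" for U
  proof
    fix y assume "y \<in> set (reading_word U)"
    then obtain i where "y \<in> set (row i U)"
      by (auto simp: reading_word_def in_set_conv_nth[of _ U] row_def)
    moreover obtain a where "row i U = row i T @ blocks m h (a i)"
      using U add_strips_iff[OF T m] by blast
    ultimately show "y \<in> {0..m + h}"
      using T_row_le[of i] set_blocks[of m h "a i"] by fastforce
  qed
  then have "reading_word ` lr_tableaux m l h T
     \<subseteq> {w. set w \<subseteq> {0..m + h} \<and> length w = length (reading_word T) + h * l}"
    using add_strips_length by (auto simp: lr_tableaux_def)
  then show "finite (reading_word ` lr_tableaux m l h T)"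
    by (rule finite_subset[OF _ finite_lists_length_eq]) simp
  show "inj_on reading_word (lr_tableaux m l h T)"
    by (rule inj_onI) (auto simp: lr_tableaux_def add_strips_iff[OF T m] intro: knuth_tableau_unique)
qed

lemma lr_le_count:
  assumes "row i U = row i T @ blocks m h a"
  shows "le_count (row i U) (m + j) = length (row i T) + (\<Sum>t<j. count_list (row i U) (Suc (m + t)))"
  unfolding le_count_sum using le_count_all[OF T_row_le] le_count_blocks[of m m h a] assms by simp

text \<open>
  The companion of \<open>U\<close> exchanges rows and letters: a letter \<open>m + j + 1\<close> in row \<open>i\<close> of \<open>U\<close> becomes a letter
  \<open>i + 1\<close> in row \<open>j\<close>.  Under this exchange strictly increasing columns and the Yamanouchi condition change
  places.
\<close>

definition companion :: "tableau \<Rightarrow> tableau \<times> tableau \<Rightarrow> bool" where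
  "companion U p \<longleftrightarrow>
     (\<forall>i j. count_list (row i U) (Suc (m + j)) = count_list (row j (fst p)) (Suc i))"

lemma rect_partition: "1 \<le> l \<Longrightarrow> is_partition (rect l h)"
  by (auto simp: is_partition_def rect_def sorted_wrt_iff_nth_less)

lemma rect_shapeI:
  assumes V: "is_tableau V" and l: "1 \<le> l"
    and len: "\<And>j. length (row j V) = (if j < h then l else 0)"
  shows "shape V = rect l h"
proof -
  have "length (row j (canonical 0 (rect l h))) = (if j < h then l else 0)" for j
    by (simp add: row_def nth_canonical rect_def)
  then have "shape V = shape (canonical 0 (rect l h))"
    by (intro shape_eqI[OF V canonical_tableau[OF rect_partition[OF l]]]) (simp only: len)
  then show ?thesis by simp
qed

lemma count_canonical_row: "count_list (reading_word (canonical 0 (shape T))) (Suc i) = length (row i T)"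
  by (simp add: count_canonical row_def shape_def)

text \<open>
  The condition says that the shape of \<open>T\<close>, with the letters of \<open>V\<close> added one at a time from the end of the
  reading word, stays a partition.
\<close>

lemma pair_highest_iff:
  assumes V: "is_tableau V"
  shows "highest_weight {1..} (reading_word V @ reading_word (canonical 0 (shape T))) \<longleftrightarrow>
    (\<forall>i j. (\<Sum>t<Suc j. count_list (row t V) (Suc (Suc i))) + length (row (Suc i) T)
        \<le> (\<Sum>t<j. count_list (row t V) (Suc i)) + length (row i T))"
proof -
  let ?K = "reading_word (canonical 0 (shape T))"
  have sV: "\<forall>r\<in>set V. sorted r" using V by (simp add: is_tableau_def)
  have K: "free_hi (Suc i) ?K = 0" for i
    using canonical_highest[of "shape T"] T by (simp add: highest_weight_def is_tableau_def)
  have "highest_weight {1..} (reading_word V @ ?K) \<longleftrightarrow> (\<forall>i. free_hi (Suc i) (reading_word V @ ?K) = 0)"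
    unfolding highest_weight_def by (metis Suc_le_D atLeast_iff le_add1 plus_1_eq_Suc One_nat_def)
  also have "\<dots> \<longleftrightarrow> (\<forall>i j. (\<Sum>t<Suc j. count_list (row t V) (Suc (Suc i))) + length (row (Suc i) T)
        \<le> (\<Sum>t<j. count_list (row t V) (Suc i)) + length (row i T))"
    unfolding free_hi_reading[OF sV] count_canonical_row using K by simp
  finally show ?thesis .
qed

text \<open>
  The second word is a suffix, hence Yamanouchi itself.
\<close>

lemma yamanouchi_pair_snd:
  assumes p: "p \<in> yamanouchi_pairs nu (shape T)"
  shows "snd p = canonical 0 (shape T)"
proof -
  have S: "is_tableau (snd p)" "shape (snd p) = shape T"
    using p by (auto simp: yamanouchi_pairs_def tableau_pairs_def)
  have "highest_weight {1..} (drop (length (reading_word (fst p))) (pair_word p))"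
    by (rule highest_weight_drop) (use p in \<open>simp add: yamanouchi_pairs_def\<close>)
  then have "highest_weight {1..} (reading_word (snd p))" by (simp add: pair_word_def)
  from yamanouchi_tableau[OF S(1) this] S(2) show ?thesis by simp
qed

text \<open>
  Column strictness of the companion is the Yamanouchi condition of \<open>U\<close>, its rows have length \<open>l\<close> because
  \<open>U\<close> contains each added letter \<open>l\<close> times, and the Yamanouchi condition of the pair is column strictness
  of \<open>U\<close>.
\<close>

lemma companion_exists:
  assumes l: "1 \<le> l" and U: "U \<in> lr_tableaux m l h T"
  shows "\<exists>p\<in>yamanouchi_pairs (rect l h) (shape T). companion U p"
proof -
  from U obtain a where tU: "is_tableau U" and rU: "\<And>i. row i U = row i T @ blocks m h (a i)"
    and cU: "\<And>j. j < h \<Longrightarrow> count_list (reading_word U) (Suc (m + j)) = l"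
    and yU: "\<And>j. Suc j < h \<Longrightarrow> free_hi (Suc (m + j)) (reading_word U) = 0"
    unfolding lr_tableaux_def add_strips_iff[OF T m] yamanouchi_iff by auto
  define b where "b j i = count_list (row i U) (Suc (m + j))" for i j
  \<comment> \<open>row \<open>j\<close> of the companion\<close>
  define r where "r j = blocks 0 (length U) (b j)" for j
  have bi: "b j i = 0" if "length U \<le> i" for i j using that by (simp add: b_def)
  have bj: "b j i = 0" if "h \<le> j" for i j
    using that T_row_le[of i] by (auto simp: b_def rU count_blocks count_list_0_iff)
  have cr: "count_list (r j) (Suc i) = b j i" for i j
    using bi by (simp add: r_def count_blocks)
  have r0: "0 \<notin> set (r j)" for j using set_blocks[of 0 "length U" "b j"] by (auto simp: r_def)
  have ler: "le_count (r j) x = (\<Sum>t<x. b j t)" for j x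
    using le_count_sum[of "r j" 0 x] le_count_0[OF r0] by (simp add: cr)
  have "\<exists>V. is_tableau V \<and> (\<forall>j. row j V = r j)"
  proof (rule tableau_of_rows[of r h])
    fix j x
    show "le_count (r (Suc j)) (Suc x) \<le> le_count (r j) x"
    proof (cases "Suc j < h")
      case True
      have sU: "\<forall>r\<in>set U. sorted r" using tU by (simp add: is_tableau_def)
      from yU[OF True] free_hi_reading[OF sU, of "Suc (m + j)" "[]"]
      have "(\<Sum>t<Suc x. b (Suc j) t) \<le> (\<Sum>t<x. b j t)" by (simp add: b_def)
      then show ?thesis by (simp only: ler)
    next
      case False
      then show ?thesis using bj[of "Suc j"] by (simp add: ler)
    qed
  qed (use r0 in \<open>auto simp: r_def sorted_blocks intro!: blocks_zero bj\<close>)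
  then obtain V where V: "is_tableau V" "\<And>j. row j V = r j" by blast
  have "length (row j V) = (if j < h then l else 0)" for j
  proof -
    have "length (row j V) = (\<Sum>i<length U. b j i)" by (simp add: V(2) r_def length_blocks)
    also have "\<dots> = (if j < h then l else 0)"
      using cU[of j] bj[of j] by (simp add: b_def count_reading)
    finally show ?thesis .
  qed
  then have sV: "shape V = rect l h" by (rule rect_shapeI[OF V(1) l])
  have "(\<Sum>t<Suc j. count_list (row t V) (Suc (Suc i))) + length (row (Suc i) T)
        \<le> (\<Sum>t<j. count_list (row t V) (Suc i)) + length (row i T)" for i j
  proof -
    have "le_count (row (Suc i) U) (m + Suc j) \<le> le_count (row i U) (m + j)"
      using tableau_interlacing[OF tU, of i "m + j"] by simp
    then have "length (row (Suc i) T) + (\<Sum>t<Suc j. b t (Suc i)) \<le> length (row i T) + (\<Sum>t<j. b t i)"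
      unfolding lr_le_count[OF rU] by (simp only: b_def)
    then show ?thesis by (simp only: V(2) cr add.commute)
  qed
  then have "highest_weight {1..} (reading_word V @ reading_word (canonical 0 (shape T)))"
    using pair_highest_iff[OF V(1)] by blast
  then have "(V, canonical 0 (shape T)) \<in> yamanouchi_pairs (rect l h) (shape T)"
    using V(1) sV T canonical_tableau[of "shape T" 0]
    by (simp add: yamanouchi_pairs_def tableau_pairs_def pair_word_def is_tableau_def[of T])
  moreover have "companion U (V, canonical 0 (shape T))"
    by (simp add: companion_def V(2) cr b_def)
  ultimately show ?thesis by blast
qed

text \<open>
  The same translation of conditions in the opposite direction; below level \<open>m\<close> the interlacing
  inequalities of \<open>U\<close> are those of \<open>T\<close>.
\<close>

lemma companion_exists_back:
  assumes p: "p \<in> yamanouchi_pairs (rect l h) (shape T)"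
  shows "\<exists>U\<in>lr_tableaux m l h T. companion U p"
proof -
  define V where "V = fst p"
  have V: "is_tableau V" "shape V = rect l h"
    using p by (auto simp: yamanouchi_pairs_def tableau_pairs_def V_def)
  have "highest_weight {1..} (reading_word V @ reading_word (canonical 0 (shape T)))"
    using p yamanouchi_pair_snd[OF p] by (simp add: yamanouchi_pairs_def pair_word_def V_def)
  then have dom: "(\<Sum>t<Suc j. count_list (row t V) (Suc (Suc i))) + length (row (Suc i) T)
        \<le> (\<Sum>t<j. count_list (row t V) (Suc i)) + length (row i T)" for i j
    using pair_highest_iff[OF V(1)] by blast
  have lV: "length V = h" using V(2) by (metis length_map length_replicate rect_def shape_def)
  have len: "length (row j V) = l" if "j < h" for j
    using V(2) that lV unfolding shape_def rect_def by (metis length_map nth_map nth_replicate row_less)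
  define b where "b j i = count_list (row j V) (Suc i)" for i j
  define B where "B = Max (insert 0 (set (reading_word V)))"
  have B: "y \<le> B" if "y \<in> set (row j V)" for y j
    unfolding B_def using that row_subset[of j V] by (intro Max_ge) auto
  have bi: "b j i = 0" if "B \<le> i" for i j
    using that B[of "Suc i" j] by (auto simp: b_def count_list_0_iff)
  have bj: "b j i = 0" if "h \<le> j" for i j using that lV by (simp add: b_def)
  have leV: "le_count (row j V) x = (\<Sum>t<x. b j t)" for j x
    using le_count_sum[of "row j V" 0 x] le_count_0 tableau_row[OF V(1)] by (simp add: b_def)
  \<comment> \<open>row \<open>i\<close> of the tableau with companion \<open>V\<close>\<close>
  define r where "r i = row i T @ blocks m h (\<lambda>j. b j i)" for i
  have cr: "count_list (r i) (Suc (m + j)) = b j i" for i j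
  proof -
    have "Suc (m + j) \<notin> set (row i T)" using T_row_le[of i] by auto
    then show ?thesis using bj[of j i] by (simp add: r_def count_blocks count_list_0_iff)
  qed
  have ler: "le_count (r i) (m + j) = length (row i T) + (\<Sum>t<j. b t i)" for i j
    unfolding le_count_sum cr using le_count_all[OF T_row_le] le_count_blocks[of m m h]
    by (simp add: r_def)
  have "\<exists>U. is_tableau U \<and> (\<forall>i. row i U = r i)"
  proof (rule tableau_of_rows[of r "max (length T) B"])
    fix i
    show "sorted (r i)"
      using tableau_row[OF T, of i] sorted_blocks[of m h] set_blocks[of m h "\<lambda>j. b j i"] T_row_le[of i]
      by (fastforce simp: r_def sorted_append)
    show "0 \<notin> set (r i)"
      using tableau_row[OF T, of i] set_blocks[of m h "\<lambda>j. b j i"] by (auto simp: r_def)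
    show "r i = []" if "max (length T) B \<le> i"
      using that bi[of i] by (simp add: r_def blocks_zero)
    fix x
    show "le_count (r (Suc i)) (Suc x) \<le> le_count (r i) x"
    proof (cases "Suc x \<le> m")
      case True
      then show ?thesis using tableau_interlacing[OF T, of i x] by (simp add: r_def le_count_blocks)
    next
      case False
      then obtain j where j: "x = m + j" by (metis le_Suc_ex not_less_eq_eq)
      show ?thesis using dom[of i j] ler[of "Suc i" "Suc j"] ler[of i j]
        unfolding j by (simp add: b_def)
    qed
  qed
  then obtain U where U: "is_tableau U" "\<And>i. row i U = r i" by blast
  have "count_list (reading_word U) (Suc (m + j)) = l" if j: "j < h" for j
  proof -
    define N where "N = max (length U) B"
    have "count_list (reading_word U) (Suc (m + j)) = (\<Sum>i<N. b j i)"
      by (subst count_reading_ge[of _ N]) (simp_all add: N_def U(2) cr)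
    also have "\<dots> = le_count (row j V) N" by (rule leV[symmetric])
    also have "\<dots> = length (row j V)" using B[of _ j] by (intro le_count_all) (auto simp: N_def le_max_iff_disj)
    finally show ?thesis using len[OF j] by simp
  qed
  moreover have "free_hi (Suc (m + j)) (reading_word U) = 0" for j
  proof -
    have sU: "\<forall>r\<in>set U. sorted r" using U(1) by (simp add: is_tableau_def)
    have "(\<Sum>t<Suc i. b (Suc j) t) \<le> (\<Sum>t<i. b j t)" for i
      using tableau_interlacing[OF V(1), of j i] unfolding leV .
    moreover have "count_list (row t U) (Suc (Suc (m + j))) = b (Suc j) t" for t
      using cr[of t "Suc j"] by (simp add: U(2))
    moreover have "count_list (row t U) (Suc (m + j)) = b j t" for t
      by (simp add: U(2) cr)
    ultimately show ?thesis
      using free_hi_reading[OF sU, of "Suc (m + j)" "[]"] by (simp del: sum.lessThan_Suc)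
  qed
  ultimately have "U \<in> lr_tableaux m l h T"
    unfolding lr_tableaux_def add_strips_iff[OF T m] yamanouchi_iff using U
    by (auto simp: r_def intro!: exI[of _ "\<lambda>i j. b j i"])
  moreover have "companion U p" by (simp add: companion_def U(2) cr b_def V_def)
  ultimately show ?thesis by blast
qed

text \<open>
  Row \<open>i\<close> of \<open>U\<close> is row \<open>i\<close> of \<open>T\<close> followed by one cell for each letter \<open>i + 1\<close> of the companion, and the
  shape of a Yamanouchi word is its evaluation.
\<close>

lemma companion_shape:
  assumes U: "U \<in> lr_tableaux m l h T" and p: "p \<in> yamanouchi_pairs (rect l h) (shape T)" and c: "companion U p"
  shows "shape U = shape (P_tab (pair_word p))"
proof -
  from U obtain a where tU: "is_tableau U" and rU: "\<And>i. row i U = row i T @ blocks m h (a i)"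
    unfolding lr_tableaux_def add_strips_iff[OF T m] by auto
  have tp: "p \<in> tableau_pairs (rect l h) (shape T)" and hw: "highest_weight {1..} (pair_word p)"
    using p by (auto simp: yamanouchi_pairs_def)
  have z: "0 \<notin> set (pair_word p)" by (rule pair_word_no_zero[OF tp])
  have lV: "length (fst p) = h"
  proof -
    have "shape (fst p) = rect l h" using tp by (auto simp: tableau_pairs_def)
    then show ?thesis by (metis length_map length_replicate rect_def shape_def)
  qed
  show ?thesis
  proof (rule shape_eqI[OF tU P_tab(1)[OF z]])
    fix i
    have "\<forall>y\<in>set (row i U). y \<le> m + h"
      using T_row_le[of i] set_blocks[of m h "a i"] by (fastforce simp: rU)
    then have "length (row i U) = le_count (row i U) (m + h)" by (simp add: le_count_all)
    also have "\<dots> = length (row i T) + (\<Sum>t<h. count_list (row t (fst p)) (Suc i))"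
      unfolding lr_le_count[OF rU] using c by (simp add: companion_def)
    also have "\<dots> = count_list (pair_word p) (Suc i)"
      by (simp add: pair_word_def count_reading[of "fst p"] lV yamanouchi_pair_snd[OF p] count_canonical_row)
    also have "\<dots> = length (row i (P_tab (pair_word p)))"
      by (rule yamanouchi_P_row_length[OF hw z, symmetric])
    finally show "length (row i U) = length (row i (P_tab (pair_word p)))" .
  qed
qed

lemma companion_bij:
  assumes l: "1 \<le> l"
  shows "\<exists>f. bij_betw f (lr_tableaux m l h T) (yamanouchi_pairs (rect l h) (shape T)) \<and>
     (\<forall>U\<in>lr_tableaux m l h T. companion U (f U))"
proof (rule bij_betw_from_relation)
  fix U p p'
  assume h: "p \<in> yamanouchi_pairs (rect l h) (shape T)" "p' \<in> yamanouchi_pairs (rect l h) (shape T)"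
    "companion U p" "companion U p'"
  have t: "is_tableau (fst p)" "is_tableau (fst p')"
    using h(1,2) by (auto simp: yamanouchi_pairs_def tableau_pairs_def)
  have "fst p = fst p'"
  proof (rule tableau_eqI_rows[OF t])
    fix j
    show "row j (fst p) = row j (fst p')"
    proof (rule sorted_eqI_count)
      fix y
      show "count_list (row j (fst p)) y = count_list (row j (fst p')) y"
        using h(3,4) tableau_row[OF t(1), of j] tableau_row[OF t(2), of j]
        by (cases y) (auto simp: companion_def count_list_0_iff)
    qed (use tableau_row t in auto)
  qed
  then show "p = p'" using yamanouchi_pair_snd[OF h(1)] yamanouchi_pair_snd[OF h(2)] by (simp add: prod_eq_iff)
next
  fix U U' p
  assume h: "U \<in> lr_tableaux m l h T" "U' \<in> lr_tableaux m l h T" "companion U p" "companion U' p"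
  from h(1) obtain a where tU: "is_tableau U" and rU: "\<And>i. row i U = row i T @ blocks m h (a i)"
    unfolding lr_tableaux_def add_strips_iff[OF T m] by auto
  from h(2) obtain a' where tU': "is_tableau U'" and rU': "\<And>i. row i U' = row i T @ blocks m h (a' i)"
    unfolding lr_tableaux_def add_strips_iff[OF T m] by auto
  show "U = U'"
  proof (rule tableau_eqI_rows[OF tU tU'])
    fix i
    show "row i U = row i U'"
    proof (rule sorted_eqI_count)
      fix y
      show "count_list (row i U) y = count_list (row i U') y"
      proof (cases "y \<le> m")
        case True
        then show ?thesis by (simp add: rU rU' count_blocks)
      next
        case False
        then obtain j where "y = Suc (m + j)" by (metis less_iff_Suc_add not_le)
        then show ?thesis using h(3,4) by (simp add: companion_def)
      qed
    qed (use tableau_row tU tU' in auto)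
  qed
qed (use companion_exists[OF l] companion_exists_back in blast)+

text \<open>
  The components of the set of words of pairs are counted by Yamanouchi pairs, and these are in bijection
  with Littlewood--Richardson tableaux by companions.
\<close>

theorem littlewood_richardson:
  assumes l: "1 \<le> l"
  shows "(\<Sum>U\<in>lr_tableaux m l h T. schur (shape U) M) =
    (series_mult (schur (rect l h)) (schur (shape T)) M :: 'c::comm_semiring_1)"
proof -
  let ?Y = "yamanouchi_pairs (rect l h) (shape T)"
  obtain f where f: "bij_betw f (lr_tableaux m l h T) ?Y" "\<forall>U\<in>lr_tableaux m l h T. companion U (f U)"
    using companion_bij[OF l] by blast
  have fin: "finite ?Y" using bij_betw_finite[OF f(1)] finite_lr_tableaux by simp
  have "(\<Sum>U\<in>lr_tableaux m l h T. card (tableaux (shape U) M)) =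
     (\<Sum>U\<in>lr_tableaux m l h T. card (tableaux (shape (P_tab (pair_word (f U)))) M))"
  proof (rule sum.cong[OF refl])
    fix U assume U: "U \<in> lr_tableaux m l h T"
    have "f U \<in> ?Y" using f(1) U bij_betwE by blast
    then have "shape U = shape (P_tab (pair_word (f U)))"
      using companion_shape[OF U _ f(2)[rule_format, OF U]] by blast
    then show "card (tableaux (shape U) M) = card (tableaux (shape (P_tab (pair_word (f U)))) M)" by simp
  qed
  also have "\<dots> = (\<Sum>p\<in>?Y. card (tableaux (shape (P_tab (pair_word p))) M))"
    by (rule sum.reindex_bij_betw[OF f(1)])
  also have "\<dots> = card {p \<in> tableau_pairs (rect l h) (shape T). mset (pair_word p) = M}"
    by (rule pairs_by_components[OF fin, symmetric])
  finally have "(of_nat (\<Sum>U\<in>lr_tableaux m l h T. card (tableaux (shape U) M)) :: 'c) =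
      of_nat (card {p \<in> tableau_pairs (rect l h) (shape T). mset (pair_word p) = M})" by simp
  then show ?thesis by (simp add: series_mult_schur schur_tableaux)
qed

end

section \<open>The symmetric group action\<close>

text \<open>
  The positions in the stack, last one first, cut the word into completely cancelled pieces.  Nothing is
  required of the letters at these positions, so that the relation survives every change of them.
\<close>

inductive bracketing :: "nat \<Rightarrow> nat list \<Rightarrow> nat list \<Rightarrow> bool" for i where
  bracketing_base: "free_lo i b = 0 \<Longrightarrow> free_hi i b = 0 \<Longrightarrow> bracketing i b []"
| bracketing_step: "bracketing i w stk \<Longrightarrow> free_lo i b = 0 \<Longrightarrow> free_hi i b = 0 \<Longrightarrow>
    bracketing i (w @ y # b) (length w # stk)"

lemma bracketing_extend:
  assumes "bracketing i w stk" "free_lo i c = 0" "free_hi i c = 0"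
  shows "bracketing i (w @ c) stk"
  using assms(1)
proof cases
  case bracketing_base
  with assms(2,3) show ?thesis by (auto intro!: bracketing.bracketing_base simp: free_lo_append free_hi_append)
next
  case (bracketing_step w0 stk0 b y)
  have "bracketing i (w0 @ y # (b @ c)) (length w0 # stk0)"
    by (rule bracketing.bracketing_step) (use bracketing_step assms(2,3) in \<open>auto simp: free_lo_append free_hi_append\<close>)
  with bracketing_step show ?thesis by simp
qed

lemma bracketing_less: "bracketing i w stk \<Longrightarrow> p \<in> set stk \<Longrightarrow> p < length w"
  by (induction rule: bracketing.induct) auto

lemma bracketing_distinct: "bracketing i w stk \<Longrightarrow> distinct stk"
  by (induction rule: bracketing.induct) (auto dest: bracketing_less)

lemma bracketing_update: "bracketing i w stk \<Longrightarrow> p \<in> set stk \<Longrightarrow> bracketing i (w[p := z]) stk"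
proof (induction rule: bracketing.induct)
  case (bracketing_step w stk b y)
  show ?case
  proof (cases "p = length w")
    case True
    then show ?thesis using bracketing.bracketing_step[OF bracketing_step(1-3), of z] by simp
  next
    case False
    with bracketing_step.prems have p: "p \<in> set stk" by simp
    then have "p < length w" using bracketing_less[OF bracketing_step(1)] by simp
    then show ?thesis
      using bracketing.bracketing_step[OF bracketing_step.IH[OF p] bracketing_step(2,3), of y]
      by (simp add: list_update_append)
  qed
qed simp

text \<open>
  The letters at the positions of the stack, last one first, when no factor \<open>(i + 1) i\<close> is left among
  them.
\<close>

definition pattern :: "nat \<Rightarrow> nat list \<Rightarrow> nat list \<Rightarrow> nat \<Rightarrow> nat \<Rightarrow> bool" where
  "pattern i w stk a c \<longleftrightarrow> map ((!) w) stk = replicate a (Suc i) @ replicate c i"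

lemma bracketing_map_nth:
  "bracketing i w stk \<Longrightarrow> map ((!) (w @ z)) stk = map ((!) w) stk"
  using bracketing_less[of i w stk] by (auto simp: nth_append)

lemma bracketing_free:
  "bracketing i w stk \<Longrightarrow> pattern i w stk a c \<Longrightarrow> free_hi i w = a \<and> free_lo i w = c"
proof (induction arbitrary: a c rule: bracketing.induct)
  case (bracketing_base b)
  then show ?case by (simp add: pattern_def)
next
  case (bracketing_step w stk b y)
  have m: "y # map ((!) w) stk = replicate a (Suc i) @ replicate c i"
    using bracketing_step.prems bracketing_map_nth[OF bracketing_step(1), of "y # b"] by (simp add: pattern_def)
  show ?case
  proof (cases a)
    case (Suc a')
    with m have "y = Suc i" "pattern i w stk a' c" by (simp_all add: pattern_def)
    with bracketing_step.IH[of a' c] bracketing_step(2,3) Suc show ?thesis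
      by (simp add: free_lo_append free_hi_append)
  next
    case 0
    with m obtain c' where c': "c = Suc c'" by (cases c) auto
    with m 0 have "y = i" "pattern i w stk 0 c'" by (simp_all add: pattern_def)
    with bracketing_step.IH[of 0 c'] bracketing_step(2,3) 0 c' show ?thesis
      by (simp add: free_lo_append free_hi_append)
  qed
qed

lemma crystal_step_extend:
  assumes "crystal_step x w w'" "free_lo x z = 0"
  shows "crystal_step x (w @ z) (w' @ z)"
proof -
  obtain u v where uv: "w = u @ x # v" "w' = u @ Suc x # v" "free_hi x u = 0" "free_lo x v = 0"
    by (rule crystal_stepE[OF assms(1)])
  then have "free_lo x (v @ z) = 0" using assms(2) by (simp add: free_lo_append)
  with uv crystal_step.intros[of x u "v @ z"] show ?thesis by simp
qed

text \<open>
  A crystal step changes the last free letter \<open>i\<close>, which is the topmost \<open>i\<close> of the stack.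
\<close>

lemma bracketing_crystal_step:
  "bracketing i w stk \<Longrightarrow> pattern i w stk a (Suc c) \<Longrightarrow> crystal_step i w (w[stk ! a := Suc i])"
proof (induction arbitrary: a rule: bracketing.induct)
  case (bracketing_base b)
  then show ?case by (simp add: pattern_def)
next
  case (bracketing_step w stk b y)
  have m: "y # map ((!) w) stk = replicate a (Suc i) @ replicate (Suc c) i"
    using bracketing_step.prems bracketing_map_nth[OF bracketing_step(1), of "y # b"] by (simp add: pattern_def)
  show ?case
  proof (cases a)
    case (Suc a')
    with m have y: "y = Suc i" and p: "pattern i w stk a' (Suc c)" by (simp_all add: pattern_def)
    have "length stk = a' + Suc c" using p unfolding pattern_def by (metis length_append length_map length_replicate)
    then have "stk ! a' < length w" using bracketing_less[OF bracketing_step(1)] by simp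
    moreover have "crystal_step i (w @ y # b) (w[stk ! a' := Suc i] @ y # b)"
      by (rule crystal_step_extend[OF bracketing_step.IH[OF p]]) (simp add: y bracketing_step(2))
    ultimately show ?thesis by (simp add: Suc list_update_append)
  next
    case 0
    with m have y: "y = i" and p: "pattern i w stk 0 c" by (simp_all add: pattern_def)
    from bracketing_free[OF bracketing_step(1) p] have "free_hi i w = 0" by simp
    with crystal_step.intros[of i w b] bracketing_step(2) show ?thesis by (simp add: 0 y)
  qed
qed

definition agree_off :: "nat set \<Rightarrow> nat list \<Rightarrow> nat list \<Rightarrow> bool" where
  "agree_off A u v \<longleftrightarrow> length u = length v \<and> (\<forall>p. p < length u \<longrightarrow> p \<notin> A \<longrightarrow> u ! p = v ! p)"

lemma pattern_unique:
  assumes "pattern i u stk a c" "pattern i v stk a c" "agree_off (set stk) u v"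
  shows "u = v"
proof (rule nth_equalityI)
  fix p assume "p < length u"
  have "map ((!) u) stk = map ((!) v) stk" using assms(1,2) by (simp add: pattern_def)
  then have "\<forall>q\<in>set stk. u ! q = v ! q" by simp
  with assms(3) \<open>p < length u\<close> show "u ! p = v ! p" by (cases "p \<in> set stk") (auto simp: agree_off_def)
qed (use assms(3) in \<open>simp add: agree_off_def\<close>)

lemma pattern_update:
  assumes "bracketing i w stk" "pattern i w stk a (Suc c)"
  shows "pattern i (w[stk ! a := Suc i]) stk (Suc a) c"
proof -
  have len: "length stk = a + Suc c"
    using assms(2) unfolding pattern_def by (metis length_append length_map length_replicate)
  have "map ((!) (w[stk ! a := Suc i])) stk = (map ((!) w) stk)[a := Suc i]"
  proof (rule nth_equalityI)
    fix j assume "j < length (map ((!) (w[stk ! a := Suc i])) stk)"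
    then have j: "j < length stk" by simp
    have "stk ! j < length w" using bracketing_less[OF assms(1)] j by simp
    moreover have "stk ! j = stk ! a \<longleftrightarrow> j = a"
      using bracketing_distinct[OF assms(1)] j len by (simp add: nth_eq_iff_index_eq)
    ultimately show "map ((!) (w[stk ! a := Suc i])) stk ! j = (map ((!) w) stk)[a := Suc i] ! j"
      using j by (auto simp: nth_list_update)
  qed simp
  also have "\<dots> = replicate (Suc a) (Suc i) @ replicate c i"
    using assms(2) by (simp add: pattern_def list_update_append replicate_app_Cons_same)
  finally show ?thesis by (simp add: pattern_def)
qed

lemma bracketing_crystal_power:
  assumes "bracketing i w stk" "pattern i w stk a (t + c)"
  shows "\<exists>v. (crystal_step i ^^ t) w v \<and> bracketing i v stk \<and> pattern i v stk (a + t) c \<and> agree_off (set stk) w v"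
  using assms(2)
proof (induction t arbitrary: c)
  case 0
  then show ?case using assms(1) by (auto simp: agree_off_def)
next
  case (Suc t)
  then have "pattern i w stk a (t + Suc c)" by simp
  from Suc.IH[OF this] obtain v where
    v: "(crystal_step i ^^ t) w v" "bracketing i v stk" "pattern i v stk (a + t) (Suc c)"
      "agree_off (set stk) w v" by blast
  let ?v = "v[stk ! (a + t) := Suc i]"
  have "a + t < length stk"
    using v(3) unfolding pattern_def by (metis length_append length_map length_replicate less_add_Suc1 add_Suc_right)
  then have p: "stk ! (a + t) \<in> set stk" by simp
  have "agree_off (set stk) w ?v" using v(4) p by (simp add: agree_off_def) (metis nth_list_update_neq)
  moreover have "(crystal_step i ^^ Suc t) w ?v"
    using v(1) bracketing_crystal_step[OF v(2,3)] by (rule relpowp_Suc_I)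
  ultimately show ?case
    using bracketing_update[OF v(2) p] pattern_update[OF v(2,3)] by auto
qed

text \<open>
  A letter \<open>i\<close> that meets \<open>i + 1\<close> on top of the stack closes a bracket, and the two adjacent pieces merge
  into one; every other relevant letter starts a new piece.
\<close>

lemma bracketing_scan:
  fixes w :: "nat list" and i :: nat
  assumes "n \<le> length w"
  defines "stk \<equiv> foldl (push_letter w i) [] (filter (\<lambda>p. w ! p = i \<or> w ! p = Suc i) [0..<n])"
  shows "bracketing i (take n w) stk \<and> (\<exists>a c. pattern i w stk a c)"
  using assms(1) unfolding stk_def
proof (induction n)
  case 0
  then show ?case by (auto simp: pattern_def intro!: bracketing_base exI[of _ 0])
next
  case (Suc n)
  define stk where "stk = foldl (push_letter w i) [] (filter (\<lambda>p. w ! p = i \<or> w ! p = Suc i) [0..<n])"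
  have IH: "bracketing i (take n w) stk" "\<exists>a c. pattern i w stk a c"
    using Suc unfolding stk_def by auto
  then obtain a c where pat: "pattern i w stk a c" by blast
  have tk: "take (Suc n) w = take n w @ [w ! n]" "length (take n w) = n"
    using Suc.prems by (auto simp: take_Suc_conv_app_nth)
  show ?case
  proof (cases "w ! n = i \<or> w ! n = Suc i")
    case False
    then have "bracketing i (take n w @ [w ! n]) stk"
      by (intro bracketing_extend[OF IH(1)]) auto
    then show ?thesis using False pat unfolding tk(1) stk_def by auto
  next
    case True
    have goal: "bracketing i (take n w @ [w ! n]) (push_letter w i stk n) \<and>
       (\<exists>a c. pattern i w (push_letter w i stk n) a c)"
    proof (cases "\<exists>p ps. stk = p # ps \<and> w ! p = Suc i \<and> w ! n = i")
      case True
      then obtain p ps where p: "stk = p # ps" "w ! p = Suc i" "w ! n = i" by blast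
      from IH(1)[unfolded p(1)] obtain w0 b y where
        w0: "take n w = w0 @ y # b" "p = length w0" "bracketing i w0 ps" "free_lo i b = 0" "free_hi i b = 0"
        by cases auto
      have "p < n" using bracketing_less[OF IH(1), of p] p(1) tk(2) by simp
      then have "take n w ! p = w ! p" by simp
      then have y: "y = Suc i" using w0(1,2) p(2) by simp
      have "bracketing i (w0 @ (Suc i # b @ [i])) ps"
        by (rule bracketing_extend[OF w0(3)]) (use w0(4,5) in \<open>simp_all add: free_lo_append free_hi_append\<close>)
      then have "bracketing i (take n w @ [w ! n]) ps" by (simp add: w0(1) y p(3))
      moreover have "pattern i w ps (a - 1) c"
        using pat p(1,2) by (cases a; cases c) (auto simp: pattern_def)
      ultimately show ?thesis using p by (auto simp: push_letter_def)
    next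
      case False
      then have push: "push_letter w i stk n = n # stk"
        by (auto simp: push_letter_def split: list.splits)
      have "bracketing i (take n w @ w ! n # []) (length (take n w) # stk)"
        by (rule bracketing_step[OF IH(1)]) simp_all
      moreover have "\<exists>a c. pattern i w (n # stk) a c"
      proof (cases "w ! n = Suc i")
        case True
        with pat show ?thesis by (intro exI[of _ "Suc a"] exI[of _ c]) (simp add: pattern_def)
      next
        case False
        with \<open>w ! n = i \<or> w ! n = Suc i\<close> have wn: "w ! n = i" by simp
        have "a = 0"
        proof (rule ccontr)
          assume "a \<noteq> 0"
          then obtain a' where "a = Suc a'" by (cases a) auto
          with pat obtain p ps where "stk = p # ps" "w ! p = Suc i" by (cases stk) (auto simp: pattern_def)
          with wn \<open>\<nexists>p ps. stk = p # ps \<and> w ! p = Suc i \<and> w ! n = i\<close> show False by blast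
        qed
        with pat wn show ?thesis by (intro exI[of _ 0] exI[of _ "Suc c"]) (simp add: pattern_def)
      qed
      ultimately show ?thesis unfolding push tk(2) by simp
    qed
    then show ?thesis using True unfolding tk(1) stk_def by simp
  qed
qed

lemma foldl_update_nth:
  fixes g :: "nat \<Rightarrow> 'a"
  assumes "distinct U" "\<forall>p\<in>set U. p < length w" "k \<le> length U"
  defines "v \<equiv> foldl (\<lambda>v j. v[U ! j := g j]) w [0..<k]"
  shows "length v = length w \<and> (\<forall>j<k. v ! (U ! j) = g j) \<and>
     (\<forall>p. p < length w \<longrightarrow> p \<notin> set (take k U) \<longrightarrow> v ! p = w ! p)"
  using assms(3) unfolding v_def
proof (induction k)
  case (Suc k)
  define v where "v = foldl (\<lambda>v j. v[U ! j := g j]) w [0..<k]"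
  have IH: "length v = length w" "\<forall>j<k. v ! (U ! j) = g j"
     "\<forall>p. p < length w \<longrightarrow> p \<notin> set (take k U) \<longrightarrow> v ! p = w ! p"
    using Suc unfolding v_def by auto
  have k: "k < length U" using Suc.prems by simp
  have "U ! j \<noteq> U ! k" if "j < k" for j
    using assms(1) k that by (simp add: nth_eq_iff_index_eq)
  moreover have "U ! k < length w" using assms(2) k by simp
  moreover have "take (Suc k) U = take k U @ [U ! k]" using k by (simp add: take_Suc_conv_app_nth)
  ultimately show ?case
    using IH unfolding v_def[symmetric] by (simp add: v_def[symmetric] nth_list_update less_Suc_eq) metis
qed simp

lemma relpowp_det:
  fixes R :: "'a \<Rightarrow> 'a \<Rightarrow> bool"
  assumes "\<And>x y z. R x y \<Longrightarrow> R x z \<Longrightarrow> y = z"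
  shows "(R ^^ n) x y \<Longrightarrow> (R ^^ n) x z \<Longrightarrow> y = z"
proof (induction n arbitrary: y z)
  case (Suc n)
  from Suc.prems obtain y' z' where "(R ^^ n) x y'" "R y' y" "(R ^^ n) x z'" "R z' z"
    by (auto elim!: relpowp_Suc_E)
  with Suc.IH[of y' z'] assms show ?case by blast
qed simp

lemma relpowp_inj:
  fixes R :: "'a \<Rightarrow> 'a \<Rightarrow> bool"
  assumes "\<And>x y z. R y x \<Longrightarrow> R z x \<Longrightarrow> y = z"
  shows "(R ^^ n) y x \<Longrightarrow> (R ^^ n) z x \<Longrightarrow> y = z"
proof (induction n arbitrary: x)
  case (Suc n)
  from Suc.prems obtain y' z' where h: "(R ^^ n) y y'" "R y' x" "(R ^^ n) z z'" "R z' x"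
    by (auto elim!: relpowp_Suc_E)
  then have "y' = z'" using assms by blast
  with Suc.IH h show ?case by blast
qed simp

lemma crystal_power_facts:
  "(crystal_step i ^^ t) w z \<Longrightarrow>
     free_lo i w = free_lo i z + t \<and> free_hi i z = free_hi i w + t \<and>
     count_list w i = count_list z i + t \<and> count_list z (Suc i) = count_list w (Suc i) + t \<and>
     (\<forall>y. y \<noteq> i \<longrightarrow> y \<noteq> Suc i \<longrightarrow> count_list z y = count_list w y) \<and>
     (1 \<le> i \<longrightarrow> crystal_conn {1..} w z)"
proof (induction t arbitrary: z)
  case (Suc t)
  from Suc.prems obtain v where v: "(crystal_step i ^^ t) w v" "crystal_step i v z"
    by (auto elim!: relpowp_Suc_E)
  have "count_list v i = Suc (count_list z i) \<and> count_list z (Suc i) = Suc (count_list v (Suc i)) \<and>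
     (\<forall>y. y \<noteq> i \<longrightarrow> y \<noteq> Suc i \<longrightarrow> count_list z y = count_list v y)"
    by (rule crystal_stepE[OF v(2)]) simp
  moreover have "1 \<le> i \<longrightarrow> crystal_conn {1..} w v \<longrightarrow> crystal_conn {1..} w z"
    using conn_step[of i "{1..}" v z] v(2) conn_trans by (meson atLeast_iff)
  ultimately show ?case
    using Suc.IH[OF v(1)] crystal_step_lo_pos[OF v(2)] crystal_step_hi_pos[OF v(2)] by simp
qed simp

text \<open>
  The word \<open>\<sigma>\<^sub>i w\<close> has the bracketing of \<open>w\<close> with the numbers of free letters \<open>i\<close> and \<open>i + 1\<close> exchanged.  The
  words with this bracketing and a given number of free letters form one string of crystal steps.
\<close>

lemma sigma_power:
  fixes w :: "nat list" and i :: nat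
  defines "r \<equiv> free_lo i w" and "s \<equiv> free_hi i w"
  shows "s \<le> r \<longrightarrow> (crystal_step i ^^ (r - s)) w (sigma i w)"
    and "r \<le> s \<longrightarrow> (crystal_step i ^^ (s - r)) (sigma i w) w"
proof -
  define stk where "stk = foldl (push_letter w i) [] (filter (\<lambda>p. w ! p = i \<or> w ! p = Suc i) [0..<length w])"
  have br: "bracketing i w stk" and "\<exists>a c. pattern i w stk a c"
    using bracketing_scan[of "length w" w i] by (simp_all add: stk_def)
  then obtain a c where "pattern i w stk a c" by blast
  with bracketing_free[OF br] have pat: "pattern i w stk s r" by (simp add: r_def s_def)
  define U where "U = rev stk"
  have len: "length stk = s + r"
    using pat unfolding pattern_def by (metis length_append length_map length_replicate)
  have "length (filter (\<lambda>p. w ! p = Suc i) U) = length (filter (\<lambda>y. y = Suc i) (map ((!) w) stk))"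
    by (simp add: U_def filter_map comp_def rev_filter[symmetric])
  also have "\<dots> = s" using pat by (simp add: pattern_def)
  finally have sU: "length (filter (\<lambda>p. w ! p = Suc i) U) = s" .
  define g where "g j = (if j < s then i else Suc i)" for j :: nat
  define v where "v = foldl (\<lambda>v j. v[U ! j := g j]) w [0..<length U]"
  have sig: "sigma i w = v"
    by (simp add: sigma_def Let_def unpaired_def flip: stk_def U_def) (simp add: sU v_def g_def)
  have U: "distinct U" "\<forall>p\<in>set U. p < length w"
    using bracketing_distinct[OF br] bracketing_less[OF br] by (simp_all add: U_def)
  have v: "length v = length w" "\<forall>j<length U. v ! (U ! j) = g j"
     "\<forall>p. p < length w \<longrightarrow> p \<notin> set U \<longrightarrow> v ! p = w ! p"
    using foldl_update_nth[OF U, of "length U" g] unfolding v_def by auto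
  have agree: "agree_off (set stk) w v" using v(1,3) by (simp add: agree_off_def U_def)
  have patv: "pattern i v stk r s"
    unfolding pattern_def
  proof (rule nth_equalityI)
    fix j assume "j < length (map ((!) v) stk)"
    then have j: "j < s + r" using len by simp
    have "stk ! j = U ! (s + r - Suc j)" using j len by (simp add: U_def rev_nth)
    then have "v ! (stk ! j) = g (s + r - Suc j)" using v(2) j len by (simp add: U_def)
    also have "\<dots> = (replicate r (Suc i) @ replicate s i) ! j"
      using j by (auto simp: g_def nth_append)
    finally show "map ((!) v) stk ! j = (replicate r (Suc i) @ replicate s i) ! j" using j len by simp
  qed (simp add: len)
  have "bracketing i (foldl (\<lambda>v j. v[U ! j := g j]) w [0..<k]) stk" if "k \<le> length U" for k
    using that
  proof (induction k)
    case (Suc k)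
    then have "U ! k \<in> set stk" using nth_mem[of k U] by (simp add: U_def)
    with Suc show ?case by (simp add: bracketing_update)
  qed (simp add: br)
  then have brv: "bracketing i v stk" by (simp add: v_def)
  show "s \<le> r \<longrightarrow> (crystal_step i ^^ (r - s)) w (sigma i w)"
  proof
    assume le: "s \<le> r"
    with pat have "pattern i w stk s ((r - s) + s)" by simp
    from bracketing_crystal_power[OF br this] obtain z where
      z: "(crystal_step i ^^ (r - s)) w z" "pattern i z stk r s" "agree_off (set stk) w z" using le by auto
    have "agree_off (set stk) z v" using agree z(3) by (simp add: agree_off_def)
    then have "z = v" by (rule pattern_unique[OF z(2) patv])
    with z(1) show "(crystal_step i ^^ (r - s)) w (sigma i w)" by (simp add: sig)
  qed
  show "r \<le> s \<longrightarrow> (crystal_step i ^^ (s - r)) (sigma i w) w"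
  proof
    assume le: "r \<le> s"
    with patv have "pattern i v stk r ((s - r) + r)" by simp
    from bracketing_crystal_power[OF brv this] obtain z where
      z: "(crystal_step i ^^ (s - r)) v z" "pattern i z stk s r" "agree_off (set stk) v z" using le by auto
    have "agree_off (set stk) z w" using agree z(3) by (simp add: agree_off_def)
    then have "z = w" by (rule pattern_unique[OF z(2) pat])
    with z(1) show "(crystal_step i ^^ (s - r)) (sigma i w) w" by (simp add: sig)
  qed
qed

lemma sigma_free_conn:
  "free_lo i (sigma i w) = free_hi i w \<and> free_hi i (sigma i w) = free_lo i w \<and>
     (1 \<le> i \<longrightarrow> crystal_conn {1..} w (sigma i w))"
proof (cases "free_hi i w \<le> free_lo i w")
  case True
  then have "(crystal_step i ^^ (free_lo i w - free_hi i w)) w (sigma i w)" using sigma_power(1) by blast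
  from crystal_power_facts[OF this] True show ?thesis by auto
next
  case False
  then have "(crystal_step i ^^ (free_hi i w - free_lo i w)) (sigma i w) w" using sigma_power(2) by simp
  from crystal_power_facts[OF this] False show ?thesis by (auto intro: conn_sym)
qed

lemma sigma_free: "free_lo i (sigma i w) = free_hi i w" "free_hi i (sigma i w) = free_lo i w"
  using sigma_free_conn by blast+

lemma sigma_conn: "1 \<le> i \<Longrightarrow> crystal_conn {1..} w (sigma i w)"
  using sigma_free_conn by blast

lemma count_sigma:
  "count_list (sigma i w) y =
     (if y = i then count_list w (Suc i) else if y = Suc i then count_list w i else count_list w y)"
proof (cases "free_hi i w \<le> free_lo i w")
  case True
  then have "(crystal_step i ^^ (free_lo i w - free_hi i w)) w (sigma i w)" using sigma_power(1) by blast
  from crystal_power_facts[OF this] free_count[of w i] True show ?thesis by auto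
next
  case False
  then have "(crystal_step i ^^ (free_hi i w - free_lo i w)) (sigma i w) w" using sigma_power(2) by simp
  from crystal_power_facts[OF this] free_count[of w i] False show ?thesis by auto
qed

text \<open>
  The free letters of the image tell in which direction and how far to go back along the string.
\<close>

lemma sigma_inj: 
  assumes "sigma i w = sigma i w'"
  shows "w = w'"
proof -
  have lo: "free_lo i w = free_lo i w'" and hi: "free_hi i w = free_hi i w'"
    using sigma_free[of i w] sigma_free[of i w'] assms by simp_all
  show ?thesis
  proof (cases "free_hi i w \<le> free_lo i w")
    case True
    then have "(crystal_step i ^^ (free_lo i w - free_hi i w)) w (sigma i w)"
      "(crystal_step i ^^ (free_lo i w - free_hi i w)) w' (sigma i w)"
      using sigma_power(1)[of i w] sigma_power(1)[of i w'] assms lo hi by simp_all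
    then show ?thesis by (rule relpowp_inj[rotated]) (rule crystal_step_inj)
  next
    case False
    then have "(crystal_step i ^^ (free_hi i w - free_lo i w)) (sigma i w) w"
      "(crystal_step i ^^ (free_hi i w - free_lo i w)) (sigma i w) w'"
      using sigma_power(2)[of i w] sigma_power(2)[of i w'] assms lo hi by simp_all
    then show ?thesis by (rule relpowp_det[rotated]) (rule crystal_step_det)
  qed
qed

section \<open>Splitting and katabolism\<close>

lemma is_ksplit_Nil: "is_ksplit k lam [] \<longleftrightarrow> lam = []"
  by (auto simp: is_ksplit_def)

lemma is_ksplit_Cons:
  "is_ksplit k lam (p # S) \<longleftrightarrow> p \<noteq> [] \<and> (\<exists>rest. lam = p @ rest \<and> is_ksplit k rest S) \<and>
     main_hook p \<le> k \<and> (S \<noteq> [] \<longrightarrow> main_hook p = k)"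
proof -
  have "(\<forall>i. Suc i < length (p # S) \<longrightarrow> main_hook ((p # S) ! i) = k) \<longleftrightarrow>
    (S \<noteq> [] \<longrightarrow> main_hook p = k) \<and> (\<forall>i. Suc i < length S \<longrightarrow> main_hook (S ! i) = k)"
    by (auto simp: nth_Cons split: nat.splits)
  then show ?thesis unfolding is_ksplit_def by auto
qed

lemma is_ksplit_empty: "is_ksplit k [] S \<Longrightarrow> S = []"
  by (cases S) (auto simp: is_ksplit_Cons)

text \<open>
  All admissible first parts begin with the same number, so the main hook-length determines their
  lengths.
\<close>

lemma is_ksplit_unique: "is_ksplit k lam S \<Longrightarrow> is_ksplit k lam S' \<Longrightarrow> S = S'"
proof (induction S arbitrary: lam S')
  case Nil
  then show ?case using is_ksplit_empty[of k S'] by (simp add: is_ksplit_Nil)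
next
  case (Cons p S)
  then obtain r where r: "lam = p @ r" "is_ksplit k r S" "p \<noteq> []" "main_hook p \<le> k" "S \<noteq> [] \<longrightarrow> main_hook p = k"
    by (auto simp: is_ksplit_Cons)
  with Cons.prems(2) obtain q Q where S': "S' = q # Q" by (cases S') (auto simp: is_ksplit_Nil)
  with Cons.prems(2) obtain r' where r': "lam = q @ r'" "is_ksplit k r' Q" "q \<noteq> []" "main_hook q \<le> k"
      "Q \<noteq> [] \<longrightarrow> main_hook q = k"
    by (auto simp: is_ksplit_Cons)
  have hd: "hd p = hd q" using r(1,3) r'(1,3) by (metis hd_append2)
  have lens: "length p + length r = length q + length r'" using r(1) r'(1) by (metis length_append)
  have pos: "0 < length p" "0 < length q" using r(3) r'(3) by auto
  have nil: "S = [] \<Longrightarrow> r = []" "Q = [] \<Longrightarrow> r' = []" using r(2) r'(2) by (auto simp: is_ksplit_Nil)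
  have hooks: "main_hook p = hd q + length p - 1" "main_hook q = hd q + length q - 1"
    by (simp_all add: main_hook_def hd)
  have "length p = length q"
  proof (cases "S = []")
    case True
    then have r0: "length r = 0" using nil by simp
    show ?thesis
    proof (cases "Q = []")
      case True
      with r0 lens nil show ?thesis by simp
    next
      case False
      then have "hd q + length p - 1 \<le> hd q + length q - 1" using r(4) r'(5) hooks by simp
      with r0 lens pos show ?thesis by linarith
    qed
  next
    case False
    then have k: "hd q + length p - 1 = k" using r(5) hooks by simp
    show ?thesis
    proof (cases "Q = []")
      case True
      then have "length r' = 0" using nil by simp
      moreover have "hd q + length q - 1 \<le> hd q + length p - 1" using r'(4) hooks k by simp
      ultimately show ?thesis using lens pos by linarith
    next
      case False
      then have "hd q + length q - 1 = hd q + length p - 1" using r'(5) hooks k by simp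
      with pos show ?thesis by linarith
    qed
  qed
  then have "p = q" "r = r'" using r(1) r'(1) by auto
  with Cons.IH[OF r(2)] r'(2) S' show ?case by simp
qed

lemma partition_append: "is_partition (a @ b) \<Longrightarrow> is_partition a \<and> is_partition b"
  by (auto simp: is_partition_def sorted_wrt_append)

lemma k_bounded_append: "is_partition (a @ b) \<Longrightarrow> k_bounded k (a @ b) \<Longrightarrow> k_bounded k b"
  by (cases a; cases b) (auto simp: is_partition_def k_bounded_def)

lemma is_ksplit_exists: "is_partition lam \<Longrightarrow> k_bounded k lam \<Longrightarrow> \<exists>S. is_ksplit k lam S"
proof (induction "length lam" arbitrary: lam rule: less_induct)
  case less
  show ?case
  proof (cases lam)
    case Nil
    then show ?thesis using is_ksplit_Nil by blast
  next
    case (Cons x xs)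
    have x: "x \<le> k" using less.prems Cons by (simp add: k_bounded_def)
    define n where "n = min (length lam) (k - x + 1)"
    have n: "0 < n" by (simp add: n_def Cons)
    have split: "lam = take n lam @ drop n lam" by simp
    have "is_partition (drop n lam)" "k_bounded k (drop n lam)"
      using partition_append k_bounded_append split less.prems by metis+
    moreover have "length (drop n lam) < length lam" using n Cons by simp
    ultimately obtain S where S: "is_ksplit k (drop n lam) S" using less.hyps by blast
    have hook: "main_hook (take n lam) = x + n - 1"
      using n by (simp add: main_hook_def Cons n_def)
    have "main_hook (take n lam) \<le> k" using x hook by (simp add: n_def)
    moreover have "main_hook (take n lam) = k" if "S \<noteq> []"
    proof -
      have "drop n lam \<noteq> []" using that S is_ksplit_empty by metis
      then have "n = k - x + 1" by (simp add: n_def)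
      with hook x show ?thesis by simp
    qed
    ultimately have "is_ksplit k lam (take n lam # S)"
      unfolding is_ksplit_Cons using S n Cons split by (metis take_eq_Nil2 list.distinct(1) less_irrefl)
    then show ?thesis by blast
  qed
qed

lemma concat_ksplit:
  assumes "is_partition lam" "k_bounded k lam"
  shows "concat (ksplit k lam) = lam"
proof -
  have "\<exists>!S. is_ksplit k lam S" using is_ksplit_exists[OF assms] is_ksplit_unique by blast
  then have "is_ksplit k lam (ksplit k lam)" unfolding ksplit_def by (rule theI')
  then show ?thesis by (simp add: is_ksplit_def)
qed

lemma reading_word_empty_rows: "reading_word (replicate n []) = []"
  by (induction n) simp_all

text \<open>
  The tableau of shape \<open>a\<close> inside the canonical one fills its rows completely, so the katabolism just
  removes it.
\<close>

lemma katabolism_canonical: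
  assumes "is_partition (a @ b)"
  shows "katabolism a (canonical m (a @ b)) = {# canonical (m + length a) b #}"
proof -
  note p = partition_append[OF assms]
  let ?K = "canonical m (a @ b)"
  have K: "?K ! i = replicate (a ! i) (Suc (m + i))" if "i < length a" for i
    using that by (simp add: nth_canonical nth_append)
  have "contains_shape a ?K" by (simp add: contains_shape_def K)
  moreover have sub: "sub_tableau a ?K = canonical m a"
    unfolding sub_tableau_def by (rule nth_equalityI) (simp_all add: K nth_canonical nth_append)
  moreover have "canonical m a \<in> shifted_canonical a"
    unfolding shifted_canonical_def using p canonical_tableau by (auto simp: count_canonical intro!: exI[of _ m])
  moreover have "map2 drop a ?K = replicate (length a) []"
    by (rule nth_equalityI) (simp_all add: K nth_append)
  moreover have "drop (length a) ?K = canonical (m + length a) b" by (simp add: canonical_append)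
  moreover have "P_tab (reading_word (canonical (m + length a) b)) = canonical (m + length a) b"
    using p by (intro P_tab_reading canonical_tableau) simp
  ultimately show ?thesis by (simp add: katabolism_def reading_word_empty_rows)
qed

lemma lin_single [simp]: "lin f {#T#} = f T"
  by (simp add: lin_def)

lemma katabolisms_canonical:
  "is_partition (concat S) \<Longrightarrow> fold (\<lambda>lam. lin (katabolism lam)) S {# canonical m (concat S) #} = {#[]#}"
proof (induction S arbitrary: m)
  case (Cons a S)
  then have "is_partition (a @ concat S)" by simp
  from katabolism_canonical[OF this] Cons partition_append[OF this] show ?case by simp
qed simp

lemma canonical_passes_filter:
  assumes "is_partition lam" "k_bounded k lam"
  shows "katabolism_filter (ksplit k lam) (canonical 0 lam) = {# canonical 0 lam #}"
  using katabolisms_canonical[of "ksplit k lam" 0] concat_ksplit[OF assms] assms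
  by (simp add: katabolism_filter_def)

section \<open>Super atoms\<close>

text \<open>
  The product of the reflections permutes the evaluation cyclically: the last multiplicity becomes the
  first.
\<close>

lemma count_sigma_cycle:
  assumes "1 \<le> k" "k \<le> Suc m"
  shows "count_list (foldr sigma [k..<Suc m] w) y =
     (if y = k then count_list w (Suc m) else if k < y \<and> y \<le> Suc m then count_list w (y - 1) else count_list w y)"
  using assms(2,1)
proof (induction k arbitrary: y rule: inc_induct)
  case base
  then show ?case by simp
next
  case (step n)
  then have "[n..<Suc m] = n # [Suc n..<Suc m]" by (simp add: upt_conv_Cons del: upt_Suc)
  then show ?case
    using step.IH step.prems step.hyps by (auto simp: count_sigma simp del: upt_Suc)
qed

lemma foldr_sigma_inj: "foldr sigma js u = foldr sigma js v \<Longrightarrow> u = v"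
  by (induction js) (auto dest: sigma_inj)

lemma foldr_sigma_conn: "0 \<notin> set js \<Longrightarrow> crystal_conn {1..} w (foldr sigma js w)"
proof (induction js)
  case (Cons j js)
  then have "1 \<le> j" by (cases j) auto
  then show ?case using Cons conn_trans sigma_conn by auto
qed simp

text \<open>
  The evaluation is described by that of the canonical tableau.
\<close>

definition content_tableaux :: "nat list \<Rightarrow> tableau set" where
  "content_tableaux lam = {T. is_tableau T \<and> mset (reading_word T) = mset (reading_word (canonical 0 lam))}"

lemma content_count:
  assumes "T \<in> content_tableaux lam"
  shows "count_list (reading_word T) y = (if 0 < y \<and> y \<le> length lam then lam ! (y - 1) else 0)"
proof -
  have "count_list (reading_word T) y = count_list (reading_word (canonical 0 lam)) y"
    using assms by (simp add: content_tableaux_def flip: count_mset)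
  then show ?thesis by (simp add: count_canonical)
qed

lemma content_tableauxI:
  assumes "is_tableau T"
    "\<And>y. count_list (reading_word T) y = (if 0 < y \<and> y \<le> length lam then lam ! (y - 1) else 0)"
  shows "T \<in> content_tableaux lam"
proof -
  have "mset (reading_word T) = mset (reading_word (canonical 0 lam))"
  proof (rule multiset_eqI)
    fix y
    show "count (mset (reading_word T)) y = count (mset (reading_word (canonical 0 lam))) y"
      unfolding count_mset assms(2) count_canonical by simp
  qed
  with assms(1) show ?thesis by (simp add: content_tableaux_def)
qed

lemma content_max_letter:
  assumes "is_partition lam" "T \<in> content_tableaux lam"
  shows "max_letter (reading_word T) = length lam"
proof -
  have pos: "lam ! i > 0" if "i < length lam" for i
    using assms(1) that unfolding is_partition_def by (metis nth_mem not_gr_zero)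
  have "y \<in> set (reading_word T) \<longleftrightarrow> 0 < y \<and> y \<le> length lam" for y
  proof -
    have "y \<in> set (reading_word T) \<longleftrightarrow> count_list (reading_word T) y \<noteq> 0" by (simp add: count_list_0_iff)
    then show ?thesis using content_count[OF assms(2), of y] pos[of "y - 1"] by (cases y) auto
  qed
  then have "insert 0 (set (reading_word T)) = {0..length lam}"
    by (intro set_eqI) auto
  moreover have "Max {0..length lam} = length lam" by (rule Max_eqI) auto
  ultimately show ?thesis by (simp add: max_letter_def)
qed

lemma content_letters: "is_partition lam \<Longrightarrow> T \<in> content_tableaux lam \<Longrightarrow> \<forall>y\<in>set (reading_word T). y \<le> length lam"
  using content_max_letter unfolding max_letter_def by (metis Max_ge finite_insert insertCI List.finite_set)

text \<open>
  With a single added letter the Yamanouchi condition is empty.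
\<close>

lemma strips_lr: "{U. adds_strip (Suc m) x T U} = lr_tableaux m x 1 T"
  by (auto simp: lr_tableaux_def yamanouchi_iff)

context
  fixes x :: nat and xs :: "nat list"
  assumes part: "is_partition (x # xs)"
begin

lemma part_tail: "is_partition xs"
  using part by (simp add: is_partition_def)

abbreviation (input) "tail_cycle \<equiv> on_tableau (foldr sigma [1..<Suc (length xs)])"

lemma promotion_content:
  assumes "T \<in> content_tableaux xs"
  shows "promotion x T = image_mset tail_cycle (mset_set (lr_tableaux (length xs) x 1 T))"
  unfolding promotion_def Let_def content_max_letter[OF part_tail assms] strips_lr ..

lemma strip_rows:
  assumes T: "T \<in> content_tableaux xs" and U: "U \<in> lr_tableaux (length xs) x 1 T"
  obtains n where "is_tableau U" "\<And>i. row i U = row i T @ replicate (n i) (Suc (length xs))"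
    "count_list (reading_word U) (Suc (length xs)) = x"
proof -
  have tT: "is_tableau T" using T by (simp add: content_tableaux_def)
  from U obtain a where "is_tableau U" "\<And>i. row i U = row i T @ blocks (length xs) 1 (a i)"
    "count_list (reading_word U) (Suc (length xs)) = x"
    unfolding lr_tableaux_def add_strips_iff[OF tT content_letters[OF part_tail T]] by auto
  then show ?thesis using that[of "\<lambda>i. a i 0"] by (simp add: blocks_def)
qed

lemma tail_cycle_facts:
  assumes "is_tableau U"
  shows "is_tableau (tail_cycle U)" "reading_word (tail_cycle U) = foldr sigma [1..<Suc (length xs)] (reading_word U)"
    "shape (tail_cycle U) = shape U"
proof -
  have c: "crystal_conn {1..} (reading_word U) (foldr sigma [1..<Suc (length xs)] (reading_word U))"
    by (rule foldr_sigma_conn) auto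
  show "is_tableau (tail_cycle U)" "reading_word (tail_cycle U) = foldr sigma [1..<Suc (length xs)] (reading_word U)"
    "shape (tail_cycle U) = shape U"
    by (rule on_tableau_conn[of U "foldr sigma [1..<Suc (length xs)]", OF assms c])+
qed

lemma tail_cycle_content:
  assumes T: "T \<in> content_tableaux xs" and U: "U \<in> lr_tableaux (length xs) x 1 T"
  shows "tail_cycle U \<in> content_tableaux (x # xs)"
proof -
  obtain n where n: "is_tableau U" "\<And>i. row i U = row i T @ replicate (n i) (Suc (length xs))"
    "count_list (reading_word U) (Suc (length xs)) = x"
    by (rule strip_rows[OF T U]) blast
  define N where "N = max (length U) (length T)"
  have same: "count_list (reading_word U) y = count_list (reading_word T) y" if "y \<noteq> Suc (length xs)" for y
  proof -
    have "count_list (reading_word U) y = (\<Sum>i<N. count_list (row i U) y)"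
      by (rule count_reading_ge) (simp add: N_def)
    also have "\<dots> = (\<Sum>i<N. count_list (row i T) y)" using that by (simp add: n(2) count_replicate)
    also have "\<dots> = count_list (reading_word T) y"
      by (rule count_reading_ge[symmetric]) (simp add: N_def)
    finally show ?thesis .
  qed
  show ?thesis
  proof (rule content_tableauxI[OF tail_cycle_facts(1)[OF n(1)]])
    fix y
    have "count_list (reading_word (tail_cycle U)) y =
        count_list (foldr sigma [1..<Suc (length xs)] (reading_word U)) y"
      by (simp only: tail_cycle_facts(2)[OF n(1)])
    also have "\<dots> = (if y = 1 then x else if 1 < y \<and> y \<le> Suc (length xs) then count_list (reading_word U) (y - 1)
        else count_list (reading_word U) y)"
      by (subst count_sigma_cycle) (simp_all add: n(3))
    also have "\<dots> = (if 0 < y \<and> y \<le> length (x # xs) then (x # xs) ! (y - 1) else 0)"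
      using same[of y] same[of "y - 1"] content_count[OF T, of y] content_count[OF T, of "y - 1"]
      by (auto simp: nth_Cons split: nat.splits)
    finally show "count_list (reading_word (tail_cycle U)) y =
       (if 0 < y \<and> y \<le> length (x # xs) then (x # xs) ! (y - 1) else 0)" .
  qed
qed

lemma tail_cycle_inj:
  assumes "is_tableau U" "is_tableau U'" "tail_cycle U = tail_cycle U'"
  shows "U = U'"
proof -
  have "foldr sigma [1..<Suc (length xs)] (reading_word U) = foldr sigma [1..<Suc (length xs)] (reading_word U')"
    using tail_cycle_facts(2)[OF assms(1)] tail_cycle_facts(2)[OF assms(2)] assms(3) by metis
  then have "reading_word U = reading_word U'" by (rule foldr_sigma_inj)
  then show ?thesis using knuth_tableau_unique[OF assms(1,2)] by simp
qed

text \<open>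
  Removing the added letters recovers the tableau.
\<close>

lemma strips_disjoint:
  assumes T: "T \<in> content_tableaux xs" "T' \<in> content_tableaux xs"
    and U: "U \<in> lr_tableaux (length xs) x 1 T" "U \<in> lr_tableaux (length xs) x 1 T'"
  shows "T = T'"
proof -
  obtain n where n: "\<And>i. row i U = row i T @ replicate (n i) (Suc (length xs))"
    by (rule strip_rows[OF T(1) U(1)]) blast
  obtain n' where n': "\<And>i. row i U = row i T' @ replicate (n' i) (Suc (length xs))"
    by (rule strip_rows[OF T(2) U(2)]) blast
  have f: "filter (\<lambda>y. y \<le> length xs) (row i V @ replicate d (Suc (length xs))) = row i V"
    if "V \<in> content_tableaux xs" for V i d
    using content_letters[OF part_tail that] row_subset[of i V] by (auto simp: filter_id_conv)
  have "row i T = row i T'" for i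
  proof -
    have "row i T = filter (\<lambda>y. y \<le> length xs) (row i U)" by (simp only: n[of i] f[OF T(1)])
    moreover have "row i T' = filter (\<lambda>y. y \<le> length xs) (row i U)" by (simp only: n'[of i] f[OF T(2)])
    ultimately show ?thesis by simp
  qed
  then show ?thesis using T by (intro tableau_eqI_rows) (auto simp: content_tableaux_def)
qed

end

lemma sum_mset_set_disjoint:
  assumes "finite S" "\<And>T. T \<in> S \<Longrightarrow> finite (B T)"
    "\<And>T T' V. T \<in> S \<Longrightarrow> T' \<in> S \<Longrightarrow> V \<in> B T \<Longrightarrow> V \<in> B T' \<Longrightarrow> T = T'"
  shows "(\<Sum>T\<in>S. mset_set (B T)) = mset_set (\<Union>T\<in>S. B T)"
  using assms
proof (induction S rule: finite_induct)
  case (insert T S)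
  have "B T \<inter> (\<Union>T\<in>S. B T) = {}" using insert.prems(2) insert.hyps(2) by blast
  moreover have "finite (B T)" "finite (\<Union>T\<in>S. B T)" using insert by auto
  moreover have "(\<Sum>T\<in>S. mset_set (B T)) = mset_set (\<Union>T\<in>S. B T)"
    by (rule insert.IH) (use insert.prems in blast)+
  ultimately show ?case using insert.hyps by (simp add: mset_set_Union)
qed simp

lemma lin_mset_set: "lin f (mset_set S) = (\<Sum>T\<in>S. f T)"
  by (simp add: lin_def sum_unfold_sum_mset)

lemma lin_filter: "lin (\<lambda>T. if P T then {#T#} else {#}) M = filter_mset P M"
  by (induction M) (simp_all add: lin_def)

text \<open>
  Adding a strip can be undone because the added letter is known, and the reflections are injective.  All
  tableaux of the previous super atom have the same largest letter, so that the same reflections are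
  applied to all of them.
\<close>

lemma super_atom_multiplicity_free:
  "is_partition lam \<Longrightarrow> \<exists>S. finite S \<and> super_atom k lam = mset_set S \<and> S \<subseteq> content_tableaux lam"
proof (induction lam)
  case Nil
  show ?case
    by (intro exI[of _ "{[]}"]) (simp add: content_tableaux_def is_tableau_def is_partition_def shape_def)
next
  case (Cons x xs)
  note part = Cons.prems
  obtain S where S: "finite S" "super_atom k xs = mset_set S" "S \<subseteq> content_tableaux xs"
    using Cons.IH[OF part_tail[OF part]] by blast
  define g where "g = on_tableau (foldr sigma [1..<Suc (length xs)])"
  define R where "R = lr_tableaux (length xs) x 1"
  have tab: "is_tableau U" if "T \<in> S" "U \<in> R T" for T U
    using strip_rows[OF part, of T U] that S(3) unfolding R_def by blast
  have finR: "finite (R T)" if "T \<in> S" for T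
    unfolding R_def using that S(3) content_letters[OF part_tail[OF part]]
    by (intro finite_lr_tableaux) (auto simp: content_tableaux_def)
  have inj: "inj_on g (\<Union>T\<in>S. R T)"
    unfolding g_def by (rule inj_onI) (use tail_cycle_inj[OF part] tab in blast)
  have "lin (promotion x) (super_atom k xs) = (\<Sum>T\<in>S. mset_set (g ` R T))"
    unfolding S(2) lin_mset_set
  proof (rule sum.cong[OF refl])
    fix T assume T: "T \<in> S"
    then have "promotion x T = image_mset g (mset_set (R T))"
      unfolding g_def R_def using promotion_content[OF part] S(3) by blast
    also have "\<dots> = mset_set (g ` R T)"
      by (rule image_mset_mset_set) (rule inj_on_subset[OF inj], use T in blast)
    finally show "promotion x T = mset_set (g ` R T)" .
  qed
  also have "\<dots> = mset_set (\<Union>T\<in>S. g ` R T)"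
  proof (rule sum_mset_set_disjoint[OF S(1)])
    fix T T' V assume h: "T \<in> S" "T' \<in> S" "V \<in> g ` R T" "V \<in> g ` R T'"
    then obtain U U' where "U \<in> R T" "U' \<in> R T'" "g U = g U'" by auto
    with h inj have "U \<in> R T" "U \<in> R T'" by (auto dest: inj_onD)
    then show "T = T'" using strips_disjoint[OF part] h(1,2) S(3) unfolding R_def by blast
  qed (use finR in simp)
  finally have prom: "lin (promotion x) (super_atom k xs) = mset_set (\<Union>T\<in>S. g ` R T)" .
  define P where "P T \<longleftrightarrow> fold (\<lambda>lam. lin (katabolism lam)) (ksplit k (x # xs)) {#T#} = {#[]#}" for T
  have filt: "katabolism_filter (ksplit k (x # xs)) = (\<lambda>T. if P T then {#T#} else {#})"
    by (rule ext) (simp add: katabolism_filter_def P_def)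
  have fin: "finite (\<Union>T\<in>S. g ` R T)" using S(1) finR by blast
  have "super_atom k (x # xs) = filter_mset P (mset_set (\<Union>T\<in>S. g ` R T))"
    unfolding super_atom.simps prom filt lin_filter ..
  also have "\<dots> = mset_set {T \<in> (\<Union>T\<in>S. g ` R T). P T}"
    using fin by (simp add: filter_mset_mset_set)
  finally have "super_atom k (x # xs) = mset_set {T \<in> (\<Union>T\<in>S. g ` R T). P T}" .
  moreover have "{T \<in> (\<Union>T\<in>S. g ` R T). P T} \<subseteq> content_tableaux (x # xs)"
    unfolding g_def R_def using tail_cycle_content[OF part] S(3) by blast
  moreover have "finite {T \<in> (\<Union>T\<in>S. g ` R T). P T}"
    by (rule finite_subset[OF _ fin]) blast
  ultimately show ?case by blast
qed

lemma count_list_full: "count_list r y = length r \<Longrightarrow> r = replicate (length r) y"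
proof -
  assume full: "count_list r y = length r"
  have "count_list r y = length r \<longrightarrow> (\<forall>z\<in>set r. z = y)"
  proof (induction r)
    case (Cons a r)
    have "count_list r y \<le> length r" by (rule count_le_length)
    with Cons show ?case by auto
  qed simp
  with full show "r = replicate (length r) y" by (metis replicate_eqI)
qed

text \<open>
  By induction on the row, all letters \<open>i + 1\<close> must lie in row \<open>i\<close>, counted from \<open>0\<close>: the lower rows are already
  full, and the entries of the higher rows are larger.
\<close>

lemma shape_content_canonical:
  assumes V: "V \<in> content_tableaux lam" and sh: "shape V = lam"
  shows "V = canonical 0 lam"
proof -
  have tV: "is_tableau V" using V by (simp add: content_tableaux_def)
  have lV: "length V = length lam" unfolding sh[symmetric] by (simp add: shape_def)
  have len: "length (row i V) = lam ! i" if "i < length lam" for i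
  proof -
    have "length (V ! i) = shape V ! i" using that lV by (simp add: shape_def)
    then show ?thesis using that lV sh by (simp add: row_less)
  qed
  have "i < length lam \<Longrightarrow> row i V = replicate (lam ! i) (Suc i)" for i
  proof (induction i rule: less_induct)
    case (less i)
    have "count_list (row k V) (Suc i) = 0" if "k \<noteq> i" for k
    proof (cases "k < i")
      case True
      then show ?thesis using less.IH[OF True] less.prems by (simp add: count_replicate)
    next
      case False
      then have "Suc i \<notin> set (row k V)" using that tableau_entry_gt[OF tV, of "Suc i" k] by auto
      then show ?thesis by (simp add: count_list_0_iff)
    qed
    then have "(\<Sum>k<length V. count_list (row k V) (Suc i)) = count_list (row i V) (Suc i)"
      using sum.mono_neutral_right[of "{..<length V}" "{i}" "\<lambda>k. count_list (row k V) (Suc i)"] less.prems lV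
      by simp
    then have "count_list (row i V) (Suc i) = lam ! i"
      using content_count[OF V, of "Suc i"] less.prems by (simp add: count_reading)
    with len[OF less.prems] count_list_full[of "row i V" "Suc i"] show ?case by simp
  qed
  then have rows: "row i V = row i (canonical 0 lam)" for i
    by (cases "i < length lam") (simp_all add: row_less[of i "canonical 0 lam"] nth_canonical lV)
  have "is_tableau (canonical 0 lam)"
    using canonical_tableau tV sh unfolding is_tableau_def by blast
  from tableau_eqI_rows[OF tV this rows] show ?thesis .
qed

text \<open>
  Filling up row \<open>i\<close> of the canonical tableau, which has length \<open>(x # xs) ! (i + 1)\<close>, to length \<open>(x # xs) ! i\<close> adds a horizontal
  strip because the parts decrease.
\<close>

lemma canonical_strip:
  assumes part: "is_partition (x # xs)"
  shows "\<exists>U\<in>lr_tableaux (length xs) x 1 (canonical 0 xs). shape U = x # xs"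
proof -
  define m where "m = length xs"
  define lam where "lam = x # xs"
  define K where "K = canonical 0 xs"
  note pt = part_tail[OF part]
  have K: "is_tableau K" by (simp add: K_def canonical_tableau[OF pt])
  have rowK: "row i K = (if i < m then replicate (lam ! Suc i) (Suc i) else [])" for i
    by (simp add: K_def row_def nth_canonical m_def lam_def)
  define d where "d i = (if i \<le> m then lam ! i - length (row i K) else 0)" for i
  \<comment> \<open>row \<open>m\<close> is new and consists of added letters only\<close>
  define r where "r i = row i K @ replicate (d i) (Suc m)" for i
  have len: "length (r i) = (if i \<le> m then lam ! i else 0)" for i
    using partition_decreasing[OF part, of i "Suc i"] by (auto simp: r_def d_def rowK lam_def m_def)
  have le_all: "y \<le> Suc m" if "y \<in> set (r i)" for y i
    using that by (auto simp: r_def rowK split: if_splits)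
  have "\<exists>U. is_tableau U \<and> (\<forall>i. row i U = r i)"
  proof (rule tableau_of_rows[of r "Suc m"])
    fix i y
    show "le_count (r (Suc i)) (Suc y) \<le> le_count (r i) y"
    proof (cases "Suc y \<le> m")
      case True
      have "le_count (replicate n (Suc m)) z = 0" if "z \<le> m" for n z
        using that by (induction n) auto
      then show ?thesis using True tableau_interlacing[OF K, of i y] by (simp add: r_def)
    next
      case False
      have "le_count (r (Suc i)) (Suc y) \<le> length (r (Suc i))" by (rule le_count_le)
      also have "\<dots> \<le> length (row i K)" by (auto simp: len rowK)
      also have "\<dots> = le_count (row i K) y"
        using False by (intro le_count_all[symmetric]) (auto simp: rowK)
      also have "\<dots> \<le> le_count (r i) y" by (simp add: r_def)
      finally show ?thesis .
    qed
  qed (auto simp: r_def rowK d_def sorted_append sorted_replicate)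
  then obtain U where U: "is_tableau U" "\<And>i. row i U = r i" by blast
  have "length (row i U) = length (row i (canonical 0 lam))" for i
  proof -
    have "length (row i (canonical 0 lam)) = (if i \<le> m then lam ! i else 0)"
      by (auto simp: row_def nth_canonical lam_def m_def)
    then show ?thesis by (simp only: U(2) len)
  qed
  then have sh: "shape U = lam"
    using shape_eqI[OF U(1) canonical_tableau[of lam 0]] part by (simp add: lam_def)
  have "length (reading_word U) = length (reading_word K) + x"
    by (simp add: length_reading_word sh K_def lam_def)
  then have "adds_strip (Suc m) x K U"
    unfolding adds_strip_iff[OF K] using U by (auto simp: r_def)
  then have "U \<in> lr_tableaux m x 1 K" using strips_lr by blast
  with sh show ?thesis by (auto simp: m_def lam_def K_def)
qed

text \<open>
  The reflections turn the tableau of the previous lemma into a tableau with shape and evaluation \<open>\<lambda>\<close>,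
  which is the canonical one, and the katabolisms remove the canonical tableau part by part.
\<close>

lemma canonical_in_super_atom:
  "is_partition lam \<Longrightarrow> k_bounded k lam \<Longrightarrow> canonical 0 lam \<in># super_atom k lam"
proof (induction lam)
  case (Cons x xs)
  note part = Cons.prems(1)
  have b: "k_bounded k xs" using k_bounded_append[of "[x]" xs k] Cons.prems by simp
  have IH: "canonical 0 xs \<in># super_atom k xs" using Cons.IH[OF part_tail[OF part] b] .
  have cK: "canonical 0 xs \<in> content_tableaux xs"
    using canonical_tableau[OF part_tail[OF part]] by (simp add: content_tableaux_def)
  obtain U where U: "U \<in> lr_tableaux (length xs) x 1 (canonical 0 xs)" "shape U = x # xs"
    using canonical_strip[OF part] by blast
  define g where "g = on_tableau (foldr sigma [1..<Suc (length xs)])"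
  have tU: "is_tableau U" by (rule strip_rows[OF part cK U(1)])
  have "g U = canonical 0 (x # xs)"
    unfolding g_def
    by (rule shape_content_canonical[OF tail_cycle_content[OF part cK U(1)]])
      (simp only: tail_cycle_facts(3)[OF part tU] U(2))
  moreover have "finite (lr_tableaux (length xs) x 1 (canonical 0 xs))"
    using cK content_letters[OF part_tail[OF part] cK]
    by (intro finite_lr_tableaux) (auto simp: content_tableaux_def)
  ultimately have "canonical 0 (x # xs) \<in># promotion x (canonical 0 xs)"
    unfolding promotion_content[OF part cK] g_def[symmetric] using U(1) by (auto intro: rev_image_eqI)
  then have "canonical 0 (x # xs) \<in># lin (promotion x) (super_atom k xs)"
    using IH by (auto simp: lin_def)
  then show ?case
    using canonical_passes_filter[OF Cons.prems] by (force simp: lin_def)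
qed simp

section \<open>Charge\<close>

lemma sorted_rev_canonical: "sorted (rev (reading_word (canonical m lam)))"
proof (induction lam rule: rev_induct)
  case (snoc a lam)
  have "y \<le> m + length lam" if "y \<in> set (reading_word (canonical m lam))" for y
  proof (rule ccontr)
    assume "\<not> y \<le> m + length lam"
    then have "count_list (reading_word (canonical m lam)) y = 0" by (simp add: count_canonical)
    with that show False by (simp add: count_list_0_iff)
  qed
  with snoc show ?case
    by (auto simp: canonical_snoc sorted_append sorted_replicate le_SucI)
qed simp

lemma charge_step_eq:
  assumes "C = {q\<in>A. q < length v \<and> v ! q = j}" "D = {q\<in>C. s \<le> q}"
  shows "charge_step v j (A, s, l, c) =
    (if D \<noteq> {} then (A - {Min D}, Suc (Min D), l, c + l)
     else if C \<noteq> {} then (A - {Min C}, Suc (Min C), l + 1, c + (l + 1)) else (A, s, l, c))"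
  by (simp only: charge_step_def Let_def assms prod.case)

text \<open>
  In a sorted word all candidates for the next letter lie behind the letter labeled last, so the label is
  never increased.
\<close>

lemma charge_steps_sorted:
  assumes v: "sorted v"
  shows "\<forall>q<length v. j \<le> v ! q \<longrightarrow> s \<le> q \<Longrightarrow>
    \<exists>A' s'. fold (charge_step v) [j..<n] (A, s, 0, c) = (A', s', 0, c)"
proof (induction "n - j" arbitrary: j s A)
  case 0
  then show ?case by simp
next
  case (Suc d)
  then have up: "[j..<n] = j # [Suc j..<n]" by (simp add: upt_conv_Cons)
  define C where "C = {q\<in>A. q < length v \<and> v ! q = j}"
  have D: "{q\<in>C. s \<le> q} = C" using Suc.prems by (auto simp: C_def)
  have fin: "finite C" by (rule finite_subset[of _ "{..<length v}"]) (auto simp: C_def)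
  have d: "d = n - Suc j" using Suc.hyps(2) by simp
  show ?case
  proof (cases "C = {}")
    case True
    then have "charge_step v j (A, s, 0, c) = (A, s, 0, c)"
      by (simp add: charge_step_eq[OF C_def D[symmetric]])
    moreover have "\<forall>q<length v. Suc j \<le> v ! q \<longrightarrow> s \<le> q" using Suc.prems by auto
    ultimately show ?thesis using Suc.hyps(1)[OF d] unfolding up by simp
  next
    case False
    then have "charge_step v j (A, s, 0, c) = (A - {Min C}, Suc (Min C), 0, c)"
      by (simp add: charge_step_eq[OF C_def D[symmetric]])
    moreover have "\<forall>q<length v. Suc j \<le> v ! q \<longrightarrow> Suc (Min C) \<le> q"
    proof (intro allI impI)
      fix q assume q: "q < length v" "Suc j \<le> v ! q"
      have "Min C \<in> C" using fin False by (rule Min_in)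
      then have m: "Min C < length v" "v ! Min C = j" by (auto simp: C_def)
      show "Suc (Min C) \<le> q"
      proof (rule ccontr)
        assume "\<not> Suc (Min C) \<le> q"
        then have "v ! q \<le> v ! Min C" using sorted_nth_mono[OF v, of q "Min C"] m(1) by simp
        with m(2) q(2) show False by simp
      qed
    qed
    ultimately show ?thesis using Suc.hyps(1)[OF d] unfolding up by simp
  qed
qed

lemma charge_partition_sorted:
  assumes "sorted (rev w)"
  shows "charge_partition w = 0"
proof -
  have round: "\<exists>A'. charge_round (rev w) (A, c) = (A', c)" for A c
    using charge_steps_sorted[OF assms, of 1 0 "Suc (max_letter (rev w))" A c]
    unfolding charge_round_def by (auto simp del: upt_Suc)
  have "snd ((charge_round (rev w) ^^ n) (A, c)) = c" for n A c
  proof (induction n)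
    case (Suc n)
    obtain B where "(charge_round (rev w) ^^ n) (A, c) = (B, c)" using Suc by (metis prod.collapse)
    with round[of B c] show ?case by auto
  qed simp
  then show ?thesis by (simp add: charge_partition_def)
qed

lemma charge_step_mono: "charge_step v j (A, s, l, c) = (A', s', l', c') \<Longrightarrow> c \<le> c'"
  by (auto simp: charge_step_def Let_def split: if_splits)

lemma charge_steps_mono: "fold (charge_step v) js (A, s, l, c) = (A', s', l', c') \<Longrightarrow> c \<le> c'"
proof (induction js arbitrary: A s l c)
  case (Cons j js)
  obtain A1 s1 l1 c1 where 1: "charge_step v j (A, s, l, c) = (A1, s1, l1, c1)"
    by (cases "charge_step v j (A, s, l, c)") auto
  with Cons.prems have "fold (charge_step v) js (A1, s1, l1, c1) = (A', s', l', c')" by simp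
  from Cons.IH[OF this] charge_step_mono[OF 1] show ?case by simp
qed simp

definition labeled :: "nat list \<Rightarrow> nat set \<Rightarrow> nat \<Rightarrow> nat \<Rightarrow> nat" where
  "labeled v A n x = card {q. q < n \<and> q < length v \<and> q \<notin> A \<and> v ! q = x}"

text \<open>
  The state in round \<open>t\<close>, counted from \<open>0\<close>, before letter \<open>j\<close> is handled, as long as all labels are \<open>0\<close>.  The last
  clause is the reserve that keeps the third one true when a letter \<open>j\<close> is labeled: a letter \<open>j - 1\<close> has
  just been labeled at position \<open>s - 1\<close>.
\<close>

definition charge_inv :: "nat list \<Rightarrow> nat \<Rightarrow> nat \<Rightarrow> nat set \<Rightarrow> nat \<Rightarrow> bool" where
  "charge_inv v t j A s \<longleftrightarrow> A \<subseteq> {..<length v} \<and>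
     (\<forall>i\<ge>1. card {q\<in>A. v ! q = i} = count_list v i - (if i < j then Suc t else t)) \<and>
     (\<forall>x\<ge>1. \<forall>n. labeled v A n (Suc x) \<le> labeled v A n x) \<and>
     (2 \<le> j \<longrightarrow> t < count_list v j \<longrightarrow> (\<forall>n\<ge>s. labeled v A n j < labeled v A n (j - 1)))"

lemma labeled_remove:
  assumes "p \<in> A" "p < length v"
  shows "labeled v (A - {p}) n x = labeled v A n x + (if p < n \<and> v ! p = x then 1 else 0)"
proof (cases "p < n \<and> v ! p = x")
  case True
  then have "{q. q < n \<and> q < length v \<and> q \<notin> A - {p} \<and> v ! q = x} =
     insert p {q. q < n \<and> q < length v \<and> q \<notin> A \<and> v ! q = x}" using assms by auto
  with True assms(1) show ?thesis by (simp add: labeled_def)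
next
  case False
  then have "{q. q < n \<and> q < length v \<and> q \<notin> A - {p} \<and> v ! q = x} =
     {q. q < n \<and> q < length v \<and> q \<notin> A \<and> v ! q = x}" by auto
  with False show ?thesis by (simp add: labeled_def)
qed

text \<open>
  Since no label becomes positive, the next letter \<open>j\<close> is found behind the letter \<open>j - 1\<close> just labeled.
\<close>

lemma charge_inv_step:
  assumes dec: "\<And>i. 1 \<le> i \<Longrightarrow> count_list v (Suc i) \<le> count_list v i" and j: "1 \<le> j"
    and inv: "charge_inv v t j A s" and step: "charge_step v j (A, s, 0, 0) = (A', s', l', 0)"
  shows "charge_inv v t (Suc j) A' s' \<and> l' = 0"
proof -
  from inv have sub: "A \<subseteq> {..<length v}"
    and card: "\<And>i. 1 \<le> i \<Longrightarrow> card {q\<in>A. v ! q = i} = count_list v i - (if i < j then Suc t else t)"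
    and dom: "\<And>x n. 1 \<le> x \<Longrightarrow> labeled v A n (Suc x) \<le> labeled v A n x"
    and gap: "\<And>n. 2 \<le> j \<Longrightarrow> t < count_list v j \<Longrightarrow> s \<le> n \<Longrightarrow> labeled v A n j < labeled v A n (j - 1)"
    unfolding charge_inv_def by auto
  define C where "C = {q\<in>A. q < length v \<and> v ! q = j}"
  define D where "D = {q\<in>C. s \<le> q}"
  have C: "C = {q\<in>A. v ! q = j}" using sub by (auto simp: C_def)
  have fin: "finite C" "finite D" using finite_subset[OF sub] by (auto simp: C_def D_def)
  have cC: "card C = count_list v j - t" using card[OF j] C by simp
  note step' = step[unfolded charge_step_eq[OF C_def D_def]]
  show ?thesis
  proof (cases "D = {}")
    case True
    with step' have C0: "C = {}" and r: "A' = A" "s' = s" "l' = 0" by (auto split: if_splits)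
    have le: "count_list v j \<le> t" using cC C0 by simp
    have "card {q\<in>A. v ! q = i} = count_list v i - (if i < Suc j then Suc t else t)" if "1 \<le> i" for i
      using card[OF that] le by (cases "i = j") auto
    moreover have "\<not> t < count_list v (Suc j)" using le dec[OF j] by simp
    ultimately show ?thesis using sub dom unfolding charge_inv_def r by auto
  next
    case False
    define p where "p = Min D"
    have r: "A' = A - {p}" "s' = Suc p" "l' = 0" using step' False by (auto simp: p_def)
    have "p \<in> D" unfolding p_def using fin(2) False by (rule Min_in)
    then have p: "p \<in> A" "p < length v" "v ! p = j" "s \<le> p" "p \<in> C" by (auto simp: D_def C_def)
    have "0 < card C" using p(5) fin(1) by (auto simp: card_gt_0_iff)
    then have t: "t < count_list v j" using cC by simp
    note lab = labeled_remove[OF p(1,2)]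
    have "card {q\<in>A - {p}. v ! q = i} = count_list v i - (if i < Suc j then Suc t else t)" if i: "1 \<le> i" for i
    proof (cases "i = j")
      case True
      have "{q\<in>A - {p}. v ! q = i} = C - {p}" using C True by auto
      then have "card {q\<in>A - {p}. v ! q = i} = card C - 1" using p(5) by simp
      then show ?thesis using cC True by simp
    next
      case False
      then have "{q\<in>A - {p}. v ! q = i} = {q\<in>A. v ! q = i}" using p(3) by auto
      then show ?thesis using card[OF i] False by auto
    qed
    moreover have "labeled v (A - {p}) n (Suc x) \<le> labeled v (A - {p}) n x" if x: "1 \<le> x" for x n
    proof (cases "Suc x = j \<and> p < n")
      case True
      then have jx: "j = Suc x" and n: "p < n" by simp_all
      have "labeled v A n (Suc x) < labeled v A n x" using gap[of n] t p(4) x n unfolding jx by simp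
      with n show ?thesis using p(3) jx by (simp add: lab)
    next
      case False
      then show ?thesis using dom[OF x, of n] p(3) by (auto simp: lab)
    qed
    moreover have "labeled v (A - {p}) n (Suc j) < labeled v (A - {p}) n j" if "Suc p \<le> n" for n
      using dom[OF j, of n] that p(3) by (simp add: lab)
    ultimately show ?thesis using sub unfolding charge_inv_def r by auto
  qed
qed

lemma charge_inv_steps:
  assumes dec: "\<And>i. 1 \<le> i \<Longrightarrow> count_list v (Suc i) \<le> count_list v i"
  shows "1 \<le> j \<Longrightarrow> j \<le> n \<Longrightarrow> charge_inv v t j A s \<Longrightarrow>
    fold (charge_step v) [j..<n] (A, s, 0, 0) = (A', s', l', 0) \<Longrightarrow> charge_inv v t n A' s'"
proof (induction "n - j" arbitrary: j s A)
  case 0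
  then show ?case by simp
next
  case (Suc d)
  then have up: "[j..<n] = j # [Suc j..<n]" by (simp add: upt_conv_Cons)
  have d: "d = n - Suc j" using Suc.hyps(2) by simp
  obtain A1 s1 l1 c1 where 1: "charge_step v j (A, s, 0, 0) = (A1, s1, l1, c1)"
    by (cases "charge_step v j (A, s, 0, 0)") auto
  have f: "fold (charge_step v) [Suc j..<n] (A1, s1, l1, c1) = (A', s', l', 0)"
    using Suc.prems(4) 1 unfolding up by simp
  then have c1: "c1 = 0" using charge_steps_mono[OF f] by simp
  have "charge_inv v t (Suc j) A1 s1 \<and> l1 = 0"
    by (rule charge_inv_step[OF dec Suc.prems(1,3)]) (use 1 c1 in simp_all)
  moreover have "Suc j \<le> n" using Suc.hyps(2) by simp
  ultimately show ?case using Suc.hyps(1)[OF d, of A1 s1] f c1 by simp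
qed

lemma charge_inv_round:
  assumes dec: "\<And>i. 1 \<le> i \<Longrightarrow> count_list v (Suc i) \<le> count_list v i"
    and inv: "charge_inv v t 1 A 0" and round: "charge_round v (A, 0) = (A', 0)"
  shows "charge_inv v (Suc t) 1 A' 0"
proof -
  let ?n = "Suc (max_letter v)"
  obtain B s l c where f: "fold (charge_step v) [1..<?n] (A, 0, 0, 0) = (B, s, l, c)"
    by (cases "fold (charge_step v) [1..<?n] (A, 0, 0, 0)") auto
  with round have "B = A'" "c = 0" by (simp_all add: charge_round_def del: upt_Suc)
  with f have "charge_inv v t ?n A' s" using charge_inv_steps[OF dec, of 1 ?n t A 0] inv by simp
  moreover have "count_list v i = 0" if "\<not> i < ?n" for i
  proof -
    have "i \<notin> set v"
    proof
      assume "i \<in> set v"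
      then have "i \<le> max_letter v" unfolding max_letter_def by (intro Max_ge) auto
      with that show False by simp
    qed
    then show ?thesis by (simp add: count_list_0_iff)
  qed
  ultimately show ?thesis unfolding charge_inv_def
    by (auto split: if_splits)
qed

text \<open>
  If no label is positive, every round labels letters \<open>1, 2, 3, \<dots>\<close> that are met in this order, so that
  every prefix of the word as it is read contains at least as many letters \<open>x\<close> as \<open>x + 1\<close>.
\<close>

lemma charge_partition_0_highest:
  assumes part: "partition_evaluation w" and pos: "0 \<notin> set w" and charge: "charge_partition w = 0"
  shows "highest_weight {1..} w"
proof -
  define v where "v = rev w"
  have cv: "count_list v i = count_list w i" for i by (simp add: v_def)
  have dec: "count_list v (Suc i) \<le> count_list v i" if "1 \<le> i" for i
    using part that by (simp add: partition_evaluation_def cv)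
  have mono: "snd x \<le> snd (charge_round v x)" for x
  proof -
    obtain A c where x: "x = (A, c)" by (cases x)
    obtain B s l c' where f: "fold (charge_step v) [1..<Suc (max_letter v)] (A, 0, 0, c) = (B, s, l, c')"
      by (cases "fold (charge_step v) [1..<Suc (max_letter v)] (A, 0, 0, c)") auto
    from charge_steps_mono[OF this] f show ?thesis by (simp add: x charge_round_def del: upt_Suc)
  qed
  have "snd ((charge_round v ^^ n) x) = 0 \<Longrightarrow> x = ({..<length v}, 0) \<Longrightarrow>
      charge_inv v n 1 (fst ((charge_round v ^^ n) x)) 0" for n x
  proof (induction n)
    case 0
    have "card {q \<in> {..<length v}. v ! q = i} = count_list v i" for i
      by (simp add: count_list_eq_length_filter length_filter_conv_card eq_commute)
    moreover have "labeled v {..<length v} n x = 0" for n x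
      unfolding labeled_def by (subst card_eq_0_iff) auto
    ultimately show ?case using 0 by (simp add: charge_inv_def)
  next
    case (Suc n)
    let ?y = "(charge_round v ^^ n) x"
    have y0: "snd ?y = 0" using Suc.prems(1) mono[of ?y] by simp
    then have "charge_inv v n 1 (fst ?y) 0" using Suc by simp
    moreover have "charge_round v (fst ?y, 0) = (fst (charge_round v ?y), 0)"
      using Suc.prems(1) y0 by (metis funpow.simps(2) comp_apply prod.collapse)
    ultimately show ?case using charge_inv_round[OF dec] by simp
  qed
  from this[of "count_list w 1" "({..<length v}, 0)"] charge
  obtain A where inv: "charge_inv v (count_list w 1) 1 A 0"
    by (auto simp: charge_partition_def v_def)
  have le1: "count_list v i \<le> count_list v 1" if "1 \<le> i" for i
    using that by (induction i rule: dec_induct) (use dec in \<open>auto intro: order_trans\<close>)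
  have "A = {}"
  proof (rule ccontr)
    assume "A \<noteq> {}"
    then obtain q where q: "q \<in> A" by blast
    have sub: "A \<subseteq> {..<length v}" using inv by (simp add: charge_inv_def)
    then have "v ! q \<in> set v" using q by auto
    then have "v ! q \<noteq> 0" using pos unfolding v_def set_rev by metis
    then have i: "1 \<le> v ! q" by simp
    have "card {p\<in>A. v ! p = v ! q} = count_list v (v ! q) - count_list w 1"
      using inv i by (simp add: charge_inv_def)
    then have "card {p\<in>A. v ! p = v ! q} = 0" using le1[OF i] by (simp add: cv)
    moreover have "finite {p\<in>A. v ! p = v ! q}" using finite_subset[OF sub] by simp
    ultimately show False using q by auto
  qed
  have lab: "labeled v {} n x = count_list (take n v) x" for n x
  proof -
    have "{q. q < n \<and> q < length v \<and> v ! q = x} = {q. q < length (take n v) \<and> x = take n v ! q}"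
      by auto
    then show ?thesis
      by (simp add: labeled_def count_list_eq_length_filter length_filter_conv_card)
  qed
  have "count_list (drop n w) (Suc x) \<le> count_list (drop n w) x" if "1 \<le> x" for n x
  proof -
    have "count_list (take (length w - n) v) (Suc x) \<le> count_list (take (length w - n) v) x"
      using inv that unfolding \<open>A = {}\<close> charge_inv_def lab by blast
    moreover have "take (length w - n) v = rev (drop n w)" 
      by (cases "n \<le> length w") (simp_all add: v_def take_rev)
    ultimately show ?thesis by simp
  qed
  then show ?thesis by (simp add: highest_weight_def free_hi_0_iff)
qed

section \<open>Super atoms are copies of themselves\<close>

lemma content_partition_evaluation:
  assumes "is_partition lam" "T \<in> content_tableaux lam"
  shows "partition_evaluation (reading_word T)"
  unfolding partition_evaluation_def
proof (intro allI impI)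
  fix i :: nat assume i: "1 \<le> i"
  show "count_list (reading_word T) (Suc i) \<le> count_list (reading_word T) i"
    using i partition_decreasing[OF assms(1), of "i - 1" i] by (simp add: content_count[OF assms(2)])
qed

text \<open>
  A tableau of charge \<open>0\<close> is Yamanouchi, and there is only one Yamanouchi tableau of given evaluation.
\<close>

lemma content_charge_pos:
  assumes lam: "is_partition lam" and U: "U \<in> content_tableaux lam" and ne: "U \<noteq> canonical 0 lam"
  shows "charge (canonical 0 lam) < charge U"
proof -
  have tU: "is_tableau U" using U by (simp add: content_tableaux_def)
  have tK: "is_tableau (canonical 0 lam)" by (rule canonical_tableau[OF lam])
  then have K: "canonical 0 lam \<in> content_tableaux lam" by (simp add: content_tableaux_def)
  have ch: "charge V = charge_partition (reading_word V)" if "V \<in> content_tableaux lam" for V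
    using content_partition_evaluation[OF lam that] by (simp add: charge_def word_charge_def)
  have "charge U \<noteq> 0"
  proof
    assume "charge U = 0"
    then have "highest_weight {1..} (reading_word U)"
      using charge_partition_0_highest[OF content_partition_evaluation[OF lam U] tableau_no_zero[OF tU]] ch[OF U] by simp
    then have "knuth_equiv (reading_word U) (reading_word (canonical 0 lam))"
      by (rule yamanouchi_knuth[OF _ canonical_highest[OF lam] tableau_no_zero[OF tU] tableau_no_zero[OF tK]])
        (use U in \<open>simp add: content_tableaux_def\<close>)
    then have "U = canonical 0 lam" by (rule knuth_tableau_unique[OF tU tK])
    with ne show False by simp
  qed
  moreover have "charge (canonical 0 lam) = 0"
    unfolding ch[OF K] by (rule charge_partition_sorted[OF sorted_rev_canonical])
  ultimately show ?thesis by simp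
qed

lemma same_diagram_refl: "same_diagram X X"
  unfolding same_diagram_def by (rule exI[of _ "\<lambda>T. T"]) (simp add: bij_betw_def)

text \<open>
  The identity is the isomorphism of diagrams, and the canonical tableau is the one of minimal charge.
\<close>

lemma super_atom_is_copy:
  assumes lam: "is_partition lam" "k_bounded k lam"
  shows "is_copy k (set_mset (super_atom k lam)) (canonical 0 lam)"
proof -
  obtain S where S: "finite S" "super_atom k lam = mset_set S" "S \<subseteq> content_tableaux lam"
    using super_atom_multiplicity_free[OF lam(1)] by blast
  have set: "set_mset (super_atom k lam) = S" using S by simp
  have "mset (reading_word T) = mset (reading_word (canonical 0 lam))" if "T \<in> S" for T
    using S(3) that by (auto simp: content_tableaux_def)
  then have "same_evaluation S" by (simp add: same_evaluation_def)
  moreover have "\<forall>U\<in>S. is_tableau U" using S(3) by (auto simp: content_tableaux_def)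
  moreover have "canonical 0 lam \<in> S" using canonical_in_super_atom[OF lam] set by simp
  moreover have "\<forall>U\<in>S. U \<noteq> canonical 0 lam \<longrightarrow> charge (canonical 0 lam) < charge U"
    using content_charge_pos[OF lam(1)] S(3) by blast
  ultimately show ?thesis unfolding is_copy_def set shape_canonical by (simp add: set same_diagram_refl)
qed

section \<open>Rectangular promotion and Schur functions\<close>

text \<open>
  The rectangular reflections keep the shapes, so that only the Littlewood--Richardson tableaux on top of
  \<open>T\<close> matter.
\<close>

lemma rect_promotion_schur:
  assumes T: "is_tableau T" and l: "1 \<le> l"
  shows "(\<Sum>V\<in>#rect_promotion l h T. schur (shape V) M) =
    (series_mult (schur (rect l h)) (schur (shape T)) M :: 'c::comm_semiring_1)"
proof -
  define m where "m = max_letter (reading_word T)"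
  have m: "\<forall>y\<in>set (reading_word T). y \<le> m" by (simp add: m_def max_letter_def)
  define g where "g = on_tableau (foldr (rect_sigma h) [1..<Suc m])"
  have sh: "shape (g U) = shape U" if "U \<in> lr_tableaux m l h T" for U
  proof -
    have "is_tableau U" using that unfolding lr_tableaux_def add_strips_iff[OF T m] by blast
    then show ?thesis
      unfolding g_def by (rule on_tableau_conn(3)) (rule rect_sigmas_conn, simp)
  qed
  have "rect_promotion l h T = image_mset g (mset_set (lr_tableaux m l h T))"
    by (simp add: rect_promotion_def Let_def m_def g_def lr_tableaux_def)
  then have "(\<Sum>V\<in>#rect_promotion l h T. schur (shape V) M :: 'c) = (\<Sum>U\<in>lr_tableaux m l h T. schur (shape (g U)) M)"
    by (simp add: sum_unfold_sum_mset image_mset.compositionality comp_def)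
  also have "\<dots> = (\<Sum>U\<in>lr_tableaux m l h T. schur (shape U) M)"
    by (rule sum.cong[OF refl]) (simp only: sh)
  also have "\<dots> = series_mult (schur (rect l h)) (schur (shape T)) M"
    by (rule littlewood_richardson[OF T m l])
  finally show ?thesis .
qed

lemma specialize_atom:
  assumes "super_atom k lam = mset_set S"
  shows "specialize (atom k lam) 1 M = (\<Sum>T\<in>S. schur (shape T) M)"
  by (simp add: specialize_def atom_def digamma_def assms poly_sum poly_monom schur_def
      flip: sum_unfold_sum_mset)

lemma sum_lin:
  fixes f :: "tableau \<Rightarrow> int"
  shows "(\<Sum>V\<in>#lin p M. f V) = (\<Sum>T\<in>#M. \<Sum>V\<in>#p T. f V)"
  by (induction M) (simp_all add: lin_def)

lemma part_union_partition:
  assumes "is_partition lam" "k_bounded k lam" "1 \<le> l" "l \<le> k"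
  shows "is_partition (part_union lam (rect l h))" "k_bounded k (part_union lam (rect l h))"
proof -
  have set: "set (part_union lam (rect l h)) \<subseteq> set lam \<union> {l}"
    by (auto simp: part_union_def rect_def)
  have "sorted (sort (lam @ rect l h))" by simp
  then have "sorted_wrt (\<ge>) (part_union lam (rect l h))"
    by (simp only: part_union_def sorted_wrt_rev)
  with set assms(1,3) show "is_partition (part_union lam (rect l h))"
    by (auto simp: is_partition_def)
  have "y \<le> k" if "y \<in> set lam" for y
    using that assms(1,2) by (cases lam) (auto simp: is_partition_def k_bounded_def)
  then have "\<forall>y\<in>set (part_union lam (rect l h)). y \<le> k" using set assms(4) by auto
  then show "k_bounded k (part_union lam (rect l h))"
    by (auto simp: k_bounded_def)
qed

theorem corollary24:
  assumes rect_promotion_copies: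
    "\<And>k l lam X T. 1 \<le> k \<Longrightarrow> l \<in> {1..k} \<Longrightarrow> is_partition lam \<Longrightarrow> k_bounded k lam \<Longrightarrow>
       is_copy k X T \<Longrightarrow> shape T = lam \<Longrightarrow>
       \<exists>T' X'. shape T' = part_union lam (rect l (k - l + 1)) \<and>
               lin (rect_promotion l (k - l + 1)) (mset_set X) = mset_set X' \<and>
               is_copy k X' T'"
  shows "\<forall>k lam l. 1 \<le> k \<longrightarrow> is_partition lam \<longrightarrow> k_bounded k lam \<longrightarrow> l \<in> {1..k} \<longrightarrow>
       series_mult (schur (rect l (k - l + 1))) (specialize (atom k lam) 1) =
       specialize (atom k (part_union lam (rect l (k - l + 1)))) 1"
proof (intro allI impI ext)
  fix k l :: nat and lam and M :: "nat multiset"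
  assume k: "1 \<le> k" and lam: "is_partition lam" "k_bounded k lam" and l: "l \<in> {1..k}"
  define h where "h = k - l + 1"
  define mu where "mu = part_union lam (rect l h)"
  obtain S where S: "finite S" "super_atom k lam = mset_set S" "S \<subseteq> content_tableaux lam"
    using super_atom_multiplicity_free[OF lam(1)] by blast
  have "is_partition mu"
    unfolding mu_def by (rule part_union_partition(1)[OF lam]) (use l in auto)
  then obtain S' where S': "finite S'" "super_atom k mu = mset_set S'"
    using super_atom_multiplicity_free by blast
  obtain T' X' where T': "shape T' = mu" "lin (rect_promotion l h) (mset_set S) = mset_set X'" "is_copy k X' T'"
    using rect_promotion_copies[OF k l lam super_atom_is_copy[OF lam] shape_canonical] S
    unfolding h_def mu_def by auto
  \<comment> \<open>the tableaux of two copies correspond to each other with their shapes\<close>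
  from T'(3) S' obtain f where f: "bij_betw f X' S'" "\<forall>T\<in>X'. shape (f T) = shape T"
    unfolding is_copy_def T'(1) same_diagram_def by auto
  have finX: "finite X'" using bij_betw_finite[OF f(1)] S'(1) by simp
  have "specialize (atom k mu) 1 M = (\<Sum>U\<in>S'. schur (shape U) M)"
    by (rule specialize_atom[OF S'(2)])
  also have "\<dots> = (\<Sum>V\<in>X'. schur (shape (f V)) M)"
    by (rule sum.reindex_bij_betw[OF f(1), symmetric])
  also have "\<dots> = (\<Sum>V\<in>X'. schur (shape V) M)"
    by (rule sum.cong[OF refl]) (simp add: f(2))
  also have "\<dots> = (\<Sum>V\<in>#lin (rect_promotion l h) (mset_set S). schur (shape V) M)"
    by (simp add: T'(2) sum_unfold_sum_mset)
  also have "\<dots> = (\<Sum>T\<in>S. \<Sum>V\<in>#rect_promotion l h T. schur (shape V) M)"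
    by (simp add: sum_lin sum_unfold_sum_mset)
  also have "\<dots> = (\<Sum>T\<in>S. series_mult (schur (rect l h)) (schur (shape T)) M)"
  proof (rule sum.cong[OF refl])
    fix T assume "T \<in> S"
    then have "is_tableau T" using S(3) by (auto simp: content_tableaux_def)
    then show "(\<Sum>V\<in>#rect_promotion l h T. schur (shape V) M) =
        (series_mult (schur (rect l h)) (schur (shape T)) M :: int)"
      by (rule rect_promotion_schur) (use l in simp)
  qed
  also have "\<dots> = series_mult (schur (rect l h)) (specialize (atom k lam) 1) M"
    unfolding series_mult_def specialize_atom[OF S(2)] sum_distrib_left by (rule sum.swap)
  finally show "series_mult (schur (rect l (k - l + 1))) (specialize (atom k lam) 1) M =
       specialize (atom k (part_union lam (rect l (k - l + 1)))) 1 M"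
    by (simp add: h_def mu_def)
qed

end
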